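(* For every integer $n\geq 2$ and every $\epsilon>0$, there exists a compact $n$-dimensional hyperbolic manifold $M$ with $\operatorname{Syst}_1(M)<\epsilon$.
   Context: $\mathcal{H}^n$ denotes hyperbolic $n$-space and $\operatorname{Isom}(\mathcal{H}^n)$ its group of isometries. A compact hyperbolic $n$-manifold is a quotient $M=\Gamma\backslash\mathcal{H}^n$, where $\Gamma$ is a cocompact torsion-free discrete subgroup of $\operatorname{Isom}(\mathcal{H}^n)$. The systole $\operatorname{Syst}_1(M)$ of a compact Riemannian manifold $M$ is the length of a shortest closed geodesic in $M$. *)

theory Defs
  imports "HOL-Analysis.Analysis" "HOL-Algebra.Group"
begin

section \<open>Hyperbolic space\<close>

text \<open>
  The hyperboloid model: the upper sheet of \<open>\<langle>p, p\<rangle> = -1\<close> in Minkowski space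
  \<open>\<real>\<^sup>n \<times> \<real>\<close>, with the distance determined by \<open>cosh d(p, q) = -\<langle>p, q\<rangle>\<close>.
\<close>

definition minkowski :: "(real ^ 'n) \<times> real \<Rightarrow> (real ^ 'n) \<times> real \<Rightarrow> real" where
  "minkowski p q = fst p \<bullet> fst q - snd p * snd q"

typedef 'n hyperbolic =
  "{p :: (real ^ 'n) \<times> real. minkowski p p = -1 \<and> snd p > 0}"
  by (rule exI[of _ "(0, 1)"]) (simp add: minkowski_def)

lemma minkowski_commute: "minkowski p q = minkowski q p"
  by (simp add: minkowski_def inner_commute mult.commute)

lemma minkowski_add_left: "minkowski (p + q) r = minkowski p r + minkowski q r"
  by (simp add: minkowski_def inner_add_left algebra_simps)

lemma minkowski_scaleR_left: "minkowski (c *\<^sub>R p) r = c * minkowski p r"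
  by (simp add: minkowski_def algebra_simps)

lemma minkowski_diff_left: "minkowski (p - q) r = minkowski p r - minkowski q r"
  by (simp add: minkowski_def inner_diff_left algebra_simps)

lemma minkowski_add_right: "minkowski r (p + q) = minkowski r p + minkowski r q"
  by (simp add: minkowski_def inner_add_right algebra_simps)

lemma minkowski_scaleR_right: "minkowski r (c *\<^sub>R p) = c * minkowski r p"
  by (simp add: minkowski_def algebra_simps)

lemma minkowski_diff_right: "minkowski r (p - q) = minkowski r p - minkowski r q"
  by (simp add: minkowski_def inner_diff_right algebra_simps)

lemmas minkowski_simps =
  minkowski_add_left minkowski_scaleR_left minkowski_diff_left
  minkowski_add_right minkowski_scaleR_right minkowski_diff_right

lemma minkowski_Rep_hyperbolic: "minkowski (Rep_hyperbolic x) (Rep_hyperbolic x) = -1"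
  using Rep_hyperbolic[of x] by simp

lemma snd_Rep_hyperbolic: "snd (Rep_hyperbolic x) > 0"
  using Rep_hyperbolic[of x] by simp

lemma minkowski_orthogonal_bound:
  assumes q: "minkowski q q = -1" and w: "minkowski w q = 0"
  shows "(snd w)\<^sup>2 \<le> minkowski w w * (snd q)\<^sup>2"
proof -
  have q2: "fst q \<bullet> fst q = (snd q)\<^sup>2 - 1"
    using q by (simp add: minkowski_def power2_eq_square)
  have "(snd w * snd q)\<^sup>2 = (fst w \<bullet> fst q)\<^sup>2"
    using w by (simp add: minkowski_def)
  also have "\<dots> \<le> (fst w \<bullet> fst w) * (fst q \<bullet> fst q)"
    by (rule Cauchy_Schwarz_ineq)
  finally have le: "(snd w)\<^sup>2 * (snd q)\<^sup>2 \<le> (fst w \<bullet> fst w) * ((snd q)\<^sup>2 - 1)"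
    by (simp add: q2 power_mult_distrib)
  moreover have "minkowski w w * (snd q)\<^sup>2 =
      (fst w \<bullet> fst w) * (snd q)\<^sup>2 - (snd w)\<^sup>2 * (snd q)\<^sup>2"
    by (simp add: minkowski_def power2_eq_square left_diff_distrib)
  moreover have "(snd w)\<^sup>2 \<le> fst w \<bullet> fst w"
  proof (rule ccontr)
    assume "\<not> ?thesis"
    hence *: "fst w \<bullet> fst w < (snd w)\<^sup>2" by simp
    have "(snd q)\<^sup>2 - 1 \<ge> 0" by (simp flip: q2)
    hence "(fst w \<bullet> fst w) * ((snd q)\<^sup>2 - 1) \<le> (snd w)\<^sup>2 * ((snd q)\<^sup>2 - 1)"
      using * by (intro mult_right_mono) auto
    also have "\<dots> < (snd w)\<^sup>2 * (snd q)\<^sup>2"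
      using le_less_trans[OF inner_ge_zero *] by (simp add: algebra_simps)
    finally show False using le by linarith
  qed
  ultimately show ?thesis by (simp add: algebra_simps)
qed

lemma minkowski_orthogonal_nonneg:
  assumes "minkowski q q = -1" and "minkowski w q = 0"
  shows "minkowski w w \<ge> 0"
proof (rule ccontr)
  assume *: "\<not> ?thesis"
  have "snd q \<noteq> 0"
    using assms(1) inner_ge_zero[of "fst q"] by (auto simp: minkowski_def simp del: inner_ge_zero)
  hence "minkowski w w * (snd q)\<^sup>2 < 0"
    using * by (intro mult_neg_pos) auto
  thus False
    using minkowski_orthogonal_bound[OF assms] by (smt (verit) zero_le_power2)
qed

lemma minkowski_orthogonal_eq_0:
  assumes "minkowski q q = -1" and "minkowski w q = 0" and "minkowski w w = 0"
  shows "w = 0"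
proof -
  have "snd w = 0"
    using minkowski_orthogonal_bound[OF assms(1,2)] assms(3) by simp
  with assms(3) have "fst w = 0"
    by (simp add: minkowski_def)
  with \<open>snd w = 0\<close> show ?thesis by (simp add: prod_eq_iff)
qed

lemma minkowski_orthogonal_Cauchy_Schwarz:
  assumes q: "minkowski q q = -1" and u: "minkowski u q = 0" and v: "minkowski v q = 0"
  shows "(minkowski u v)\<^sup>2 \<le> minkowski u u * minkowski v v"
proof (cases "minkowski v v = 0")
  case True
  hence "v = 0" using minkowski_orthogonal_eq_0[OF q v] by simp
  thus ?thesis by (simp add: minkowski_def)
next
  case False
  hence pos: "minkowski v v > 0"
    using minkowski_orthogonal_nonneg[OF q v] by simp
  let ?w = "minkowski v v *\<^sub>R u - minkowski u v *\<^sub>R v"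
  have "minkowski ?w q = 0" by (simp add: minkowski_simps u v)
  hence "0 \<le> minkowski ?w ?w" by (rule minkowski_orthogonal_nonneg[OF q])
  also have "minkowski ?w ?w =
      minkowski v v * (minkowski u u * minkowski v v - (minkowski u v)\<^sup>2)"
    using minkowski_commute[of v u]
    by (simp add: minkowski_simps power2_eq_square algebra_simps)
  finally show ?thesis using pos by (simp add: zero_le_mult_iff)
qed

lemma minkowski_hyperbolic_le:
  "minkowski (Rep_hyperbolic x) (Rep_hyperbolic y) \<le> -1"
proof -
  define p q where "p = Rep_hyperbolic x" and "q = Rep_hyperbolic y"
  have pp: "minkowski p p = -1" and qq: "minkowski q q = -1"
    and "snd p > 0" and "snd q > 0"
    by (simp_all add: p_def q_def minkowski_Rep_hyperbolic snd_Rep_hyperbolic)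
  let ?u = "p + minkowski p q *\<^sub>R q"
  have "minkowski ?u q = 0" by (simp add: minkowski_simps qq)
  hence "0 \<le> minkowski ?u ?u" by (rule minkowski_orthogonal_nonneg[OF qq])
  also have "minkowski ?u ?u = (minkowski p q)\<^sup>2 - 1"
    using minkowski_commute[of q p]
    by (simp add: minkowski_simps pp qq power2_eq_square)
  finally have "1 \<le> \<bar>minkowski p q\<bar>"
    by (simp add: abs_le_square_iff[of 1, simplified])
  moreover have "minkowski p q < 0"
  proof -
    have "norm (fst p) < snd p"
      by (rule power2_less_imp_less)
        (use pp \<open>snd p > 0\<close> in \<open>auto simp: minkowski_def power2_norm_eq_inner power2_eq_square[of "snd p"]\<close>)
    moreover have "norm (fst q) < snd q"
      by (rule power2_less_imp_less)
        (use qq \<open>snd q > 0\<close> in \<open>auto simp: minkowski_def power2_norm_eq_inner power2_eq_square[of "snd q"]\<close>)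
    ultimately have "norm (fst p) * norm (fst q) < snd p * snd q"
      by (intro mult_strict_mono') auto
    thus ?thesis
      using norm_cauchy_schwarz[of "fst p" "fst q"] by (simp add: minkowski_def)
  qed
  ultimately show ?thesis by (simp add: p_def q_def)
qed

instantiation hyperbolic :: (finite) metric_space
begin

definition dist_hyperbolic :: "'a hyperbolic \<Rightarrow> 'a hyperbolic \<Rightarrow> real" where
  "dist_hyperbolic x y = arcosh (- minkowski (Rep_hyperbolic x) (Rep_hyperbolic y))"

definition uniformity_hyperbolic :: "('a hyperbolic \<times> 'a hyperbolic) filter" where
  "uniformity_hyperbolic = (INF e\<in>{0 <..}. principal {(x, y). dist x y < e})"

definition open_hyperbolic :: "'a hyperbolic set \<Rightarrow> bool" where
  "open_hyperbolic U \<longleftrightarrow> (\<forall>x\<in>U. eventually (\<lambda>(x', y). x' = x \<longrightarrow> y \<in> U) uniformity)"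

instance
proof
  fix x y z :: "'a hyperbolic"
  show "dist x y = 0 \<longleftrightarrow> x = y"
  proof
    define p q where "p = Rep_hyperbolic x" and "q = Rep_hyperbolic y"
    have pp: "minkowski p p = -1" and qq: "minkowski q q = -1"
      by (simp_all add: p_def q_def minkowski_Rep_hyperbolic)
    assume "dist x y = 0"
    hence pq: "minkowski p q = -1"
      using minkowski_hyperbolic_le[of x y]
      by (simp add: dist_hyperbolic_def p_def q_def)
    have "minkowski (p - q) q = 0"
      by (simp add: minkowski_simps pq qq)
    moreover have "minkowski (p - q) (p - q) = 0"
      using minkowski_commute[of q p] by (simp add: minkowski_simps pp pq qq)
    ultimately have "p = q"
      using minkowski_orthogonal_eq_0[OF qq, of "p - q"] by simp
    thus "x = y" by (simp add: p_def q_def Rep_hyperbolic_inject)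
  qed (simp add: dist_hyperbolic_def minkowski_Rep_hyperbolic)
  show "dist x y \<le> dist x z + dist y z"
  proof -
    define p q r where "p = Rep_hyperbolic x" and "q = Rep_hyperbolic z"
      and "r = Rep_hyperbolic y"
    define A B C where "A = - minkowski p q" and "B = - minkowski r q"
      and "C = - minkowski p r"
    have pp: "minkowski p p = -1" and qq: "minkowski q q = -1" and rr: "minkowski r r = -1"
      by (simp_all add: p_def q_def r_def minkowski_Rep_hyperbolic)
    have ge: "A \<ge> 1" "B \<ge> 1" "C \<ge> 1"
      using minkowski_hyperbolic_le[of x z] minkowski_hyperbolic_le[of y z]
        minkowski_hyperbolic_le[of x y]
      by (simp_all add: A_def B_def C_def p_def q_def r_def)
    let ?u = "p - A *\<^sub>R q" and ?v = "r - B *\<^sub>R q"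
    have u: "minkowski ?u q = 0" and v: "minkowski ?v q = 0"
      by (simp_all add: minkowski_simps qq A_def B_def)
    have uu: "minkowski ?u ?u = A\<^sup>2 - 1" and vv: "minkowski ?v ?v = B\<^sup>2 - 1"
      and uv: "minkowski ?u ?v = A * B - C"
      using minkowski_commute[of q p] minkowski_commute[of q r]
      by (simp_all add: minkowski_simps pp qq rr A_def B_def C_def power2_eq_square)
    have "(A * B - C)\<^sup>2 \<le> (A\<^sup>2 - 1) * (B\<^sup>2 - 1)"
      using minkowski_orthogonal_Cauchy_Schwarz[OF qq u v] by (simp only: uu vv uv)
    hence "\<bar>A * B - C\<bar> \<le> sqrt ((A\<^sup>2 - 1) * (B\<^sup>2 - 1))"
      by (metis real_sqrt_abs real_sqrt_le_mono)
    hence "C \<le> A * B + sqrt (A\<^sup>2 - 1) * sqrt (B\<^sup>2 - 1)"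
      by (simp add: real_sqrt_mult)
    also have "\<dots> = cosh (arcosh A + arcosh B)"
      using ge by (simp add: cosh_add sinh_arcosh_real)
    finally have "cosh (arcosh C) \<le> cosh (arcosh A + arcosh B)"
      using ge by simp
    hence "arcosh C \<le> arcosh A + arcosh B"
      using ge by (subst (asm) cosh_real_nonneg_le_iff) auto
    thus ?thesis
      by (simp add: dist_hyperbolic_def A_def B_def C_def p_def q_def r_def)
  qed
qed (simp_all add: uniformity_hyperbolic_def open_hyperbolic_def)

end

section \<open>Groups of isometries\<close>

definition isom_group :: "('a::metric_space \<Rightarrow> 'a) monoid" where
  "isom_group =
     \<lparr>carrier = {g. bij g \<and> (\<forall>x y. dist (g x) (g y) = dist x y)}, mult = (\<circ>), one = id\<rparr>"

lemma group_isom_group: "group isom_group"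
proof (rule groupI)
  fix g :: "'a \<Rightarrow> 'a" assume g: "g \<in> carrier isom_group"
  have "inv_into UNIV g \<in> carrier isom_group"
    using g by (auto simp: isom_group_def bij_imp_bij_inv) (metis bij_inv_eq_iff)
  moreover have "inv_into UNIV g \<circ> g = id"
    using g by (simp add: isom_group_def bij_is_inj)
  ultimately show "\<exists>h\<in>carrier isom_group. h \<otimes>\<^bsub>isom_group\<^esub> g = \<one>\<^bsub>isom_group\<^esub>"
    by (auto simp: isom_group_def)
qed (auto simp: isom_group_def o_assoc intro: bij_comp)

text \<open>The compact-open topology on the isometry group.\<close>

definition isom_topology :: "('a::metric_space \<Rightarrow> 'a) topology" where
  "isom_topology =
     topology_generated_by
       {{g \<in> carrier isom_group. g ` K \<subseteq> U} |K U. compact K \<and> open U}"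

definition discrete_isom_subset :: "('a::metric_space \<Rightarrow> 'a) set \<Rightarrow> bool" where
  "discrete_isom_subset \<Gamma> \<longleftrightarrow> subtopology isom_topology \<Gamma> = discrete_topology \<Gamma>"

definition torsion_free :: "('a, 'b) monoid_scheme \<Rightarrow> 'a set \<Rightarrow> bool" where
  "torsion_free G H \<longleftrightarrow>
     (\<forall>g\<in>H. \<forall>k::nat. k > 0 \<longrightarrow> g [^]\<^bsub>G\<^esub> k = \<one>\<^bsub>G\<^esub> \<longrightarrow> g = \<one>\<^bsub>G\<^esub>)"

text \<open>
  The quotient of a metric space by a group of isometries is the set of orbits. It carries the
  quotient metric, which is the distance between orbits as subsets, i.e. \<^const>\<open>setdist\<close>.
  For a discrete group acting on hyperbolic space the orbits are closed and this is a metric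
  inducing the quotient topology; if the group is moreover torsion-free, it is the
  Riemannian distance of the quotient manifold.
\<close>

definition orbit_space :: "('a \<Rightarrow> 'a) set \<Rightarrow> 'a set set" where
  "orbit_space \<Gamma> = range (\<lambda>x. (\<lambda>g. g x) ` \<Gamma>)"

definition cocompact :: "('a::metric_space \<Rightarrow> 'a) set \<Rightarrow> bool" where
  "cocompact \<Gamma> \<longleftrightarrow> compact_space (Metric_space.mtopology (orbit_space \<Gamma>) setdist)"

definition compact_hyperbolic_manifold :: "'n::finite hyperbolic set set \<Rightarrow> bool" where
  "compact_hyperbolic_manifold M \<longleftrightarrow>
     (\<exists>\<Gamma>. subgroup \<Gamma> isom_group \<and> discrete_isom_subset \<Gamma> \<and> torsion_free isom_group \<Gamma> \<and>
          cocompact \<Gamma> \<and> M = orbit_space \<Gamma>)"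

section \<open>Closed geodesics and the systole\<close>

text \<open>
  Geodesics are parametrised by arc length, so that they are the locally distance-preserving
  maps from the real line; a closed geodesic of length \<open>L\<close> is one with period \<open>L > 0\<close>.
  The period need not be the least one: multiples belong to closed geodesics traversed several
  times, which are longer and hence do not matter for the systole. Since \<open>LEAST\<close> on the reals is not an infimum
  but an attained minimum, the systole is the length of an actual shortest closed geodesic.
\<close>

definition geodesic_line :: "'a set \<Rightarrow> ('a \<Rightarrow> 'a \<Rightarrow> real) \<Rightarrow> (real \<Rightarrow> 'a) \<Rightarrow> bool" where
  "geodesic_line M d c \<longleftrightarrow>
     range c \<subseteq> M \<and>
     (\<forall>t. \<exists>\<delta>>0. \<forall>s\<in>ball t \<delta>. \<forall>s'\<in>ball t \<delta>. d (c s) (c s') = \<bar>s - s'\<bar>)"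

definition closed_geodesic ::
    "'a set \<Rightarrow> ('a \<Rightarrow> 'a \<Rightarrow> real) \<Rightarrow> real \<Rightarrow> (real \<Rightarrow> 'a) \<Rightarrow> bool" where
  "closed_geodesic M d L c \<longleftrightarrow> geodesic_line M d c \<and> L > 0 \<and> (\<forall>t. c (t + L) = c t)"

definition systole :: "'a set \<Rightarrow> ('a \<Rightarrow> 'a \<Rightarrow> real) \<Rightarrow> real" where
  "systole M d = (LEAST L. \<exists>c. closed_geodesic M d L c)"

end

theory Submission
  imports Defs
begin

text \<open>
  The closed geodesics of arithmetic manifolds over a fixed field are not arbitrarily short, but two
  totally geodesic hypersurfaces in such manifolds can be arbitrarily close to each other. Cutting
  along them and doubling a piece that contains a short common perpendicular turns this
  perpendicular into a closed geodesic of twice its length.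

  \<^emph>\<open>The arithmetic group.\<close> The form \<open>x\<^sub>1\<^sup>2 + \<dots> + x\<^sub>n\<^sup>2 - sqrt 2 * x\<^sub>0\<^sup>2\<close> over \<open>\<int>[sqrt 2]\<close> has signature
  \<open>(n, 1)\<close>, and its conjugate is positive definite. For each point of hyperbolic space, the form and
  its conjugate together define a Euclidean norm on the lattice of integral vectors. No nonzero
  vector is shorter than one, because the product of the values of the two forms is a nonzero
  integer, and all these norms have the same determinant. By counting points, short vectors
  generate the lattice, uniformly in the point (\<open>uniformly_short_generators\<close>). There are finitely many
  possible Gram matrices and residues of the short generators, so a congruence subgroup of level
  \<open>N\<close> acts with bounded quotient (\<open>congruence_group_cobounded\<close>). If \<open>N\<close> is large, its nontrivial
  elements move every point far away, since an element that moves a point little must fix all the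
  short vectors belonging to this point
  (\<open>congruence_displacement\<close>).

  \<^emph>\<open>The hyperplanes.\<close> Congruent integers of the field that are small together with their conjugates
  are equal. Applied to the pairings of normal vectors, this shows that the translates of two given
  disjoint rational hyperplanes under a congruence subgroup of large level are pairwise disjoint or
  equal, and that no two of them are closer than the original two (\<open>arithmetic_wall_system\<close>). The
  distance of the original two can be prescribed to be as small as desired.

  \<^emph>\<open>The double.\<close> Let a chamber be the closure of the component of the complement of all these
  hyperplanes that contains the open common perpendicular, and let \<open>\<Delta>\<close> be its stabilizer in the
  congruence subgroup. The walls of the chamber are disjoint, so the reflections in them generate a
  free product of groups of order two, for which the chamber is a fundamental domain; this is proved
  by ping-pong. The group of the double is \<open>\<Lambda>\<close>, consisting of the products of an even number of
  reflections and an element of \<open>\<Delta>\<close>. Every nontrivial element of \<open>\<Lambda>\<close> moves every point by at least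
  twice the distance of the two hyperplanes (\<open>\<Lambda>_displacement\<close>), and the product of the reflections in
  these two moves the points of the common perpendicular by exactly this amount. The displacement
  bound implies that \<open>\<Lambda>\<close> is discrete and torsion-free, and that the bound is the systole of the
  quotient (\<open>compact_manifold_of_lorentz_group\<close>).
\<close>

section \<open>Minkowski space and its hyperplanes\<close>

type_synonym 'n spacetime = "(real ^ 'n) \<times> real"

(* Points of Minkowski space are treated as vectors, not as pairs. *)
declare split_paired_All [simp del] split_paired_Ex [simp del]

notation minkowski (infixl "\<bullet>\<^sub>M" 70)

definition hyperboloid :: "'n::finite spacetime set" where
  "hyperboloid = {p. p \<bullet>\<^sub>M p = -1 \<and> snd p > 0}"

lemma minkowski_zero [simp]: "0 \<bullet>\<^sub>M x = 0" "x \<bullet>\<^sub>M 0 = 0"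
  by (simp_all add: minkowski_def)

lemma minkowski_minus [simp]: "(- x) \<bullet>\<^sub>M y = - (x \<bullet>\<^sub>M y)" "x \<bullet>\<^sub>M (- y) = - (x \<bullet>\<^sub>M y)"
  by (simp_all add: minkowski_def)

lemma bilinear_minkowski: "bilinear (\<bullet>\<^sub>M)"
  unfolding bilinear_def by (intro conjI allI linearI) (simp_all add: minkowski_simps)

lemma minkowski_nondegenerate:
  assumes "\<And>y. x \<bullet>\<^sub>M y = 0" shows "x = 0"
  using assms[of "(fst x, - snd x)"] by (simp add: minkowski_def prod_eq_iff add_nonneg_eq_0_iff)

lemma continuous_on_minkowski [continuous_intros]:
  "continuous_on S f \<Longrightarrow> continuous_on S g \<Longrightarrow> continuous_on S (\<lambda>x. f x \<bullet>\<^sub>M g x)"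
  unfolding minkowski_def by (intro continuous_intros)

lemma origin_in_hyperboloid: "(0, 1) \<in> hyperboloid"
  by (simp add: hyperboloid_def minkowski_def)

lemma minkowski_origin [simp]: "x \<bullet>\<^sub>M (0, 1) = - snd x"
  by (simp add: minkowski_def)

lemma hyperboloid_self: "p \<in> hyperboloid \<Longrightarrow> p \<bullet>\<^sub>M p = -1"
  by (simp add: hyperboloid_def)

lemma Rep_hyperbolic_in: "Rep_hyperbolic x \<in> hyperboloid"
  using Rep_hyperbolic[of x] by (simp add: hyperboloid_def)

lemma Rep_Abs_hyperbolic: "p \<in> hyperboloid \<Longrightarrow> Rep_hyperbolic (Abs_hyperbolic p) = p"
  by (intro Abs_hyperbolic_inverse) (simp add: hyperboloid_def)

lemma hyperboloid_minkowski_le: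
  assumes "p \<in> hyperboloid" "q \<in> hyperboloid" shows "p \<bullet>\<^sub>M q \<le> -1"
  using minkowski_hyperbolic_le[of "Abs_hyperbolic p" "Abs_hyperbolic q"] assms
  by (simp add: Rep_Abs_hyperbolic)

lemma dist_Abs_hyperbolic:
  assumes "p \<in> hyperboloid" "q \<in> hyperboloid"
  shows "dist (Abs_hyperbolic p) (Abs_hyperbolic q) = arcosh (- (p \<bullet>\<^sub>M q))"
  using assms by (simp add: dist_hyperbolic_def Rep_Abs_hyperbolic)

lemma cosh_dist_hyperbolic:
  "cosh (dist x y) = - (Rep_hyperbolic x \<bullet>\<^sub>M Rep_hyperbolic y)"
  using minkowski_hyperbolic_le[of x y] by (simp add: dist_hyperbolic_def)

text \<open>
  The orthogonal complement of a point of the hyperboloid is positive definite. A timelike vector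
  is therefore orthogonal to no such point, its pairings with the hyperboloid are bounded away
  from zero, and since the hyperboloid is connected they all have the same sign.
\<close>

lemma reverse_Cauchy_Schwarz:
  assumes p: "p \<in> hyperboloid" shows "- (u \<bullet>\<^sub>M u) \<le> (u \<bullet>\<^sub>M p)\<^sup>2"
proof -
  let ?v = "u + (u \<bullet>\<^sub>M p) *\<^sub>R p"
  have "0 \<le> ?v \<bullet>\<^sub>M ?v"
    by (rule minkowski_orthogonal_nonneg[of p])
      (use hyperboloid_self[OF p] in \<open>simp_all add: minkowski_simps\<close>)
  also have "?v \<bullet>\<^sub>M ?v = u \<bullet>\<^sub>M u + (u \<bullet>\<^sub>M p)\<^sup>2"
    using hyperboloid_self[OF p] minkowski_commute[of p u]
    by (simp add: minkowski_simps power2_eq_square)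
  finally show ?thesis by simp
qed

text \<open>
  The Cauchy--Schwarz inequality for the projections to the orthogonal complement of \<open>p\<close>.
\<close>

lemma projected_Cauchy_Schwarz:
  assumes p: "p \<in> hyperboloid"
  shows "(x \<bullet>\<^sub>M y + (x \<bullet>\<^sub>M p) * (y \<bullet>\<^sub>M p))\<^sup>2 \<le> (x \<bullet>\<^sub>M x + (x \<bullet>\<^sub>M p)\<^sup>2) * (y \<bullet>\<^sub>M y + (y \<bullet>\<^sub>M p)\<^sup>2)"
proof -
  have pp: "p \<bullet>\<^sub>M p = -1" by (rule hyperboloid_self[OF p])
  have eq: "(x + (x \<bullet>\<^sub>M p) *\<^sub>R p) \<bullet>\<^sub>M (y + (y \<bullet>\<^sub>M p) *\<^sub>R p) = x \<bullet>\<^sub>M y + (x \<bullet>\<^sub>M p) * (y \<bullet>\<^sub>M p)" for x y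
    using minkowski_commute[of p y] by (simp add: minkowski_simps pp)
  have "((x + (x \<bullet>\<^sub>M p) *\<^sub>R p) \<bullet>\<^sub>M (y + (y \<bullet>\<^sub>M p) *\<^sub>R p))\<^sup>2
      \<le> ((x + (x \<bullet>\<^sub>M p) *\<^sub>R p) \<bullet>\<^sub>M (x + (x \<bullet>\<^sub>M p) *\<^sub>R p)) * ((y + (y \<bullet>\<^sub>M p) *\<^sub>R p) \<bullet>\<^sub>M (y + (y \<bullet>\<^sub>M p) *\<^sub>R p))"
    by (rule minkowski_orthogonal_Cauchy_Schwarz[OF pp]) (simp_all add: minkowski_simps pp)
  thus ?thesis unfolding eq by (simp only: power2_eq_square)
qed

lemma hyperboloid_normalize:
  assumes "z \<bullet>\<^sub>M z < 0" "snd z > 0"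
  shows "(1 / sqrt (- (z \<bullet>\<^sub>M z))) *\<^sub>R z \<in> hyperboloid"
  using assms by (simp add: hyperboloid_def minkowski_simps field_simps)

lemma timelike_convex:
  assumes p: "p \<in> hyperboloid" and q: "q \<in> hyperboloid" and st: "s \<ge> 0" "t \<ge> 0" "s + t > 0"
  shows "(s *\<^sub>R p + t *\<^sub>R q) \<bullet>\<^sub>M (s *\<^sub>R p + t *\<^sub>R q) < 0" "snd (s *\<^sub>R p + t *\<^sub>R q) > 0"
proof -
  have "(s *\<^sub>R p + t *\<^sub>R q) \<bullet>\<^sub>M (s *\<^sub>R p + t *\<^sub>R q) = - s\<^sup>2 - t\<^sup>2 + 2 * (s * t) * (p \<bullet>\<^sub>M q)"
    using hyperboloid_self[OF p] hyperboloid_self[OF q] minkowski_commute[of p q]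
    by (simp add: minkowski_simps power2_eq_square algebra_simps)
  also have "\<dots> \<le> - s\<^sup>2 - t\<^sup>2"
    using hyperboloid_minkowski_le[OF p q] st by (simp add: mult_nonneg_nonpos)
  also have "\<dots> < 0"
    using st by (smt (verit) zero_le_power2 power2_eq_square mult_pos_pos zero_less_power2)
  finally show "(s *\<^sub>R p + t *\<^sub>R q) \<bullet>\<^sub>M (s *\<^sub>R p + t *\<^sub>R q) < 0" .
  have "snd p > 0" "snd q > 0" using p q by (auto simp: hyperboloid_def)
  with st show "snd (s *\<^sub>R p + t *\<^sub>R q) > 0"
    by (cases "s > 0") (auto simp: add_pos_nonneg add_nonneg_pos)
qed

lemma timelike_constant_sign:
  assumes u: "u \<bullet>\<^sub>M u < 0" and p: "p \<in> hyperboloid" "u \<bullet>\<^sub>M p \<le> 0" and q: "q \<in> hyperboloid"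
  shows "u \<bullet>\<^sub>M q < 0"
proof (rule ccontr)
  assume *: "\<not> ?thesis"
  have "u \<bullet>\<^sub>M p \<noteq> 0" using reverse_Cauchy_Schwarz[OF p(1), of u] u by auto
  hence neg: "u \<bullet>\<^sub>M p < 0" using p by simp
  let ?z = "(u \<bullet>\<^sub>M q) *\<^sub>R p + (- (u \<bullet>\<^sub>M p)) *\<^sub>R q"
  let ?k = "1 / sqrt (- (?z \<bullet>\<^sub>M ?z))"
  have "?k *\<^sub>R ?z \<in> hyperboloid"
    using timelike_convex[OF p(1) q, of "u \<bullet>\<^sub>M q" "- (u \<bullet>\<^sub>M p)"] neg *
    by (intro hyperboloid_normalize) auto
  from reverse_Cauchy_Schwarz[OF this, of u] have "- (u \<bullet>\<^sub>M u) \<le> 0"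
    by (simp add: minkowski_simps)
  with u show False by simp
qed

lemma timelike_bound:
  assumes u: "u \<bullet>\<^sub>M u < 0" and p: "p \<in> hyperboloid" "u \<bullet>\<^sub>M p \<le> 0" and q: "q \<in> hyperboloid"
  shows "u \<bullet>\<^sub>M q \<le> - sqrt (- (u \<bullet>\<^sub>M u))"
proof -
  have "sqrt (- (u \<bullet>\<^sub>M u)) \<le> sqrt ((u \<bullet>\<^sub>M q)\<^sup>2)"
    using reverse_Cauchy_Schwarz[OF q, of u] by (rule real_sqrt_le_mono)
  thus ?thesis using timelike_constant_sign[OF assms] by simp
qed

text \<open>
  A unit spacelike vector \<open>w\<close> is the normal of the hyperbolic hyperplane \<open>w \<bullet>\<^sub>M p = 0\<close>, and
  \<open>w \<bullet>\<^sub>M p\<close> is the hyperbolic sine of the signed distance to it. Hence a hyperplane that separates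
  two points is no farther from either of them than the other point is.
\<close>

lemma separating_hyperplane_bound:
  assumes w: "w \<bullet>\<^sub>M w = 1" and p: "p \<in> hyperboloid" and q: "q \<in> hyperboloid"
    and s: "w \<bullet>\<^sub>M p \<ge> 0" "w \<bullet>\<^sub>M q \<le> 0"
  shows "1 + (w \<bullet>\<^sub>M q)\<^sup>2 \<le> (p \<bullet>\<^sub>M q)\<^sup>2"
proof -
  define a b x where "a = p \<bullet>\<^sub>M q" and "b = w \<bullet>\<^sub>M q" and "x = w \<bullet>\<^sub>M p"
  have pp: "p \<bullet>\<^sub>M p = -1" by (rule hyperboloid_self[OF p])
  have "(x + a * b)\<^sup>2 \<le> (1 + b\<^sup>2) * (a\<^sup>2 - 1)"
    using projected_Cauchy_Schwarz[OF q, of w p] by (simp add: w pp a_def b_def x_def mult.commute)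
  moreover have "(a * b)\<^sup>2 \<le> (x + a * b)\<^sup>2"
    using s hyperboloid_minkowski_le[OF p q]
    by (intro power_mono) (auto simp: a_def b_def x_def mult_nonpos_nonpos)
  ultimately have "b\<^sup>2 + 1 \<le> a\<^sup>2" by (simp add: algebra_simps power_mult_distrib)
  thus ?thesis by (simp add: a_def b_def)
qed

text \<open>
  Two unit normals with \<open>w \<bullet>\<^sub>M w' < -1\<close> belong to disjoint hyperplanes, because \<open>w + w'\<close> is then
  timelike. If one point lies on the negative side of both, then the two positive sides are
  disjoint, and being deep inside one of them means being far outside the other.
\<close>

lemma disjoint_halfspaces_sum:
  assumes w: "w \<bullet>\<^sub>M w = 1" "w' \<bullet>\<^sub>M w' = 1" and ww: "w \<bullet>\<^sub>M w' \<le> - c" and c: "c > 1"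
    and p: "p \<in> hyperboloid" "w \<bullet>\<^sub>M p \<le> 0" "w' \<bullet>\<^sub>M p \<le> 0" and z: "z \<in> hyperboloid"
  shows "w \<bullet>\<^sub>M z + w' \<bullet>\<^sub>M z \<le> - sqrt (2 * c - 2)"
proof -
  have uu: "(w + w') \<bullet>\<^sub>M (w + w') = 2 + 2 * (w \<bullet>\<^sub>M w')"
    using minkowski_commute[of w' w] by (simp add: minkowski_simps w)
  have "(w + w') \<bullet>\<^sub>M z \<le> - sqrt (- ((w + w') \<bullet>\<^sub>M (w + w')))"
    by (rule timelike_bound[OF _ p(1) _ z]) (use uu ww c p in \<open>auto simp: minkowski_simps\<close>)
  also have "\<dots> \<le> - sqrt (2 * c - 2)"
    using uu ww by simp
  finally show ?thesis by (simp add: minkowski_simps)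
qed

text \<open>
  The sharp form of this statement. In terms of signed distances it is the addition formula of the
  hyperbolic sine: the distance from a point to the first hyperplane is at least the distance of
  the hyperplanes plus the depth of the point behind the second one.
\<close>

lemma disjoint_halfspaces_depth:
  assumes w: "w \<bullet>\<^sub>M w = 1" "w' \<bullet>\<^sub>M w' = 1" and ww: "w \<bullet>\<^sub>M w' \<le> - c" and c: "c > 1"
    and p: "p \<in> hyperboloid" "w \<bullet>\<^sub>M p \<le> 0" "w' \<bullet>\<^sub>M p \<le> 0" and z: "z \<in> hyperboloid"
    and b: "w' \<bullet>\<^sub>M z \<ge> 0"
  shows "w \<bullet>\<^sub>M z \<le> - (c * (w' \<bullet>\<^sub>M z) + sqrt ((c\<^sup>2 - 1) * (1 + (w' \<bullet>\<^sub>M z)\<^sup>2)))"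
proof -
  define k a b where "k = - (w \<bullet>\<^sub>M w')" and "a = w \<bullet>\<^sub>M z" and "b = w' \<bullet>\<^sub>M z"
  have k: "k \<ge> c" using ww by (simp add: k_def)
  have k2: "k\<^sup>2 \<ge> c\<^sup>2" using k c by (intro power_mono) auto
  have c2: "c\<^sup>2 > 1" using c by (simp add: one_less_power)
  have "(a * b - k)\<^sup>2 \<le> (1 + a\<^sup>2) * (1 + b\<^sup>2)"
    using projected_Cauchy_Schwarz[OF z, of w w'] by (simp add: w a_def b_def k_def add.commute)
  hence 1: "(k\<^sup>2 - 1) * (1 + b\<^sup>2) \<le> (a + k * b)\<^sup>2"
    by (simp add: power2_eq_square algebra_simps)
  have uu: "(w + k *\<^sub>R w') \<bullet>\<^sub>M (w + k *\<^sub>R w') = 1 - k\<^sup>2"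
    using minkowski_commute[of w' w] by (simp add: minkowski_simps w k_def power2_eq_square)
  have "(w + k *\<^sub>R w') \<bullet>\<^sub>M z < 0"
    by (rule timelike_constant_sign[OF _ p(1) _ z])
      (use uu k2 c2 k c p in \<open>auto simp: minkowski_simps mult_nonneg_nonpos intro!: add_nonpos_nonpos\<close>)
  hence neg: "a + k * b < 0" by (simp add: minkowski_simps a_def b_def)
  have "sqrt ((c\<^sup>2 - 1) * (1 + b\<^sup>2)) \<le> sqrt ((k\<^sup>2 - 1) * (1 + b\<^sup>2))"
    using k2 by (intro real_sqrt_le_mono mult_right_mono) auto
  also have "\<dots> \<le> sqrt ((a + k * b)\<^sup>2)" using 1 by (rule real_sqrt_le_mono)
  also have "\<dots> = - (a + k * b)" using neg by simp
  finally have "a \<le> - (k * b + sqrt ((c\<^sup>2 - 1) * (1 + b\<^sup>2)))" by simp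
  moreover have "c * b \<le> k * b" using k assms(9) by (intro mult_right_mono) (auto simp: b_def)
  ultimately show ?thesis by (simp add: a_def b_def)
qed

text \<open>
  If instead \<open>w \<bullet>\<^sub>M w' > 1\<close>, then the difference of the normals is timelike, and one of the
  half-spaces contains the other.
\<close>

lemma nested_halfspaces:
  assumes w: "w \<bullet>\<^sub>M w = 1" "w' \<bullet>\<^sub>M w' = 1" and ww: "w \<bullet>\<^sub>M w' > 1"
  shows "(\<forall>z\<in>hyperboloid. w \<bullet>\<^sub>M z < w' \<bullet>\<^sub>M z) \<or> (\<forall>z\<in>hyperboloid. w' \<bullet>\<^sub>M z < w \<bullet>\<^sub>M z)"
proof -
  have uu: "(w - w') \<bullet>\<^sub>M (w - w') < 0"
    using minkowski_commute[of w' w] ww by (simp add: minkowski_simps w)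
  have uu': "(w' - w) \<bullet>\<^sub>M (w' - w) < 0"
    using minkowski_commute[of w' w] ww by (simp add: minkowski_simps w)
  show ?thesis
  proof (cases "w \<bullet>\<^sub>M (0, 1) \<le> w' \<bullet>\<^sub>M (0, 1)")
    case True
    hence "(w - w') \<bullet>\<^sub>M z < 0" if "z \<in> hyperboloid" for z
      using timelike_constant_sign[OF uu origin_in_hyperboloid _ that] by (simp add: minkowski_simps)
    thus ?thesis by (simp add: minkowski_simps)
  next
    case False
    hence "(w' - w) \<bullet>\<^sub>M z < 0" if "z \<in> hyperboloid" for z
      using timelike_constant_sign[OF uu' origin_in_hyperboloid _ that] by (simp add: minkowski_simps)
    thus ?thesis by (simp add: minkowski_simps)
  qed
qed

text \<open>
  Since \<open>snd q\<close> is the hyperbolic cosine of the distance of \<open>q\<close> from \<open>(0, 1)\<close>, subsets of the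
  hyperboloid are bounded if and only if this coordinate is, and all pairings are then bounded.
\<close>

lemma minkowski_le_time:
  assumes "q \<in> hyperboloid" "snd q \<le> R"
  shows "\<bar>x \<bullet>\<^sub>M q\<bar> \<le> (norm (fst x) + \<bar>snd x\<bar>) * R"
proof -
  have q: "fst q \<bullet> fst q \<le> (snd q)\<^sup>2" "snd q > 0"
    using assms by (auto simp: hyperboloid_def minkowski_def power2_eq_square)
  have "norm (fst q) \<le> snd q"
    by (rule power2_le_imp_le) (use q in \<open>auto simp: power2_norm_eq_inner\<close>)
  hence nq: "norm (fst q) \<le> R" "\<bar>snd q\<bar> \<le> R" using assms(2) q by auto
  have "\<bar>x \<bullet>\<^sub>M q\<bar> \<le> \<bar>fst x \<bullet> fst q\<bar> + \<bar>snd x * snd q\<bar>" unfolding minkowski_def by (rule abs_triangle_ineq4)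
  also have "\<dots> \<le> norm (fst x) * norm (fst q) + \<bar>snd x\<bar> * \<bar>snd q\<bar>"
    using Cauchy_Schwarz_ineq2[of "fst x" "fst q"] by (simp add: abs_mult)
  also have "\<dots> \<le> norm (fst x) * R + \<bar>snd x\<bar> * R"
    by (intro add_mono mult_left_mono nq) auto
  finally show ?thesis by (simp add: algebra_simps)
qed

section \<open>Lorentz transformations\<close>

definition lorentz :: "('n::finite spacetime \<Rightarrow> 'n spacetime) set" where
  "lorentz = {A. linear A \<and> (\<forall>x y. A x \<bullet>\<^sub>M A y = x \<bullet>\<^sub>M y) \<and> A ` hyperboloid \<subseteq> hyperboloid}"

lemma lorentz_linear: "A \<in> lorentz \<Longrightarrow> linear A"
  and lorentz_minkowski: "A \<in> lorentz \<Longrightarrow> A x \<bullet>\<^sub>M A y = x \<bullet>\<^sub>M y"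
  and lorentz_hyperboloid: "A \<in> lorentz \<Longrightarrow> p \<in> hyperboloid \<Longrightarrow> A p \<in> hyperboloid"
  unfolding lorentz_def by blast+

lemma lorentz_id: "id \<in> lorentz"
  by (auto simp: lorentz_def linear_id)

lemma lorentz_comp: "A \<in> lorentz \<Longrightarrow> B \<in> lorentz \<Longrightarrow> A \<circ> B \<in> lorentz"
  unfolding lorentz_def
  by (simp add: linear_compose image_subset_iff del: split_paired_All)

text \<open>
  A linear isometry of the form either preserves or exchanges the two sheets of the hyperboloid,
  so that it is enough to know where one point goes.
\<close>

lemma isometry_in_lorentz:
  assumes A: "linear A" "\<And>x y. A x \<bullet>\<^sub>M A y = x \<bullet>\<^sub>M y"
    and p: "p \<in> hyperboloid" "q \<in> hyperboloid" "A p \<bullet>\<^sub>M q \<le> 0"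
  shows "A \<in> lorentz"
proof -
  have neg: "A p \<bullet>\<^sub>M z < 0" if "z \<in> hyperboloid" for z
    by (rule timelike_constant_sign[OF _ p(2,3) that]) (use A(2) p in \<open>simp add: hyperboloid_self\<close>)
  have Ap: "A p \<in> hyperboloid"
    using neg[OF origin_in_hyperboloid] A(2) p by (simp add: hyperboloid_def)
  have "A x \<in> hyperboloid" if x: "x \<in> hyperboloid" for x
  proof -
    have "A x \<bullet>\<^sub>M (0, 1) < 0"
      by (rule timelike_constant_sign[OF _ Ap _ origin_in_hyperboloid])
        (use A(2) hyperboloid_self[OF x] hyperboloid_minkowski_le[OF x p(1)] in auto)
    thus ?thesis using A(2) hyperboloid_self[OF x] by (simp add: hyperboloid_def)
  qed
  thus ?thesis using A by (auto simp: lorentz_def)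
qed

definition reflection :: "'n::finite spacetime \<Rightarrow> 'n spacetime \<Rightarrow> 'n spacetime" where
  "reflection w x = x - (2 * (x \<bullet>\<^sub>M w)) *\<^sub>R w"

lemma linear_reflection: "linear (reflection w)"
  by (rule linearI) (auto simp: reflection_def minkowski_simps algebra_simps)

lemma reflection_involution: "w \<bullet>\<^sub>M w = 1 \<Longrightarrow> reflection w (reflection w x) = x"
  by (simp add: reflection_def minkowski_simps)

lemma reflection_minkowski:
  "w \<bullet>\<^sub>M w = 1 \<Longrightarrow> reflection w x \<bullet>\<^sub>M reflection w y = x \<bullet>\<^sub>M y"
  using minkowski_commute[of w y] by (simp add: reflection_def minkowski_simps)

lemma reflection_normal: "w \<bullet>\<^sub>M w = 1 \<Longrightarrow> w \<bullet>\<^sub>M reflection w x = - (w \<bullet>\<^sub>M x)"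
  using minkowski_commute[of w x] by (simp add: reflection_def minkowski_simps)

lemma minkowski_reflection:
  "x \<bullet>\<^sub>M reflection w y = x \<bullet>\<^sub>M y - 2 * (w \<bullet>\<^sub>M x) * (w \<bullet>\<^sub>M y)"
  using minkowski_commute[of w x] minkowski_commute[of w y]
  by (simp add: reflection_def minkowski_simps)

lemma reflection_lorentz:
  assumes w: "w \<bullet>\<^sub>M w = 1" shows "reflection w \<in> lorentz"
proof (rule isometry_in_lorentz[OF linear_reflection reflection_minkowski[OF w]
        origin_in_hyperboloid origin_in_hyperboloid])
  have "(0, 1) \<bullet>\<^sub>M reflection w (0, 1) = - 1 - 2 * (w \<bullet>\<^sub>M (0, 1))\<^sup>2"
    by (simp add: minkowski_reflection power2_eq_square del: minkowski_origin)
      (simp add: minkowski_def)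
  hence "(0, 1) \<bullet>\<^sub>M reflection w (0, 1) \<le> 0"
    using zero_le_power2[of "w \<bullet>\<^sub>M (0, 1)"] by linarith
  thus "reflection w (0, 1) \<bullet>\<^sub>M (0, 1) \<le> 0"
    by (metis minkowski_commute)
qed

text \<open>
  Conjugating a reflection by a Lorentz transformation moves its mirror.
\<close>

lemma lorentz_conj_reflection:
  assumes A: "A \<in> lorentz"
  shows "A (reflection w x) = reflection (A w) (A x)"
  using lorentz_linear[OF A] lorentz_minkowski[OF A]
  by (simp add: reflection_def linear_diff linear_cmul)

section \<open>Quotients by groups of isometries of large displacement\<close>

lemma isom_group_simps:
  "carrier isom_group = {g. bij g \<and> (\<forall>x y. dist (g x) (g y) = dist x y)}"
  "g \<otimes>\<^bsub>isom_group\<^esub> h = g \<circ> h" "\<one>\<^bsub>isom_group\<^esub> = id"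
  by (simp_all add: isom_group_def)

lemma isom_group_pow: "g [^]\<^bsub>isom_group\<^esub> (k::nat) = (g ^^ k)"
proof (induction k)
  case (Suc k)
  have "g [^]\<^bsub>isom_group\<^esub> Suc k = g [^]\<^bsub>isom_group\<^esub> k \<circ> g"
    by (simp add: nat_pow_def isom_group_simps)
  thus ?case using Suc by (simp add: funpow_Suc_right del: funpow.simps)
qed (simp add: nat_pow_def isom_group_simps)

lemma period_of_int_multiple:
  fixes c :: "real \<Rightarrow> 'a"
  assumes per: "\<And>t. c (t + L) = c t"
  shows "c (t + of_int k * L) = c t"
proof (induction k rule: int_induct[where k = 0])
  case (step1 i)
  thus ?case using per[of "t + of_int i * L"] by (simp add: algebra_simps)
next
  case (step2 i)
  thus ?case using per[of "t + of_int (i - 1) * L"] by (simp add: algebra_simps)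
qed simp

text \<open>
  A lower bound for the displacement of all nontrivial elements at all points makes the action of
  a group free and properly discontinuous in a uniform way. The points of each orbit are then
  uniformly separated, which is what makes the quotient a metric space.
\<close>

locale displacing_group =
  fixes \<Lambda> :: "('a::metric_space \<Rightarrow> 'a) set" and l :: real
  assumes isometry: "\<And>g x y. g \<in> \<Lambda> \<Longrightarrow> dist (g x) (g y) = dist x y"
    and id_mem: "id \<in> \<Lambda>"
    and comp_mem: "\<And>g h. g \<in> \<Lambda> \<Longrightarrow> h \<in> \<Lambda> \<Longrightarrow> g \<circ> h \<in> \<Lambda>"
    and inverse_mem: "\<And>g. g \<in> \<Lambda> \<Longrightarrow> \<exists>h\<in>\<Lambda>. h \<circ> g = id \<and> g \<circ> h = id"
    and l_pos: "l > 0"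
    and displacement: "\<And>g x. g \<in> \<Lambda> \<Longrightarrow> g \<noteq> id \<Longrightarrow> l \<le> dist x (g x)"
begin

lemma bij_mem: "g \<in> \<Lambda> \<Longrightarrow> bij g"
  using inverse_mem[of g] o_bij by blast

lemma subgroup_isom_group: "subgroup \<Lambda> isom_group"
proof (rule group.subgroupI[OF group_isom_group])
  show "\<Lambda> \<subseteq> carrier isom_group"
    using bij_mem isometry by (auto simp: isom_group_simps)
  show "\<Lambda> \<noteq> {}" using id_mem by auto
next
  fix g assume g: "g \<in> \<Lambda>"
  then obtain h where h: "h \<in> \<Lambda>" "h \<circ> g = id" "g \<circ> h = id" using inverse_mem by blast
  have "inv\<^bsub>isom_group\<^esub> g = h"
    using h g bij_mem isometry
    by (intro group.inv_equality[OF group_isom_group]) (auto simp: isom_group_simps)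
  thus "inv\<^bsub>isom_group\<^esub> g \<in> \<Lambda>" using h by simp
qed (auto simp: isom_group_simps comp_mem)

definition orb :: "'a \<Rightarrow> 'a set" where "orb x = (\<lambda>g. g x) ` \<Lambda>"

lemma orbit_space_eq: "orbit_space \<Lambda> = range orb"
  by (simp add: orbit_space_def orb_def)

lemma self_in_orb: "x \<in> orb x"
  unfolding orb_def by (rule image_eqI[OF _ id_mem]) simp

lemma orb_eqI:
  assumes "y \<in> orb x" shows "orb y = orb x"
proof -
  obtain g where g: "g \<in> \<Lambda>" "y = g x" using assms by (auto simp: orb_def)
  obtain h where h: "h \<in> \<Lambda>" "h \<circ> g = id" using inverse_mem[OF g(1)] by blast
  have "x = h y" using h g by (simp add: pointfree_idE)
  have "orb y \<subseteq> orb x" using comp_mem[OF _ g(1)] g(2) by (auto simp: orb_def image_iff) (metis comp_apply)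
  moreover have "orb x \<subseteq> orb y" using comp_mem[OF _ h(1)] \<open>x = h y\<close>
    by (auto simp: orb_def image_iff) (metis comp_apply)
  ultimately show ?thesis by simp
qed

lemma orb_image: "g \<in> \<Lambda> \<Longrightarrow> orb (g x) = orb x"
  by (rule orb_eqI) (auto simp: orb_def)

lemma le_setdist_orb:
  assumes "\<And>y'. y' \<in> orb y \<Longrightarrow> b \<le> dist x y'"
  shows "b \<le> setdist (orb x) (orb y)"
proof (rule le_setdistI)
  fix u v assume "u \<in> orb x" "v \<in> orb y"
  then obtain g where g: "g \<in> \<Lambda>" "u = g x" by (auto simp: orb_def)
  obtain h where h: "h \<in> \<Lambda>" "h \<circ> g = id" using inverse_mem[OF g(1)] by blast
  have "h v \<in> orb y" using \<open>v \<in> orb y\<close> comp_mem[OF h(1)] by (auto simp: orb_def image_iff) (metis comp_apply)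
  have "dist u v = dist (h u) (h v)" using isometry[OF h(1)] by simp
  also have "h u = x" using h g by (simp add: pointfree_idE)
  finally show "b \<le> dist u v" using assms[OF \<open>h v \<in> orb y\<close>] by simp
qed (use self_in_orb in auto)

lemma setdist_orb_le: "setdist (orb x) (orb y) \<le> dist x y"
  by (rule setdist_le_dist[OF self_in_orb self_in_orb])

lemma orb_near:
  assumes "setdist (orb x) (orb y) < b"
  obtains y' where "y' \<in> orb y" "dist x y' < b"
  using le_setdist_orb[of y b x] assms by force

text \<open>
  A displacement of at least \<open>l\<close> makes the projection onto the quotient isometric on pairs of
  points at distance at most \<open>l / 2\<close>: any other translate of the second point is at least as far.
\<close>

lemma setdist_orb_eq:
  assumes "dist x y \<le> l / 2" shows "setdist (orb x) (orb y) = dist x y"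
proof (rule antisym[OF setdist_orb_le le_setdist_orb])
  fix y' assume "y' \<in> orb y"
  then obtain g where g: "g \<in> \<Lambda>" "y' = g y" by (auto simp: orb_def)
  show "dist x y \<le> dist x y'"
  proof (cases "g = id")
    case False
    have "l \<le> dist y (g y)" by (rule displacement[OF g(1) False])
    also have "\<dots> \<le> dist x y + dist x y'" using g by (metis dist_commute dist_triangle)
    finally show ?thesis using assms by simp
  qed (use g in simp)
qed

lemma setdist_orb_attained:
  assumes "setdist (orb x) (orb y) < l / 2"
  obtains y' where "y' \<in> orb y" "dist x y' = setdist (orb x) (orb y)"
proof -
  obtain y' where y': "y' \<in> orb y" "dist x y' < l / 2" using orb_near[OF assms] .
  have "setdist (orb x) (orb y') = dist x y'" using y' by (intro setdist_orb_eq) auto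
  thus thesis using that y' orb_eqI[OF y'(1)] by simp
qed

lemma orbit_metric: "Metric_space (orbit_space \<Lambda>) setdist"
proof
  fix x y z assume "x \<in> orbit_space \<Lambda>" "y \<in> orbit_space \<Lambda>" 
  then obtain a b where ab: "x = orb a" "y = orb b" by (auto simp: orbit_space_eq)
  show "(setdist x y = 0) = (x = y)"
  proof
    assume 0: "setdist x y = 0"
    then obtain b' where "b' \<in> orb b" "dist a b' = 0"
      using setdist_orb_attained[of a b] l_pos ab by auto
    thus "x = y" using orb_eqI[of b' b] ab by simp
  next
    assume "x = y" thus "setdist x y = 0"
      using setdist_orb_le[of a a] ab setdist_pos_le[of x y] by (auto intro: antisym)
  qed
  assume "z \<in> orbit_space \<Lambda>"
  then obtain c where c: "z = orb c" by (auto simp: orbit_space_eq)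
  show "setdist x z \<le> setdist x y + setdist y z"
  proof (rule field_le_epsilon)
    fix e :: real assume e: "e > 0"
    obtain b' where b': "b' \<in> orb b" "dist a b' < setdist x y + e / 2"
      using orb_near[of a b "setdist x y + e / 2"] ab e by auto
    have "orb b' = y" using orb_eqI b' ab by simp
    then obtain c' where c': "c' \<in> orb c" "dist b' c' < setdist y z + e / 2"
      using orb_near[of b' c "setdist y z + e / 2"] c e by auto
    have "setdist x z \<le> dist a c'" using ab c c' self_in_orb by (auto intro: setdist_le_dist)
    also have "\<dots> \<le> dist a b' + dist b' c'" by (rule dist_triangle)
    finally show "setdist x z \<le> setdist x y + setdist y z + e" using b' c' by simp
  qed
qed (auto simp: setdist_sym)

lemma cocompactI:
  assumes K: "compact K" and cover: "\<And>x. \<exists>g\<in>\<Lambda>. g x \<in> K"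
  shows "cocompact \<Lambda>"
proof -
  interpret Q: Metric_space "orbit_space \<Lambda>" setdist by (rule orbit_metric)
  have "continuous_map euclidean Q.mtopology orb"
    unfolding Q.continuous_map_to_metric
  proof (intro ballI allI impI)
    fix x :: 'a and e :: real assume e: "e > 0"
    have "orb y \<in> Q.mball (orb x) e" if "dist x y < e" for y
      using setdist_orb_le[of x y] that by (auto simp: orbit_space_eq[symmetric] Q.in_mball) (auto simp: orbit_space_eq)
    thus "\<exists>U. openin euclidean U \<and> x \<in> U \<and> (\<forall>y\<in>U. orb y \<in> Q.mball (orb x) e)"
      using e by (intro exI[of _ "ball x e"]) auto
  qed
  hence "compactin Q.mtopology (orb ` K)"
    by (rule image_compactin[rotated]) (use K in simp)
  moreover have "orb ` K = orbit_space \<Lambda>"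
    using cover orb_image by (auto simp: orbit_space_eq image_iff) metis
  ultimately show ?thesis by (simp add: cocompact_def compact_space_def)
qed

text \<open>
  An element \<open>g\<close> is isolated because it is the only one that moves a given point \<open>x\<close> into the
  ball of radius \<open>l\<close> around \<open>g x\<close>.
\<close>

lemma discrete: "discrete_isom_subset \<Lambda>"
  unfolding discrete_isom_subset_def
proof (rule sym, subst discrete_topology_unique, intro conjI ballI)
  have sub: "\<Lambda> \<subseteq> carrier isom_group"
    using bij_mem isometry by (auto simp: isom_group_simps)
  let ?S = "{{g \<in> carrier isom_group. g ` K \<subseteq> U} |K U. compact K \<and> open U} :: ('a \<Rightarrow> 'a) set set"
  have "carrier isom_group \<in> ?S"
    by (rule CollectI) (rule exI[of _ "{}"], auto)
  hence "carrier isom_group \<subseteq> topspace (isom_topology :: ('a \<Rightarrow> 'a) topology)"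
    unfolding isom_topology_def topology_generated_by_topspace by blast
  thus "topspace (subtopology isom_topology \<Lambda>) = \<Lambda>"
    using sub by auto
  fix g assume g: "g \<in> \<Lambda>"
  fix x :: 'a
  let ?T = "{h \<in> carrier isom_group. h ` {x} \<subseteq> ball (g x) l}"
  have "?T \<in> ?S" by (rule CollectI) (rule exI[of _ "{x}"], rule exI[of _ "ball (g x) l"], simp)
  hence T: "openin isom_topology ?T"
    unfolding isom_topology_def by (rule topology_generated_by_Basis)
  have "?T \<inter> \<Lambda> = {g}"
  proof (intro equalityI subsetI)
    fix h assume h: "h \<in> ?T \<inter> \<Lambda>"
    obtain k where k: "k \<in> \<Lambda>" "k \<circ> g = id" "g \<circ> k = id" using inverse_mem[OF g] by blast
    have "dist (k (g x)) (k (h x)) < l" using isometry[OF k(1)] h by simp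
    hence "dist x ((k \<circ> h) x) < l" using k(2) by (simp add: pointfree_idE)
    hence "k \<circ> h = id" using displacement[of "k \<circ> h" x] comp_mem[OF k(1)] h by force
    hence "g \<circ> k \<circ> h = g" by (simp add: comp_assoc)
    hence "h = g" using k(3) by simp
    thus "h \<in> {g}" by simp
  qed (use g sub l_pos in auto)
  thus "openin (subtopology isom_topology \<Lambda>) {g}"
    using T unfolding openin_subtopology by blast
qed

text \<open>
  A closed geodesic of length \<open>L < l\<close> stays within distance \<open>L / 2\<close> of its starting point, hence
  in a ball over which the projection has a unique section, so that it lifts to a closed curve.
\<close>

lemma closed_geodesic_lift:
  assumes c: "closed_geodesic (orbit_space \<Lambda>) setdist L c" and L: "L < l"
  obtains c' :: "real \<Rightarrow> 'a" where "\<And>t. c' (t + L) = c' t"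
    "\<And>t. \<exists>\<delta>>0. \<forall>s\<in>ball t \<delta>. \<forall>s'\<in>ball t \<delta>. dist (c' s) (c' s') = \<bar>s - s'\<bar>"
proof -
  interpret Q: Metric_space "orbit_space \<Lambda>" setdist by (rule orbit_metric)
  have L0: "L > 0" and per: "\<And>t. c (t + L) = c t" and mem: "\<And>t. c t \<in> orbit_space \<Lambda>"
    and loc: "\<And>t. \<exists>\<delta>>0. \<forall>s\<in>ball t \<delta>. \<forall>s'\<in>ball t \<delta>. setdist (c s) (c s') = \<bar>s - s'\<bar>"
    using c by (auto simp: closed_geodesic_def geodesic_line_def)
  have lip: "setdist (c a) (c b) \<le> b - a" if "a \<le> b" for a b
    using that
  proof (induction rule: Bolzano)
    case (trans a b d)
    thus ?case using Q.triangle[OF mem mem mem, of a d b] by linarith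
  next
    case (local x)
    obtain \<delta> where d: "\<delta> > 0" "\<forall>s\<in>ball x \<delta>. \<forall>s'\<in>ball x \<delta>. setdist (c s) (c s') = \<bar>s - s'\<bar>"
      using loc by blast
    show ?case
      by (intro exI[of _ \<delta>] conjI d(1) allI impI, subst d(2)[rule_format]) (auto simp: dist_real_def)
  qed
  note per_int = period_of_int_multiple[of c L, OF per]
  obtain x where x: "c 0 = orb x" using mem[of 0] by (auto simp: orbit_space_eq)
  have near: "setdist (c 0) (c s) \<le> L / 2" for s
  proof -
    \<comment> \<open>by periodicity the parameter can be moved into the interval from \<open>- L / 2\<close> to \<open>L / 2\<close>\<close>
    define u where "u = s - of_int (round (s / L)) * L"
    have "\<bar>of_int (round (s / L)) - s / L\<bar> \<le> 1 / 2" by (rule of_int_round_abs_le)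
    hence "\<bar>of_int (round (s / L)) - s / L\<bar> * L \<le> 1 / 2 * L" using L0 by (intro mult_right_mono) auto
    hence "\<bar>(of_int (round (s / L)) - s / L) * L\<bar> \<le> L / 2" using L0 by (simp add: abs_mult)
    hence u: "\<bar>u\<bar> \<le> L / 2" using L0 by (simp add: u_def algebra_simps abs_minus_commute)
    have cs: "c s = c u" using per_int[of u "round (s / L)"] by (simp add: u_def)
    show ?thesis
      using lip[of 0 u] lip[of u 0] u by (cases "u \<ge> 0") (auto simp: cs Q.commute[of "c u"])
  qed
  have ex: "\<exists>y. y \<in> c s \<and> dist x y \<le> L / 2" for s
  proof -
    obtain y where y: "c s = orb y" using mem[of s] by (auto simp: orbit_space_eq)
    show ?thesis using setdist_orb_attained[of x y] near[of s] L y x by (metis divide_strict_right_mono le_less_trans zero_less_numeral)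
  qed
  \<comment> \<open>the lift depends on the point \<open>c s\<close> only, hence inherits the period\<close>
  define c' where "c' s = (SOME y. y \<in> c s \<and> dist x y \<le> L / 2)" for s
  have c': "c' s \<in> c s" "dist x (c' s) \<le> L / 2" for s
    using someI_ex[OF ex[of s]] by (auto simp: c'_def)
  have orb_c': "orb (c' s) = c s" for s
    using mem[of s] c'(1)[of s] orb_eqI by (auto simp: orbit_space_eq)
  have close: "dist (c' s) (c' t) \<le> L" for s t
    using c'(2)[of s] c'(2)[of t] dist_triangle[of "c' s" "c' t" x] by (simp add: dist_commute)
  have "\<exists>\<delta>>0. \<forall>s\<in>ball t \<delta>. \<forall>s'\<in>ball t \<delta>. dist (c' s) (c' s') = \<bar>s - s'\<bar>" for t
  proof -
    obtain \<delta> where d: "\<delta> > 0" "\<forall>s\<in>ball t \<delta>. \<forall>s'\<in>ball t \<delta>. setdist (c s) (c s') = \<bar>s - s'\<bar>"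
      using loc by blast
    \<comment> \<open>within this distance, the translate of \<open>c' s'\<close> nearest to \<open>c' s\<close> is \<open>c' s'\<close> itself\<close>
    define \<eta> where "\<eta> = min \<delta> (min ((l - L) / 2) (l / 4))"
    have "\<eta> > 0" using d(1) L l_pos by (simp add: \<eta>_def)
    moreover have "dist (c' s) (c' s') = \<bar>s - s'\<bar>" if s: "s \<in> ball t \<eta>" "s' \<in> ball t \<eta>" for s s'
    proof -
      have sd: "setdist (orb (c' s)) (orb (c' s')) = \<bar>s - s'\<bar>"
        using d(2) s by (simp add: orb_c' \<eta>_def)
      have lt: "\<bar>s - s'\<bar> < l - L" "\<bar>s - s'\<bar> < l / 2"
      proof -
        have "\<bar>t - s\<bar> < \<eta>" "\<bar>t - s'\<bar> < \<eta>" "\<eta> \<le> (l - L) / 2" "\<eta> \<le> l / 4"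
          using s unfolding ball_def dist_real_def mem_Collect_eq by (simp, simp) (unfold \<eta>_def, linarith+)
        hence "\<bar>s - s'\<bar> < 2 * \<eta>" "2 * \<eta> \<le> l - L" "2 * \<eta> \<le> l / 2" by (arith, simp, simp)
        thus "\<bar>s - s'\<bar> < l - L" "\<bar>s - s'\<bar> < l / 2" by simp_all
      qed
      obtain y where y: "y \<in> orb (c' s')" "dist (c' s) y = \<bar>s - s'\<bar>"
        using setdist_orb_attained[of "c' s" "c' s'"] sd lt by auto
      then obtain g where g: "g \<in> \<Lambda>" "y = g (c' s')" by (auto simp: orb_def)
      have "dist (c' s') (g (c' s')) \<le> dist (c' s') (c' s) + dist (c' s) y"
        using g by (simp add: dist_triangle)
      also have "\<dots> < l" using close[of s' s] y lt by simp
      finally have "g = id" using displacement[OF g(1), of "c' s'"] by force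
      thus ?thesis using g y by simp
    qed
    ultimately show ?thesis by blast
  qed
  moreover have "c' (t + L) = c' t" for t by (simp add: c'_def per)
  ultimately show thesis using that by blast
qed

text \<open>An axis of a group element that moves it by exactly \<open>l\<close> projects to a closed geodesic.\<close>

lemma closed_geodesic_axis:
  assumes line: "\<And>s t. dist (\<gamma> s) (\<gamma> t) = \<bar>s - t\<bar>"
    and g: "g \<in> \<Lambda>" "\<And>t. g (\<gamma> t) = \<gamma> (t + l)"
  shows "closed_geodesic (orbit_space \<Lambda>) setdist l (\<lambda>t. orb (\<gamma> t))"
  unfolding closed_geodesic_def geodesic_line_def
proof (intro conjI allI l_pos)
  show "range (\<lambda>t. orb (\<gamma> t)) \<subseteq> orbit_space \<Lambda>" by (auto simp: orbit_space_eq)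
  show "orb (\<gamma> (t + l)) = orb (\<gamma> t)" for t using orb_image[OF g(1), of "\<gamma> t"] by (simp add: g(2))
  have "setdist (orb (\<gamma> s)) (orb (\<gamma> s')) = \<bar>s - s'\<bar>" if "s \<in> ball t (l / 4)" "s' \<in> ball t (l / 4)" for s s' t
  proof -
    have "\<bar>t - s\<bar> < l / 4" "\<bar>t - s'\<bar> < l / 4" using that by (auto simp: dist_real_def)
    hence "dist (\<gamma> s) (\<gamma> s') \<le> l / 2" unfolding line by linarith
    thus ?thesis by (simp add: setdist_orb_eq line)
  qed
  thus "\<exists>\<delta>>0. \<forall>s\<in>ball t \<delta>. \<forall>s'\<in>ball t \<delta>. setdist (orb (\<gamma> s)) (orb (\<gamma> s')) = \<bar>s - s'\<bar>" for t
    using l_pos by (intro exI[of _ "l / 4"]) auto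
qed

end

section \<open>Closed geodesics in hyperbolic manifolds\<close>

text \<open>
  The difference of the two sides is orthogonal to the timelike vector of the midpoint and has
  norm zero, so it vanishes.
\<close>

lemma hyperbolic_midpoint:
  assumes "dist a m = h" "dist m b = h" "dist a b = 2 * h"
  shows "Rep_hyperbolic a + Rep_hyperbolic b = (2 * cosh h) *\<^sub>R Rep_hyperbolic m"
proof -
  define A B M where "A = Rep_hyperbolic a" and "B = Rep_hyperbolic b" and "M = Rep_hyperbolic m"
  have self: "A \<bullet>\<^sub>M A = -1" "B \<bullet>\<^sub>M B = -1" "M \<bullet>\<^sub>M M = -1"
    by (simp_all add: A_def B_def M_def minkowski_Rep_hyperbolic)
  have pair: "A \<bullet>\<^sub>M M = - cosh h" "M \<bullet>\<^sub>M B = - cosh h" "A \<bullet>\<^sub>M B = - cosh (2 * h)"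
    using cosh_dist_hyperbolic[of a m] cosh_dist_hyperbolic[of m b] cosh_dist_hyperbolic[of a b] assms
    by (simp_all add: A_def B_def M_def)
  have pair': "M \<bullet>\<^sub>M A = - cosh h" "B \<bullet>\<^sub>M M = - cosh h" "B \<bullet>\<^sub>M A = - cosh (2 * h)"
    using pair minkowski_commute by metis+
  let ?w = "A + B - (2 * cosh h) *\<^sub>R M"
  have "?w \<bullet>\<^sub>M M = 0" by (simp add: minkowski_simps self pair pair')
  moreover have "?w \<bullet>\<^sub>M ?w = 0"
    unfolding minkowski_simps self pair pair' cosh_double_cosh
    by (simp add: power2_eq_square algebra_simps)
  ultimately have "?w = 0" using minkowski_orthogonal_eq_0[OF self(3)] by blast
  thus ?thesis by (simp add: A_def B_def M_def)
qed

text \<open>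
  Along a geodesic the hyperbolic cosine of the distance to a fixed point satisfies
  \<open>\<phi> (t + h) + \<phi> (t - h) = 2 cosh h \<phi> t\<close>, so it has no maximum.
\<close>

lemma no_closed_geodesic_hyperbolic:
  fixes c :: "real \<Rightarrow> 'n::finite hyperbolic"
  assumes L: "L > 0" and per: "\<And>t. c (t + L) = c t"
    and loc: "\<And>t. \<exists>\<delta>>0. \<forall>s\<in>ball t \<delta>. \<forall>s'\<in>ball t \<delta>. dist (c s) (c s') = \<bar>s - s'\<bar>"
  shows False
proof -
  define \<phi> where "\<phi> t = cosh (dist (c 0) (c t))" for t
  have "continuous_on UNIV c"
    unfolding continuous_on_iff
  proof (intro ballI allI impI)
    fix t e :: real assume e: "e > 0"
    obtain \<delta> where d: "\<delta> > 0" "\<forall>s\<in>ball t \<delta>. \<forall>s'\<in>ball t \<delta>. dist (c s) (c s') = \<bar>s - s'\<bar>"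
      using loc by blast
    show "\<exists>d>0. \<forall>s\<in>UNIV. dist s t < d \<longrightarrow> dist (c s) (c t) < e"
      using d e by (intro exI[of _ "min \<delta> e"]) (auto simp: dist_real_def abs_minus_commute)
  qed
  hence "continuous_on {0..L} \<phi>"
    unfolding \<phi>_def by (intro continuous_intros) (auto intro: continuous_on_subset)
  then obtain m where m: "m \<in> {0..L}" "\<And>t. t \<in> {0..L} \<Longrightarrow> \<phi> t \<le> \<phi> m"
    using continuous_attains_sup[of "{0..L}" \<phi>] L by auto
  note per_int = period_of_int_multiple[of c L, OF per]
  have max: "\<phi> t \<le> \<phi> m" for t
  proof -
    have "t - of_int \<lfloor>t / L\<rfloor> * L \<in> {0..L}"
    proof -
      have "of_int \<lfloor>t / L\<rfloor> * L \<le> t"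
        using of_int_floor_le[of "t / L"] unfolding pos_le_divide_eq[OF L] .
      moreover have "t < (of_int \<lfloor>t / L\<rfloor> + 1) * L"
        using floor_correct[of "t / L"] unfolding pos_divide_less_eq[OF L] by simp
      ultimately show ?thesis by (auto simp: algebra_simps)
    qed
    from m(2)[OF this] show ?thesis
      using per_int[of t "- \<lfloor>t / L\<rfloor>"] by (simp add: \<phi>_def)
  qed
  obtain \<delta> where d: "\<delta> > 0" "\<forall>s\<in>ball m \<delta>. \<forall>s'\<in>ball m \<delta>. dist (c s) (c s') = \<bar>s - s'\<bar>"
    using loc by blast
  define h where "h = \<delta> / 2"
  have h: "h > 0" using d by (simp add: h_def)
  have "Rep_hyperbolic (c (m - h)) + Rep_hyperbolic (c (m + h)) = (2 * cosh h) *\<^sub>R Rep_hyperbolic (c m)"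
    by (rule hyperbolic_midpoint; subst d(2)[rule_format])
      (use d(1) in \<open>auto simp: h_def dist_real_def\<close>)
  hence "Rep_hyperbolic (c 0) \<bullet>\<^sub>M Rep_hyperbolic (c (m - h)) + Rep_hyperbolic (c 0) \<bullet>\<^sub>M Rep_hyperbolic (c (m + h))
      = 2 * cosh h * (Rep_hyperbolic (c 0) \<bullet>\<^sub>M Rep_hyperbolic (c m))"
    by (metis minkowski_add_right minkowski_scaleR_right)
  hence "\<phi> (m - h) + \<phi> (m + h) = 2 * cosh h * \<phi> m"
    by (simp add: \<phi>_def cosh_dist_hyperbolic)
  moreover have "\<phi> m \<ge> 1" by (simp add: \<phi>_def cosh_real_ge_1)
  moreover have "cosh h > 1" using cosh_real_strict_mono[of 0 h] h by simp
  hence "cosh h * \<phi> m > 1 * \<phi> m" using \<open>\<phi> m \<ge> 1\<close> by (intro mult_strict_right_mono) auto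
  ultimately show False using max[of "m - h"] max[of "m + h"] by simp
qed

text \<open>
  A closed geodesic shorter than the displacement bound would lift to a closed geodesic of
  hyperbolic space, which does not exist. So the bound is the systole as soon as some element
  translates a line by exactly this amount.
\<close>

lemma systole_eq_displacement:
  fixes \<Lambda> :: "('n::finite hyperbolic \<Rightarrow> 'n hyperbolic) set"
  assumes "displacing_group \<Lambda> l"
    and line: "\<And>s t. dist (\<gamma> s) (\<gamma> t) = \<bar>s - t\<bar>"
    and g: "g \<in> \<Lambda>" "\<And>t. g (\<gamma> t) = \<gamma> (t + l)"
  shows "systole (orbit_space \<Lambda>) setdist = l"
proof -
  interpret displacing_group \<Lambda> l by fact
  show ?thesis unfolding systole_def
  proof (rule Least_equality)
    show "\<exists>c. closed_geodesic (orbit_space \<Lambda>) setdist l c"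
      using closed_geodesic_axis[OF line g] by blast
    fix L assume "\<exists>c. closed_geodesic (orbit_space \<Lambda>) setdist L c"
    then obtain c where c: "closed_geodesic (orbit_space \<Lambda>) setdist L c" by blast
    show "l \<le> L"
    proof (rule ccontr)
      assume "\<not> l \<le> L"
      with closed_geodesic_lift[OF c] show False
        using no_closed_geodesic_hyperbolic c unfolding closed_geodesic_def by (metis not_le)
    qed
  qed
qed

definition hyperbolic_map ::
    "('n spacetime \<Rightarrow> 'n spacetime) \<Rightarrow> 'n::finite hyperbolic \<Rightarrow> 'n hyperbolic" where
  "hyperbolic_map A x = Abs_hyperbolic (A (Rep_hyperbolic x))"

lemma Rep_hyperbolic_map:
  "A \<in> lorentz \<Longrightarrow> Rep_hyperbolic (hyperbolic_map A x) = A (Rep_hyperbolic x)"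
  by (simp add: hyperbolic_map_def Rep_Abs_hyperbolic lorentz_hyperboloid Rep_hyperbolic_in)

lemma hyperbolic_map_comp:
  "A \<in> lorentz \<Longrightarrow> B \<in> lorentz \<Longrightarrow> hyperbolic_map (A \<circ> B) = hyperbolic_map A \<circ> hyperbolic_map B"
  by (rule ext) (simp flip: Rep_hyperbolic_inject add: Rep_hyperbolic_map lorentz_comp)

lemma hyperbolic_map_id: "hyperbolic_map id = id"
  by (rule ext) (simp add: hyperbolic_map_def Rep_hyperbolic_inverse)

lemma dist_hyperbolic_map:
  "A \<in> lorentz \<Longrightarrow> dist (hyperbolic_map A x) (hyperbolic_map A y) = dist x y"
  by (simp add: dist_hyperbolic_def Rep_hyperbolic_map lorentz_minkowski)

text \<open>
  The vertical projection to \<open>\<real>\<^sup>n\<close> is a global chart, which provides the compact sets needed for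
  cocompactness.
\<close>

lemma continuous_hyperboloid_chart:
  "continuous_on UNIV (\<lambda>u :: real ^ 'n::finite. Abs_hyperbolic (u, sqrt (1 + u \<bullet> u)))"
proof -
  define \<phi> where "\<phi> u = (u, sqrt (1 + u \<bullet> u))" for u :: "real ^ 'n"
  have mem: "\<phi> u \<in> hyperboloid" for u
    by (simp add: \<phi>_def hyperboloid_def minkowski_def add_pos_nonneg)
  have c1: "continuous_on UNIV \<phi>" unfolding \<phi>_def by (intro continuous_intros)
  have "isCont (\<lambda>v. Abs_hyperbolic (\<phi> v)) u" for u
  proof -
    have ge: "1 \<le> - (\<phi> v \<bullet>\<^sub>M \<phi> u)" for v
      using hyperboloid_minkowski_le[OF mem[of v] mem[of u]] by simp
    have "continuous_on UNIV (\<lambda>v. arcosh (- (\<phi> v \<bullet>\<^sub>M \<phi> u)))"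
      by (rule continuous_on_compose2[OF continuous_on_arcosh[OF order.refl]])
        (use c1 ge in \<open>auto intro!: continuous_intros\<close>)
    hence "isCont (\<lambda>v. dist (Abs_hyperbolic (\<phi> v)) (Abs_hyperbolic (\<phi> u))) u"
      by (simp add: dist_Abs_hyperbolic mem o_def continuous_on_eq_continuous_at)
    hence "((\<lambda>v. dist (Abs_hyperbolic (\<phi> v)) (Abs_hyperbolic (\<phi> u))) \<longlongrightarrow> 0) (at u)"
      by (simp add: isCont_def)
    thus ?thesis unfolding isCont_def by (rule tendsto_dist_iff[THEN iffD2])
  qed
  thus ?thesis by (simp add: continuous_on_eq_continuous_at \<phi>_def)
qed

lemma compact_bounded_time:
  "compact {x :: 'n::finite hyperbolic. snd (Rep_hyperbolic x) \<le> R}"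
proof -
  define \<phi> where "\<phi> u = Abs_hyperbolic (u, sqrt (1 + u \<bullet> u))" for u :: "real ^ 'n"
  have cont: "continuous_on UNIV \<phi>" unfolding \<phi>_def by (rule continuous_hyperboloid_chart)
  have mem: "(u, sqrt (1 + u \<bullet> u)) \<in> hyperboloid" for u :: "real ^ 'n"
    by (simp add: hyperboloid_def minkowski_def add_pos_nonneg)
  have "compact {u :: real ^ 'n. sqrt (1 + u \<bullet> u) \<le> R}"
  proof (rule compact_eq_bounded_closed[THEN iffD2], rule conjI)
    have "norm u \<le> R" if "sqrt (1 + u \<bullet> u) \<le> R" for u :: "real ^ 'n"
      using that order_trans[of "norm u" "sqrt (1 + u \<bullet> u)" R] by (simp add: norm_eq_sqrt_inner)
    thus "bounded {u :: real ^ 'n. sqrt (1 + u \<bullet> u) \<le> R}" by (auto simp: bounded_iff)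
    show "closed {u :: real ^ 'n. sqrt (1 + u \<bullet> u) \<le> R}"
      by (intro closed_Collect_le continuous_intros)
  qed
  hence "compact (\<phi> ` {u :: real ^ 'n. sqrt (1 + u \<bullet> u) \<le> R})"
    by (intro compact_continuous_image) (auto intro: continuous_on_subset[OF cont])
  also have "\<phi> ` {u :: real ^ 'n. sqrt (1 + u \<bullet> u) \<le> R} = {x. snd (Rep_hyperbolic x) \<le> R}"
  proof (intro equalityI subsetI)
    fix x :: "'n hyperbolic" assume x: "x \<in> {x. snd (Rep_hyperbolic x) \<le> R}"
    define u where "u = fst (Rep_hyperbolic x)"
    have "snd (Rep_hyperbolic x) = sqrt (1 + u \<bullet> u)"
      using minkowski_Rep_hyperbolic[of x] snd_Rep_hyperbolic[of x]
      by (intro real_sqrt_unique[symmetric]) (auto simp: minkowski_def u_def power2_eq_square)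
    hence "Rep_hyperbolic x = (u, sqrt (1 + u \<bullet> u))" by (simp add: u_def prod_eq_iff)
    hence "x = \<phi> u" by (metis \<phi>_def Rep_hyperbolic_inverse)
    moreover have "sqrt (1 + u \<bullet> u) \<le> R" using x \<open>snd (Rep_hyperbolic x) = _\<close> by simp
    ultimately show "x \<in> \<phi> ` {u. sqrt (1 + u \<bullet> u) \<le> R}" by blast
  qed (auto simp: \<phi>_def Rep_Abs_hyperbolic mem)
  finally show ?thesis .
qed

text \<open>
  All conditions on the group of a compact hyperbolic manifold of systole \<open>l\<close> follow from the
  displacement bound, coboundedness, and the existence of one axis. Torsion is excluded because
  the vectors in a finite orbit add up to a timelike vector, whose direction would be a fixed
  point.
\<close>

theorem compact_manifold_of_lorentz_group:
  fixes G :: "('n::finite spacetime \<Rightarrow> 'n spacetime) set"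
  assumes G: "G \<subseteq> lorentz" "id \<in> G" "\<And>A B. A \<in> G \<Longrightarrow> B \<in> G \<Longrightarrow> A \<circ> B \<in> G"
      "\<And>A. A \<in> G \<Longrightarrow> \<exists>B\<in>G. B \<circ> A = id \<and> A \<circ> B = id"
    and l: "l > 0"
    and disp: "\<And>A p. A \<in> G \<Longrightarrow> A \<noteq> id \<Longrightarrow> p \<in> hyperboloid \<Longrightarrow> p \<bullet>\<^sub>M A p \<le> - cosh l"
    and cob: "\<And>p. p \<in> hyperboloid \<Longrightarrow> \<exists>A\<in>G. snd (A p) \<le> R"
    and axis: "p \<in> hyperboloid" "v \<bullet>\<^sub>M v = 1" "p \<bullet>\<^sub>M v = 0" "T \<in> G"
      "\<And>t. T (cosh t *\<^sub>R p + sinh t *\<^sub>R v) = cosh (t + l) *\<^sub>R p + sinh (t + l) *\<^sub>R v"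
  shows "\<exists>M :: 'n hyperbolic set set. compact_hyperbolic_manifold M \<and> systole M setdist = l"
proof -
  define \<Lambda> where "\<Lambda> = hyperbolic_map ` G"
  have lor: "A \<in> lorentz" if "A \<in> G" for A using G(1) that by blast
  have disp': "l \<le> dist x (hyperbolic_map A x)" if "A \<in> G" "A \<noteq> id" for A x
  proof -
    have "cosh l \<le> cosh (dist x (hyperbolic_map A x))"
      using disp[OF that Rep_hyperbolic_in[of x]]
      by (simp add: cosh_dist_hyperbolic Rep_hyperbolic_map lor that)
    thus ?thesis using l by (subst (asm) cosh_real_nonneg_le_iff) auto
  qed
  have dg: "displacing_group \<Lambda> l"
  proof
    fix g h :: "'n hyperbolic \<Rightarrow> 'n hyperbolic" and x y
    show "id \<in> \<Lambda>" using G(2) hyperbolic_map_id unfolding \<Lambda>_def by (metis image_eqI)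
    assume "g \<in> \<Lambda>"
    then obtain A where A: "A \<in> G" "g = hyperbolic_map A" by (auto simp: \<Lambda>_def)
    show "dist (g x) (g y) = dist x y" using A lor by (simp add: dist_hyperbolic_map)
    obtain B where "B \<in> G" "B \<circ> A = id" "A \<circ> B = id" using G(4) A by blast
    thus "\<exists>h\<in>\<Lambda>. h \<circ> g = id \<and> g \<circ> h = id"
      using A lor hyperbolic_map_comp[of A B] hyperbolic_map_comp[of B A]
      by (intro bexI[of _ "hyperbolic_map B"]) (auto simp: \<Lambda>_def hyperbolic_map_id)
    {
      assume "h \<in> \<Lambda>"
      then obtain B where B: "B \<in> G" "h = hyperbolic_map B" by (auto simp: \<Lambda>_def)
      have "hyperbolic_map (A \<circ> B) = g \<circ> h" using A B lor by (simp add: hyperbolic_map_comp)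
      thus "g \<circ> h \<in> \<Lambda>" using G(3) A B unfolding \<Lambda>_def by (metis image_eqI)
    next
      assume "g \<noteq> id"
      hence "A \<noteq> id" using A hyperbolic_map_id by metis
      thus "l \<le> dist x (g x)" using disp' A by simp
    }
  qed (rule l)
  interpret displacing_group \<Lambda> l by (rule dg)
  have "torsion_free isom_group \<Lambda>"
    unfolding torsion_free_def isom_group_pow isom_group_simps
  proof (intro ballI allI impI)
    fix g and k :: nat assume g: "g \<in> \<Lambda>" and k: "k > 0" "g ^^ k = id"
    then obtain A where A: "A \<in> G" "g = hyperbolic_map A" by (auto simp: \<Lambda>_def)
    fix x :: "'n hyperbolic"
    define q where "q i = Rep_hyperbolic ((g ^^ i) x)" for i
    define z where "z = (\<Sum>i<k. q i)"
    have Aq: "A (q i) = q (Suc i)" for i using A lor by (simp add: q_def Rep_hyperbolic_map)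
    have q: "q i \<in> hyperboloid" for i by (simp add: q_def Rep_hyperbolic_in)
    have "A z = (\<Sum>i<k. q (Suc i))"
      using lorentz_linear[OF lor[OF A(1)]] by (simp add: z_def linear_sum Aq)
    also have "\<dots> = z"
      using sum.lessThan_Suc_shift[of q k] k(2) by (simp add: z_def q_def)
    finally have Az: "A z = z" .
    have "z \<bullet>\<^sub>M z = (\<Sum>i<k. \<Sum>j<k. q i \<bullet>\<^sub>M q j)"
      using bilinear_sum[OF bilinear_minkowski, of q "{..<k}" q "{..<k}"] by (simp add: z_def sum.cartesian_product)
    also have "0 < (\<Sum>i<k. \<Sum>j<k. - (q i \<bullet>\<^sub>M q j))"
    proof (intro sum_pos)
      show "0 < - (q i \<bullet>\<^sub>M q j)" for i j using hyperboloid_minkowski_le[OF q[of i] q[of j]] by simp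
    qed (use k(1) in auto)
    hence "(\<Sum>i<k. \<Sum>j<k. q i \<bullet>\<^sub>M q j) < 0" by (simp add: sum_negf)
    finally have zz: "z \<bullet>\<^sub>M z < 0" .
    have "snd z = (\<Sum>i<k. snd (q i))" by (simp add: z_def snd_sum)
    also have "\<dots> > 0" using k(1) q by (intro sum_pos) (auto simp: hyperboloid_def)
    finally have z: "snd z > 0" .
    define y where "y = (1 / sqrt (- (z \<bullet>\<^sub>M z))) *\<^sub>R z"
    have y: "y \<in> hyperboloid" unfolding y_def by (rule hyperboloid_normalize[OF zz z])
    have "A y = y" using lorentz_linear[OF lor[OF A(1)]] Az by (simp add: y_def linear_cmul)
    hence "A = id" using disp[OF A(1) _ y] cosh_real_strict_mono[of 0 l] l hyperboloid_self[OF y] by force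
    thus "g = id" using A hyperbolic_map_id by simp
  qed
  moreover have "cocompact \<Lambda>"
  proof (rule cocompactI[OF compact_bounded_time])
    fix x obtain A where "A \<in> G" "snd (A (Rep_hyperbolic x)) \<le> R"
      using cob[OF Rep_hyperbolic_in] by blast
    thus "\<exists>g\<in>\<Lambda>. g x \<in> {x. snd (Rep_hyperbolic x) \<le> R}"
      by (auto simp: \<Lambda>_def Rep_hyperbolic_map lor)
  qed
  moreover have "systole (orbit_space \<Lambda>) setdist = l"
  proof (rule systole_eq_displacement[OF dg])
    define \<gamma> where "\<gamma> t = cosh t *\<^sub>R p + sinh t *\<^sub>R v" for t
    have vp: "v \<bullet>\<^sub>M p = 0" using axis(3) by (simp add: minkowski_commute)
    have pair: "\<gamma> s \<bullet>\<^sub>M \<gamma> t = - cosh (s - t)" for s t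
      by (simp add: \<gamma>_def minkowski_simps hyperboloid_self[OF axis(1)] axis(2,3) vp cosh_diff)
    have mem: "\<gamma> t \<in> hyperboloid" for t
    proof -
      have "\<gamma> t \<bullet>\<^sub>M (0, 1) < 0"
      proof (rule timelike_constant_sign[OF _ axis(1) _ origin_in_hyperboloid])
        show "\<gamma> t \<bullet>\<^sub>M p \<le> 0"
          using cosh_real_pos[of t] by (simp add: \<gamma>_def minkowski_simps hyperboloid_self[OF axis(1)] vp)
      qed (simp add: pair)
      thus ?thesis by (simp add: hyperboloid_def pair)
    qed
    show "dist (Abs_hyperbolic (\<gamma> s)) (Abs_hyperbolic (\<gamma> t)) = \<bar>s - t\<bar>" for s t
      using arcosh_cosh_real[of "\<bar>s - t\<bar>"] by (simp add: dist_Abs_hyperbolic mem pair)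
    show "hyperbolic_map T \<in> \<Lambda>" using axis(4) by (simp add: \<Lambda>_def)
    show "hyperbolic_map T (Abs_hyperbolic (\<gamma> t)) = Abs_hyperbolic (\<gamma> (t + l))" for t
      by (simp add: hyperbolic_map_def Rep_Abs_hyperbolic mem) (simp add: \<gamma>_def axis(5))
  qed
  ultimately show ?thesis
    unfolding compact_hyperbolic_manifold_def using subgroup_isom_group discrete by blast
qed

section \<open>Reflecting a chamber across its walls\<close>

primrec refl_word :: "'n::finite spacetime list \<Rightarrow> 'n spacetime \<Rightarrow> 'n spacetime" where
  "refl_word [] = id"
| "refl_word (w # ws) = reflection w \<circ> refl_word ws"

lemma refl_word_append: "refl_word (us @ vs) = refl_word us \<circ> refl_word vs"
  by (induction us) (simp_all add: comp_assoc)

text \<open>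
  The data for doubling: a cobounded group \<open>\<Gamma>\<close> of Lorentz transformations, and an invariant family
  of hyperplanes, given by their unit normals \<open>\<N>\<close>, of which any two are at distance at least
  \<open>arcosh c\<close>. The hyperplanes of \<open>w\<^sub>1\<close> and \<open>w\<^sub>2\<close> attain this distance. Nontrivial elements of
  \<open>\<Gamma>\<close> move every point by at least twice the distance; its double has the hyperbolic cosine
  \<open>2 * c\<^sup>2 - 1\<close>.
\<close>

locale wall_system =
  fixes \<Gamma> :: "('n::finite spacetime \<Rightarrow> 'n spacetime) set"
    and \<N> :: "'n spacetime set" and c R :: real and w\<^sub>1 w\<^sub>2 :: "'n spacetime"
  assumes lor: "\<Gamma> \<subseteq> lorentz" and id_mem: "id \<in> \<Gamma>"
    and comp_mem: "\<And>A B. A \<in> \<Gamma> \<Longrightarrow> B \<in> \<Gamma> \<Longrightarrow> A \<circ> B \<in> \<Gamma>"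
    and inverse_mem: "\<And>A. A \<in> \<Gamma> \<Longrightarrow> \<exists>B\<in>\<Gamma>. B \<circ> A = id \<and> A \<circ> B = id"
    and disp: "\<And>A p. A \<in> \<Gamma> \<Longrightarrow> A \<noteq> id \<Longrightarrow> p \<in> hyperboloid \<Longrightarrow> p \<bullet>\<^sub>M A p \<le> - (2 * c\<^sup>2 - 1)"
    and cobounded: "\<And>p. p \<in> hyperboloid \<Longrightarrow> \<exists>A\<in>\<Gamma>. snd (A p) \<le> R"
    and c: "c > 1"
    and unit: "\<And>w. w \<in> \<N> \<Longrightarrow> w \<bullet>\<^sub>M w = 1"
    and uminus_mem: "\<And>w. w \<in> \<N> \<Longrightarrow> - w \<in> \<N>"
    and invariant: "\<And>A w. A \<in> \<Gamma> \<Longrightarrow> w \<in> \<N> \<Longrightarrow> A w \<in> \<N>"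
    and gap: "\<And>w w'. w \<in> \<N> \<Longrightarrow> w' \<in> \<N> \<Longrightarrow> w' \<noteq> w \<Longrightarrow> w' \<noteq> - w \<Longrightarrow> c \<le> \<bar>w \<bullet>\<^sub>M w'\<bar>"
    and locally_finite: "\<And>b. finite {w \<in> \<N>. \<bar>snd w\<bar> \<le> b}"
    and w12: "w\<^sub>1 \<in> \<N>" "w\<^sub>2 \<in> \<N>" "w\<^sub>1 \<bullet>\<^sub>M w\<^sub>2 = - c" "snd (w\<^sub>1 + w\<^sub>2) > 0"
begin

lemma \<Gamma>_lorentz: "A \<in> \<Gamma> \<Longrightarrow> A \<in> lorentz"
  using lor by blast

lemma c_bound: "c + 1 < 2 * (c * c)"
proof -
  have "1 * c < c * c" using c by (intro mult_strict_right_mono) auto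
  with c show ?thesis by linarith
qed

lemma w21: "w\<^sub>2 \<bullet>\<^sub>M w\<^sub>1 = - c"
  using w12(3) by (simp add: minkowski_commute)

text \<open>
  The midpoint of the common perpendicular of the two closest hyperplanes.
\<close>

definition base :: "'n::finite spacetime" where
  "base = (1 / sqrt (2 * c - 2)) *\<^sub>R (w\<^sub>1 + w\<^sub>2)"

lemma base_hyperboloid: "base \<in> hyperboloid"
proof -
  have "(w\<^sub>1 + w\<^sub>2) \<bullet>\<^sub>M (w\<^sub>1 + w\<^sub>2) = 2 - 2 * c"
    by (simp add: minkowski_simps unit w12 w21)
  with hyperboloid_normalize[of "w\<^sub>1 + w\<^sub>2"] c w12(4) show ?thesis by (simp add: base_def)
qed

lemma minkowski_base: "w \<bullet>\<^sub>M base = (w \<bullet>\<^sub>M w\<^sub>1 + w \<bullet>\<^sub>M w\<^sub>2) / sqrt (2 * c - 2)"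
  by (simp add: base_def minkowski_simps)

text \<open>
  The span of \<open>w\<close>, \<open>w\<^sub>1\<close> and \<open>w\<^sub>2\<close> contains a timelike vector, so the Gram determinant of the three
  vectors is not positive.
\<close>

lemma gram_w12:
  assumes w: "w \<bullet>\<^sub>M w = 1"
  shows "1 - c\<^sup>2 \<le> (w \<bullet>\<^sub>M w\<^sub>1)\<^sup>2 + (w \<bullet>\<^sub>M w\<^sub>2)\<^sup>2 + 2 * c * (w \<bullet>\<^sub>M w\<^sub>1) * (w \<bullet>\<^sub>M w\<^sub>2)"
proof -
  define a b s where "a = w \<bullet>\<^sub>M w\<^sub>1" and "b = w \<bullet>\<^sub>M w\<^sub>2" and "s = w \<bullet>\<^sub>M base"
  have s2: "s\<^sup>2 * (2 * c - 2) = (a + b)\<^sup>2"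
    using c by (simp add: s_def minkowski_base a_def b_def power_divide)
  have vb: "(w\<^sub>1 - w\<^sub>2) \<bullet>\<^sub>M base = 0"
    by (simp add: minkowski_base minkowski_simps unit w12 w21)
  have vv: "(w\<^sub>1 - w\<^sub>2) \<bullet>\<^sub>M (w\<^sub>1 - w\<^sub>2) = 2 * c + 2" by (simp add: minkowski_simps unit w12 w21)
  have "(a - b)\<^sup>2 \<le> (1 + s\<^sup>2) * (2 * c + 2)"
    using projected_Cauchy_Schwarz[OF base_hyperboloid, of w "w\<^sub>1 - w\<^sub>2"] unfolding vb vv w
    by (simp add: minkowski_diff_right a_def b_def s_def)
  hence "(a - b)\<^sup>2 * (2 * c - 2) \<le> (1 + s\<^sup>2) * (2 * c + 2) * (2 * c - 2)"
    using c by (intro mult_right_mono) auto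
  also have "\<dots> = ((2 * c - 2) + s\<^sup>2 * (2 * c - 2)) * (2 * c + 2)" by (simp add: algebra_simps)
  also have "\<dots> = ((2 * c - 2) + (a + b)\<^sup>2) * (2 * c + 2)" by (simp only: s2)
  finally show ?thesis unfolding a_def[symmetric] b_def[symmetric]
    by (simp add: power2_eq_square algebra_simps)
qed

text \<open>
  A hyperplane through the midpoint would be too close to the hyperplane of \<open>w\<^sub>1\<close>.
\<close>

lemma base_off_walls:
  assumes w: "w \<in> \<N>" shows "w \<bullet>\<^sub>M base \<noteq> 0"
proof
  assume 0: "w \<bullet>\<^sub>M base = 0"
  define a where "a = w \<bullet>\<^sub>M w\<^sub>1"
  have b: "w \<bullet>\<^sub>M w\<^sub>2 = - a" using 0 c by (simp add: minkowski_base a_def)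
  have "w\<^sub>1 \<noteq> w"
  proof
    assume "w\<^sub>1 = w"
    hence "a = 1" "- a = - c" using b w12 unit[OF w] by (auto simp: a_def)
    thus False using c by simp
  qed
  moreover have "w\<^sub>1 \<noteq> - w"
  proof
    assume "w\<^sub>1 = - w"
    hence "w = - w\<^sub>1" by simp
    hence "a = - 1" "- a = c" using b w12 unit[OF w12(1)] by (auto simp: a_def)
    thus False using c by simp
  qed
  ultimately have "c \<le> \<bar>a\<bar>" using gap[OF w w12(1)] by (simp add: a_def)
  hence "c\<^sup>2 \<le> a\<^sup>2" using c by (metis abs_le_square_iff abs_of_pos less_trans zero_less_one)
  moreover have "(c - 1) * (2 * a\<^sup>2) \<le> (c - 1) * (c + 1)"
    using gram_w12[OF unit[OF w]] by (simp add: b a_def[symmetric]) (simp add: power2_eq_square algebra_simps)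
  hence "2 * a\<^sup>2 \<le> c + 1" using c by simp
  moreover have "c + 1 < 2 * c\<^sup>2" using c_bound by (simp add: power2_eq_square)
  ultimately show False by simp
qed

text \<open>
  The half-spaces belonging to outward normals may be nested. Those behind the walls, which are the
  hyperplanes that touch the chamber, are pairwise disjoint.
\<close>


definition outward where "outward = {w \<in> \<N>. w \<bullet>\<^sub>M base < 0}"

definition chamber where "chamber = {p \<in> hyperboloid. \<forall>w\<in>outward. w \<bullet>\<^sub>M p \<le> 0}"

definition walls where "walls = {w \<in> outward. \<exists>p\<in>chamber. w \<bullet>\<^sub>M p = 0}"

definition \<Delta> where "\<Delta> = {A \<in> \<Gamma>. A ` outward = outward}"

lemma walls_outward: "w \<in> walls \<Longrightarrow> w \<in> outward"
  and outward_mem: "w \<in> outward \<Longrightarrow> w \<in> \<N>"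
  and outward_base: "w \<in> outward \<Longrightarrow> w \<bullet>\<^sub>M base < 0"
  and chamber_hyperboloid: "p \<in> chamber \<Longrightarrow> p \<in> hyperboloid"
  and chamber_outward: "p \<in> chamber \<Longrightarrow> w \<in> outward \<Longrightarrow> w \<bullet>\<^sub>M p \<le> 0"
  unfolding walls_def outward_def chamber_def by blast+

lemma walls_base: "w \<in> walls \<Longrightarrow> w \<bullet>\<^sub>M base \<le> 0"
  using outward_base[OF walls_outward] by (rule less_imp_le)

lemma walls_unit: "w \<in> walls \<Longrightarrow> w \<bullet>\<^sub>M w = 1"
  using unit outward_mem walls_outward by blast

lemma outwardI: "w \<in> \<N> \<Longrightarrow> \<not> w \<bullet>\<^sub>M base > 0 \<Longrightarrow> w \<in> outward"
  using base_off_walls[of w] by (auto simp: outward_def)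

text \<open>
  Each of two walls touches the chamber, so neither of the two half-spaces behind them can contain
  the other.
\<close>

lemma walls_disjoint:
  assumes w: "w \<in> walls" "w' \<in> walls" "w \<noteq> w'"
  shows "w \<bullet>\<^sub>M w' \<le> - c"
proof (rule ccontr)
  assume *: "\<not> ?thesis"
  have neg: "w \<bullet>\<^sub>M base < 0" "w' \<bullet>\<^sub>M base < 0" using w outward_base walls_outward by blast+
  have "w' \<noteq> - w" using neg by auto
  hence "c \<le> \<bar>w \<bullet>\<^sub>M w'\<bar>" using gap w walls_outward outward_mem by metis
  with * c have "w \<bullet>\<^sub>M w' > 1" by auto
  obtain p p' where p: "p \<in> chamber" "w \<bullet>\<^sub>M p = 0" and p': "p' \<in> chamber" "w' \<bullet>\<^sub>M p' = 0"
    using w by (auto simp: walls_def)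
  have "w' \<bullet>\<^sub>M p \<le> 0" "w \<bullet>\<^sub>M p' \<le> 0"
    using chamber_outward p p' w walls_outward by auto
  with nested_halfspaces[OF walls_unit[OF w(1)] walls_unit[OF w(2)] \<open>w \<bullet>\<^sub>M w' > 1\<close>] p p'
  show False using chamber_hyperboloid by fastforce
qed

lemma w12_outward: "w\<^sub>1 \<in> outward" "w\<^sub>2 \<in> outward"
  using c by (auto simp: outward_def w12 w21 unit minkowski_base divide_neg_pos)

text \<open>
  No hyperplane of the family separates the base point from the foot of the common perpendicular
  on \<open>w\<^sub>1\<close> or \<open>w\<^sub>2\<close>, because it would lie between these two hyperplanes and be closer to one of
  them than they are to each other.
\<close>

lemma between_walls:
  assumes w: "w \<in> outward" and u: "u = w\<^sub>1 \<and> u' = w\<^sub>2 \<or> u = w\<^sub>2 \<and> u' = w\<^sub>1"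
  shows "w \<bullet>\<^sub>M u' + c * (w \<bullet>\<^sub>M u) \<le> 0"
proof (rule ccontr)
  assume *: "\<not> ?thesis"
  define a b where "a = w \<bullet>\<^sub>M u" and "b = w \<bullet>\<^sub>M u'"
  have uu: "u \<in> \<N>" "u' \<in> \<N>" "u \<bullet>\<^sub>M u' = - c" "u' \<bullet>\<^sub>M u = - c" "u \<bullet>\<^sub>M base < 0" "u' \<bullet>\<^sub>M base < 0"
    using u w12 w21 outward_base[OF w12_outward(1)] outward_base[OF w12_outward(2)] by auto
  have "w \<bullet>\<^sub>M base < 0" by (rule outward_base[OF w])
  have sum: "a + b < 0"
    using \<open>w \<bullet>\<^sub>M base < 0\<close> u c by (auto simp: a_def b_def minkowski_base divide_less_0_iff)
  have pos: "b + c * a > 0" using * by (simp add: a_def b_def)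
  have cc: "c * c > 1" using c by (simp add: less_1_mult)
  have "u \<noteq> w" using pos uu(3,1) unit[of u] by (auto simp: a_def b_def)
  moreover have "u' \<noteq> w" using pos uu(2,4) unit[of u'] cc by (auto simp: a_def b_def)
  moreover have "u \<noteq> - w" "u' \<noteq> - w" using uu \<open>w \<bullet>\<^sub>M base < 0\<close> by auto
  ultimately have ab: "c \<le> \<bar>a\<bar>" "c \<le> \<bar>b\<bar>"
    using gap outward_mem[OF w] uu by (auto simp: a_def b_def)
  have ac: "a \<ge> c"
  proof (rule ccontr)
    assume "\<not> a \<ge> c"
    hence "a \<le> - c" using ab by linarith
    hence "c * (- a) \<ge> 1 * (- a)" using c by (intro mult_right_mono) auto
    with pos sum show False by simp
  qed
  \<comment> \<open>the Gram inequality is quadratic in \<open>b\<close> and fails at both ends of the possible range\<close>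
  have "0 \<le> (- b - a) * (c * a + b)" using sum pos by (intro mult_nonneg_nonneg) auto
  hence 1: "b * b \<le> - ((c + 1) * (a * b)) - c * (a * a)" by (simp add: algebra_simps)
  have "1 - c\<^sup>2 \<le> a\<^sup>2 + b\<^sup>2 + 2 * c * a * b"
    using gram_w12[OF unit[OF outward_mem[OF w]]] u by (auto simp: a_def b_def algebra_simps)
  also have "\<dots> \<le> (1 - c) * (a * (a - b))"
    using 1 by (simp add: power2_eq_square algebra_simps)
  finally have "(c - 1) * (a * (a - b)) \<le> (c - 1) * (c + 1)"
    by (simp add: power2_eq_square algebra_simps)
  hence "a * (a - b) \<le> c + 1" using c by simp
  moreover have "c * (2 * c) \<le> a * (a - b)" using ac sum c by (intro mult_mono) auto
  moreover have "c + 1 < c * (2 * c)" using c_bound by (simp add: algebra_simps)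
  ultimately show False by simp
qed

lemma w12_walls: "w\<^sub>1 \<in> walls" "w\<^sub>2 \<in> walls"
proof -
  have "u \<in> walls" if u: "u = w\<^sub>1 \<and> u' = w\<^sub>2 \<or> u = w\<^sub>2 \<and> u' = w\<^sub>1" for u u'
  proof -
    have uu: "u \<bullet>\<^sub>M u = 1" "u' \<bullet>\<^sub>M u' = 1" "u \<bullet>\<^sub>M u' = - c" "u' \<bullet>\<^sub>M u = - c" "u \<bullet>\<^sub>M base < 0" "u' \<bullet>\<^sub>M base < 0"
      "u \<in> outward"
      using u w12 w21 outward_base[OF w12_outward(1)] outward_base[OF w12_outward(2)]
        w12_outward unit[OF w12(1)] unit[OF w12(2)] by auto
    have cc: "c * c > 1" using c by (simp add: less_1_mult)
    \<comment> \<open>the direction of the foot of the common perpendicular on \<open>u\<close>\<close>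
    let ?z = "u' + c *\<^sub>R u"
    have zz: "?z \<bullet>\<^sub>M ?z = 1 - c\<^sup>2" by (simp add: minkowski_simps uu power2_eq_square)
    have neg: "?z \<bullet>\<^sub>M ?z < 0" using cc by (simp add: zz power2_eq_square)
    have "?z \<bullet>\<^sub>M (0, 1) < 0"
      using timelike_constant_sign[OF neg base_hyperboloid _ origin_in_hyperboloid] uu c
      by (simp add: minkowski_simps mult_nonneg_nonpos add_nonpos_nonpos)
    hence "snd ?z > 0" by simp
    define p where "p = (1 / sqrt (c\<^sup>2 - 1)) *\<^sub>R ?z"
    have p: "p \<in> hyperboloid" using hyperboloid_normalize[OF neg \<open>snd ?z > 0\<close>] by (simp add: p_def zz)
    have "w \<bullet>\<^sub>M p \<le> 0" if "w \<in> outward" for w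
      using between_walls[OF that u] cc
      by (simp add: p_def minkowski_simps divide_nonpos_nonneg power2_eq_square)
    hence "p \<in> chamber" using p by (simp add: chamber_def)
    moreover have "u \<bullet>\<^sub>M p = 0" by (simp add: p_def minkowski_simps uu)
    ultimately show ?thesis using uu(7) by (auto simp: walls_def)
  qed
  thus "w\<^sub>1 \<in> walls" "w\<^sub>2 \<in> walls" by blast+
qed

text \<open>
  A hyperplane that separates two points of a bounded set separates \<open>(0, 1)\<close> from one of them and
  is therefore close to \<open>(0, 1)\<close>.
\<close>

lemma finite_separating:
  "finite {w \<in> \<N>. \<exists>p\<in>hyperboloid. \<exists>q\<in>hyperboloid. snd p \<le> b \<and> snd q \<le> b \<and> w \<bullet>\<^sub>M p \<ge> 0 \<and> w \<bullet>\<^sub>M q \<le> 0}"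
proof (rule finite_subset[OF _ locally_finite[of b]], rule subsetI)
  fix w assume "w \<in> {w \<in> \<N>. \<exists>p\<in>hyperboloid. \<exists>q\<in>hyperboloid. snd p \<le> b \<and> snd q \<le> b \<and> w \<bullet>\<^sub>M p \<ge> 0 \<and> w \<bullet>\<^sub>M q \<le> 0}"
  then obtain p q where w: "w \<in> \<N>" and p: "p \<in> hyperboloid" "snd p \<le> b" "w \<bullet>\<^sub>M p \<ge> 0"
    and q: "q \<in> hyperboloid" "snd q \<le> b" "w \<bullet>\<^sub>M q \<le> 0" by blast
  have "1 + (snd w)\<^sup>2 \<le> b\<^sup>2"
  proof (cases "w \<bullet>\<^sub>M (0, 1) \<le> 0")
    case True
    have "1 + (snd w)\<^sup>2 \<le> (snd p)\<^sup>2"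
      using separating_hyperplane_bound[OF unit[OF w] p(1) origin_in_hyperboloid p(3) True] by simp
    also have "\<dots> \<le> b\<^sup>2" using p by (intro power_mono) (auto simp: hyperboloid_def)
    finally show ?thesis .
  next
    case False
    have "1 + (snd w)\<^sup>2 \<le> (snd q)\<^sup>2"
      using separating_hyperplane_bound[OF unit[OF uminus_mem[OF w]] q(1) origin_in_hyperboloid] q(3) False by simp
    also have "\<dots> \<le> b\<^sup>2" using q by (intro power_mono) (auto simp: hyperboloid_def)
    finally show ?thesis .
  qed
  hence "\<bar>snd w\<bar>\<^sup>2 \<le> b\<^sup>2" by simp
  moreover have "b \<ge> 0" using p by (auto simp: hyperboloid_def)
  ultimately have "\<bar>snd w\<bar> \<le> b" by (rule power2_le_imp_le)
  thus "w \<in> {w \<in> \<N>. \<bar>snd w\<bar> \<le> b}" using w by simp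
qed

text \<open>
  The chamber is cut out by its own walls: on the way from the base point to a point outside the
  chamber, the first hyperplane that is crossed is a wall.
\<close>

lemma chamber_iff_walls:
  assumes p: "p \<in> hyperboloid" and le: "\<And>w. w \<in> walls \<Longrightarrow> w \<bullet>\<^sub>M p \<le> 0"
  shows "p \<in> chamber"
proof (rule ccontr)
  assume np: "p \<notin> chamber"
  define F where "F = {w \<in> outward. w \<bullet>\<^sub>M p > 0}"
  obtain w\<^sub>0 where "w\<^sub>0 \<in> outward" "\<not> w\<^sub>0 \<bullet>\<^sub>M p \<le> 0" using np p unfolding chamber_def by blast
  hence "F \<noteq> {}" unfolding F_def by auto
  have "F \<subseteq> {w \<in> \<N>. \<exists>p'\<in>hyperboloid. \<exists>q\<in>hyperboloid.
      snd p' \<le> max (snd p) (snd base) \<and> snd q \<le> max (snd p) (snd base) \<and> w \<bullet>\<^sub>M p' \<ge> 0 \<and> w \<bullet>\<^sub>M q \<le> 0}"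
  proof
    fix w assume "w \<in> F"
    hence "w \<in> \<N>" "w \<bullet>\<^sub>M p > 0" "w \<bullet>\<^sub>M base < 0" by (auto simp: F_def outward_def)
    thus "w \<in> {w \<in> \<N>. \<exists>p'\<in>hyperboloid. \<exists>q\<in>hyperboloid.
      snd p' \<le> max (snd p) (snd base) \<and> snd q \<le> max (snd p) (snd base) \<and> w \<bullet>\<^sub>M p' \<ge> 0 \<and> w \<bullet>\<^sub>M q \<le> 0}"
      using p base_hyperboloid by (intro CollectI conjI bexI[of _ p] bexI[of _ base]) auto
  qed
  hence fin: "finite F" using finite_separating finite_subset by blast
  \<comment> \<open>the time at which the segment from the base point to \<open>p\<close> crosses the hyperplane of \<open>w\<close>\<close>
  define t where "t w = - (w \<bullet>\<^sub>M base) / (w \<bullet>\<^sub>M p - w \<bullet>\<^sub>M base)" for w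
  define s where "s = Min (t ` F)"
  have "s \<in> t ` F" unfolding s_def using fin \<open>F \<noteq> {}\<close> by (intro Min_in) simp_all
  then obtain w where w: "w \<in> F" "s = t w" by blast
  have min: "s \<le> t w'" if "w' \<in> F" for w' using that fin by (simp add: s_def)
  have wF: "w \<in> outward" "w \<bullet>\<^sub>M p > 0" "w \<bullet>\<^sub>M base < 0" using w by (auto simp: F_def outward_base)
  have s01: "0 < s" "s < 1" using wF by (auto simp: w(2) t_def field_simps)
  define z where "z = (1 - s) *\<^sub>R base + s *\<^sub>R p"
  have z: "z \<bullet>\<^sub>M z < 0" "snd z > 0"
    using timelike_convex[OF base_hyperboloid p, of "1 - s" s] s01 by (auto simp: z_def)
  have pair: "w' \<bullet>\<^sub>M z = w' \<bullet>\<^sub>M base + s * (w' \<bullet>\<^sub>M p - w' \<bullet>\<^sub>M base)" for w'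
    by (simp add: z_def minkowski_simps algebra_simps)
  have "w \<bullet>\<^sub>M z = 0" using wF by (simp add: pair w(2) t_def)
  have neg: "w' \<bullet>\<^sub>M z \<le> 0" if w': "w' \<in> outward" for w'
  proof (cases "w' \<in> F")
    case True
    hence d: "w' \<bullet>\<^sub>M p - w' \<bullet>\<^sub>M base > 0" using outward_base[OF w'] by (auto simp: F_def)
    hence "s * (w' \<bullet>\<^sub>M p - w' \<bullet>\<^sub>M base) \<le> t w' * (w' \<bullet>\<^sub>M p - w' \<bullet>\<^sub>M base)"
      using min[OF True] by (intro mult_right_mono) auto
    also have "\<dots> = - (w' \<bullet>\<^sub>M base)" using d by (simp add: t_def)
    finally show ?thesis by (simp add: pair)
  next
    case False
    hence "w' \<bullet>\<^sub>M p \<le> 0" using w' by (auto simp: F_def)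
    hence "(1 - s) * (w' \<bullet>\<^sub>M base) + s * (w' \<bullet>\<^sub>M p) \<le> 0"
      using s01 outward_base[OF w'] by (intro add_nonpos_nonpos mult_nonneg_nonpos) auto
    thus ?thesis by (simp add: pair algebra_simps)
  qed
  define q where "q = (1 / sqrt (- (z \<bullet>\<^sub>M z))) *\<^sub>R z"
  have "q \<in> hyperboloid" unfolding q_def by (rule hyperboloid_normalize[OF z])
  moreover have "w' \<bullet>\<^sub>M q \<le> 0" if "w' \<in> outward" for w'
    using neg[OF that] z by (simp add: q_def minkowski_simps divide_nonpos_nonneg)
  ultimately have "q \<in> chamber" by (simp add: chamber_def)
  moreover have "w \<bullet>\<^sub>M q = 0" using \<open>w \<bullet>\<^sub>M z = 0\<close> by (simp add: q_def minkowski_simps)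
  ultimately have "w \<in> walls" using wF by (auto simp: walls_def)
  from le[OF this] wF show False by simp
qed

subsection \<open>The stabilizer of the chamber\<close>

lemma \<Delta>_\<Gamma>: "A \<in> \<Delta> \<Longrightarrow> A \<in> \<Gamma>"
  and \<Delta>_outward: "A \<in> \<Delta> \<Longrightarrow> A ` outward = outward"
  by (auto simp: \<Delta>_def)

lemma \<Delta>_lorentz: "A \<in> \<Delta> \<Longrightarrow> A \<in> lorentz"
  using \<Delta>_\<Gamma> \<Gamma>_lorentz by blast

lemma \<Delta>_id: "id \<in> \<Delta>"
  by (simp add: \<Delta>_def id_mem)

lemma \<Delta>_comp: "A \<in> \<Delta> \<Longrightarrow> B \<in> \<Delta> \<Longrightarrow> A \<circ> B \<in> \<Delta>"
  unfolding \<Delta>_def by (simp add: comp_mem image_comp[of A B outward, symmetric] del: o_apply)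

lemma \<Delta>_inverse:
  assumes "A \<in> \<Delta>" shows "\<exists>B\<in>\<Delta>. B \<circ> A = id \<and> A \<circ> B = id"
proof -
  obtain B where B: "B \<in> \<Gamma>" "B \<circ> A = id" "A \<circ> B = id" using inverse_mem[OF \<Delta>_\<Gamma>[OF assms]] by blast
  have "B ` (A ` outward) = outward" using B by (simp add: image_comp)
  thus ?thesis using B \<Delta>_outward[OF assms] by (auto simp: \<Delta>_def)
qed

lemma \<Delta>_chamber:
  assumes A: "A \<in> \<Delta>" and p: "p \<in> chamber" shows "A p \<in> chamber"
proof -
  have "w \<bullet>\<^sub>M A p \<le> 0" if "w \<in> outward" for w
  proof -
    obtain w' where "w' \<in> outward" "w = A w'" using \<Delta>_outward[OF A] \<open>w \<in> outward\<close> by blast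
    thus ?thesis using chamber_outward[OF p] lorentz_minkowski[OF \<Delta>_lorentz[OF A]] by simp
  qed
  thus ?thesis
    using lorentz_hyperboloid[OF \<Delta>_lorentz[OF A]] p by (auto simp: chamber_def)
qed

lemma \<Delta>_walls:
  assumes A: "A \<in> \<Delta>" and w: "w \<in> walls" shows "A w \<in> walls"
proof -
  obtain p where p: "p \<in> chamber" "w \<bullet>\<^sub>M p = 0" using w by (auto simp: walls_def)
  have "A w \<bullet>\<^sub>M A p = 0" using p lorentz_minkowski[OF \<Delta>_lorentz[OF A]] by simp
  moreover have "A w \<in> outward" using \<Delta>_outward[OF A] walls_outward[OF w] by blast
  ultimately show ?thesis using \<Delta>_chamber[OF A p(1)] by (auto simp: walls_def)
qed

text \<open>
  Two translates of the chamber that meet a bounded set coincide as soon as they lie on the same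
  side of the finitely many hyperplanes that cut this set. Hence only finitely many translates
  meet it, and the stabilizer inherits coboundedness from \<open>\<Gamma>\<close>.
\<close>

lemma \<Delta>_cobounded: "\<exists>R'. \<forall>p\<in>chamber. \<exists>A\<in>\<Delta>. snd (A p) \<le> R'"
proof -
  define S where "S = {w \<in> \<N>. \<exists>p\<in>hyperboloid. \<exists>q\<in>hyperboloid. snd p \<le> R \<and> snd q \<le> R \<and> w \<bullet>\<^sub>M p \<ge> 0 \<and> w \<bullet>\<^sub>M q \<le> 0}"
  have finS: "finite S" unfolding S_def by (rule finite_separating)
  \<comment> \<open>the sides on which a translate of the chamber lies; \<open>\<rho>\<close> chooses one translate for each pattern\<close>
  define \<sigma> where "\<sigma> A = {w \<in> S. w \<bullet>\<^sub>M A base < 0}" for A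
  define G where "G = {A \<in> \<Gamma>. \<exists>p\<in>chamber. snd (A p) \<le> R}"
  have "\<exists>\<rho>. \<forall>s\<in>\<sigma> ` G. \<rho> s \<in> G \<and> \<sigma> (\<rho> s) = s" by (rule bchoice) blast
  then obtain \<rho> where \<rho>: "\<And>s. s \<in> \<sigma> ` G \<Longrightarrow> \<rho> s \<in> G \<and> \<sigma> (\<rho> s) = s" by blast
  have key: "B' (A w) \<in> outward"
    if A: "A \<in> G" and B: "B \<in> G" and eq: "\<sigma> A = \<sigma> B" and B': "B' \<in> \<Gamma>" "B \<circ> B' = id" and w: "w \<in> outward" for A B B' w
  proof -
    have Gam: "A \<in> \<Gamma>" "B \<in> \<Gamma>" using A B by (auto simp: G_def)
    have BB: "B (B' x) = x" for x using B'(2) by (simp add: pointfree_idE)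
    have pairB: "x \<bullet>\<^sub>M B y = B' x \<bullet>\<^sub>M y" for x y
      using lorentz_minkowski[OF \<Gamma>_lorentz[OF Gam(2)], of "B' x" y] by (simp add: BB)
    have pairA: "A x \<bullet>\<^sub>M A y = x \<bullet>\<^sub>M y" for x y by (rule lorentz_minkowski[OF \<Gamma>_lorentz[OF Gam(1)]])
    have AN: "A w \<in> \<N>" "B' (A w) \<in> \<N>" using invariant w outward_mem Gam B' by auto
    show ?thesis
    proof (rule ccontr)
      assume "B' (A w) \<notin> outward"
      hence pos: "B' (A w) \<bullet>\<^sub>M base > 0" using outwardI[OF AN(2)] by blast
      hence neg: "- B' (A w) \<in> outward" using uminus_mem[OF AN(2)] by (auto simp: outward_def)
      obtain p where p: "p \<in> chamber" "snd (A p) \<le> R" using A by (auto simp: G_def)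
      obtain q where q: "q \<in> chamber" "snd (B q) \<le> R" using B by (auto simp: G_def)
      have "A w \<bullet>\<^sub>M A p \<le> 0" using chamber_outward[OF p(1) w] by (simp add: pairA)
      moreover have "A w \<bullet>\<^sub>M B q \<ge> 0" using chamber_outward[OF q(1) neg] by (simp add: pairB)
      ultimately have "A w \<in> S"
        unfolding S_def using AN p q lorentz_hyperboloid[OF \<Gamma>_lorentz[OF Gam(1)]]
          lorentz_hyperboloid[OF \<Gamma>_lorentz[OF Gam(2)]] chamber_hyperboloid
        by (intro CollectI conjI bexI[of _ "B q"] bexI[of _ "A p"]) auto
      moreover have "A w \<bullet>\<^sub>M A base < 0" using outward_base[OF w] by (simp add: pairA)
      ultimately have "A w \<in> \<sigma> A" by (simp add: \<sigma>_def)
      hence "A w \<bullet>\<^sub>M B base < 0" unfolding eq by (simp add: \<sigma>_def)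
      with pos show False by (simp add: pairB)
    qed
  qed
  define bound where "bound B = (norm (fst (B (0, 1))) + \<bar>snd (B (0, 1))\<bar>) * R" for B :: "'n::finite spacetime \<Rightarrow> 'n spacetime"
  define T where "T = \<rho> ` \<sigma> ` G"
  have "\<sigma> ` G \<subseteq> Pow S" by (auto simp: \<sigma>_def)
  hence finT: "finite T" unfolding T_def using finS finite_subset by blast
  have "\<exists>A\<in>\<Delta>. snd (A p) \<le> Max (bound ` T)" if p: "p \<in> chamber" for p
  proof -
    obtain A where A: "A \<in> \<Gamma>" "snd (A p) \<le> R" using cobounded[OF chamber_hyperboloid[OF p]] by blast
    hence AG: "A \<in> G" using p by (auto simp: G_def)
    define B where "B = \<rho> (\<sigma> A)"
    have BG: "B \<in> G" "\<sigma> B = \<sigma> A" using \<rho> AG by (auto simp: B_def)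
    have BT: "B \<in> T" using AG by (auto simp: B_def T_def)
    obtain A' where A': "A' \<in> \<Gamma>" "A' \<circ> A = id" "A \<circ> A' = id" using inverse_mem[OF A(1)] by blast
    have "B \<in> \<Gamma>" using BG by (auto simp: G_def)
    then obtain B' where B': "B' \<in> \<Gamma>" "B' \<circ> B = id" "B \<circ> B' = id" using inverse_mem by blast
    have 1: "B' (A w) \<in> outward" if "w \<in> outward" for w
      by (rule key[OF AG BG(1) BG(2)[symmetric] B'(1,3) that])
    have 2: "A' (B w) \<in> outward" if "w \<in> outward" for w
      by (rule key[OF BG(1) AG BG(2) A'(1,3) that])
    have "(B' \<circ> A) ` outward = outward"
    proof (intro equalityI subsetI)
      fix w assume w: "w \<in> outward"
      have "w = B' (A (A' (B w)))" using A'(3) B'(2) by (simp add: pointfree_idE)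
      thus "w \<in> (B' \<circ> A) ` outward" using 2[OF w] by auto
    qed (use 1 in auto)
    hence "B' \<circ> A \<in> \<Delta>" using B'(1) A(1) comp_mem by (auto simp: \<Delta>_def)
    moreover have "snd ((B' \<circ> A) p) \<le> bound B"
    proof -
      have "snd ((B' \<circ> A) p) = - (B' (A p) \<bullet>\<^sub>M (0, 1))" by simp
      also have "\<dots> = - (B (B' (A p)) \<bullet>\<^sub>M B (0, 1))"
        using lorentz_minkowski[OF \<Gamma>_lorentz[OF \<open>B \<in> \<Gamma>\<close>]] by metis
      also have "B (B' (A p)) = A p" using B'(3) by (simp add: pointfree_idE)
      also have "- (A p \<bullet>\<^sub>M B (0, 1)) \<le> \<bar>B (0, 1) \<bullet>\<^sub>M A p\<bar>" by (subst minkowski_commute) simp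
      also have "\<dots> \<le> bound B" unfolding bound_def
        using minkowski_le_time[OF lorentz_hyperboloid[OF \<Gamma>_lorentz[OF A(1)] chamber_hyperboloid[OF p]] A(2)] .
      finally show ?thesis .
    qed
    moreover have "bound B \<le> Max (bound ` T)" using BT finT by simp
    ultimately show ?thesis by force
  qed
  thus ?thesis by blast
qed

subsection \<open>The reflection group of the chamber\<close>

lemma refl_word_lorentz: "ws \<in> lists walls \<Longrightarrow> refl_word ws \<in> lorentz"
  by (induction ws) (auto simp: lorentz_id reflection_lorentz walls_unit intro!: lorentz_comp)

lemma refl_word_rev: "ws \<in> lists walls \<Longrightarrow> refl_word (rev ws) \<circ> refl_word ws = id"
proof (induction ws)
  case (Cons w ws)
  hence w: "w \<bullet>\<^sub>M w = 1" and ws: "ws \<in> lists walls" by (simp_all add: walls_unit)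
  have "refl_word (rev ws) (refl_word ws x) = x" for x by (rule pointfree_idE[OF Cons.IH[OF ws]])
  thus ?case by (intro ext) (simp add: refl_word_append reflection_involution[OF w])
qed simp

lemma \<Delta>_refl_word:
  assumes A: "A \<in> \<Delta>" shows "A \<circ> refl_word ws = refl_word (map A ws) \<circ> A"
  by (induction ws) (auto simp: fun_eq_iff lorentz_conj_reflection[OF \<Delta>_lorentz[OF A]])

lemma walls_sum:
  assumes "w \<in> walls" "w' \<in> walls" "w \<noteq> w'" "z \<in> hyperboloid"
  shows "w \<bullet>\<^sub>M z + w' \<bullet>\<^sub>M z \<le> - sqrt (2 * c - 2)"
  by (rule disjoint_halfspaces_sum[OF walls_unit walls_unit walls_disjoint c base_hyperboloid])
    (use assms in \<open>simp_all add: walls_base\<close>)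

text \<open>
  Every point can be reflected into the chamber, since the depth behind the walls decreases: if
  \<open>w \<bullet>\<^sub>M p = s > 0\<close> for a wall \<open>w\<close>, then the reflection in \<open>w\<close> takes \<open>p\<close> to a point \<open>q\<close> such that
  \<open>w' \<bullet>\<^sub>M q \<le> s - sqrt (2 * c - 2)\<close> for all other walls \<open>w'\<close>.
\<close>

lemma reflect_into_chamber_bounded:
  assumes "p \<in> hyperboloid" "\<And>w. w \<in> walls \<Longrightarrow> w \<bullet>\<^sub>M p \<le> s" "s \<le> real n * sqrt (2 * c - 2)"
  shows "\<exists>ws\<in>lists walls. refl_word ws p \<in> chamber"
  using assms
proof (induction n arbitrary: p s)
  case 0
  hence "p \<in> chamber" by (intro chamber_iff_walls) force+
  thus ?case by (intro bexI[of _ "[]"]) auto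
next
  case (Suc n)
  show ?case
  proof (cases "p \<in> chamber")
    case True
    thus ?thesis by (intro bexI[of _ "[]"]) auto
  next
    case False
    then obtain w where w: "w \<in> walls" "w \<bullet>\<^sub>M p > 0"
      using chamber_iff_walls[OF Suc.prems(1)] by force
    define q where "q = reflection w p"
    have q: "q \<in> hyperboloid"
      unfolding q_def by (rule lorentz_hyperboloid[OF reflection_lorentz[OF walls_unit[OF w(1)]] Suc.prems(1)])
    have wq: "w \<bullet>\<^sub>M q = - (w \<bullet>\<^sub>M p)" by (simp add: q_def reflection_normal walls_unit w)
    have "w' \<bullet>\<^sub>M q \<le> max 0 (s - sqrt (2 * c - 2))" if w': "w' \<in> walls" for w'
    proof (cases "w' = w")
      case False
      thus ?thesis using walls_sum[OF w(1) w' _ q] wq Suc.prems(2)[OF w(1)] by auto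
    qed (use wq w in auto)
    moreover have "max 0 (s - sqrt (2 * c - 2)) \<le> real n * sqrt (2 * c - 2)"
      using Suc.prems(3) c by (auto simp: algebra_simps)
    ultimately obtain ws where "ws \<in> lists walls" "refl_word ws q \<in> chamber"
      using Suc.IH[OF q] by blast
    thus ?thesis using w by (intro bexI[of _ "ws @ [w]"]) (auto simp: refl_word_append q_def)
  qed
qed

lemma reflect_into_chamber:
  assumes p: "p \<in> hyperboloid"
  obtains ws where "ws \<in> lists walls" "refl_word ws p \<in> chamber"
proof (cases "p \<in> chamber")
  case True
  thus thesis using that[of "[]"] by simp
next
  case False
  then obtain w where w: "w \<in> walls" "w \<bullet>\<^sub>M p > 0" using chamber_iff_walls[OF p] by force
  have r: "sqrt (2 * c - 2) > 0" using c by simp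
  obtain n where n: "w \<bullet>\<^sub>M p \<le> real n * sqrt (2 * c - 2)"
    using reals_Archimedean3[OF r] by (metis less_imp_le)
  have "w' \<bullet>\<^sub>M p \<le> w \<bullet>\<^sub>M p" if "w' \<in> walls" for w'
  proof (cases "w' = w")
    case False
    hence "w \<bullet>\<^sub>M p + w' \<bullet>\<^sub>M p \<le> - sqrt (2 * c - 2)" using walls_sum[OF w(1) that _ p] by simp
    thus ?thesis using w(2) r by linarith
  qed simp
  thus thesis using reflect_into_chamber_bounded[OF p _ n] that by blast
qed

text \<open>
  Deleting two equal adjacent letters preserves the parity of the length, which is why the words of
  even length below are well behaved although words are not unique.
\<close>

lemma refl_word_reduced:
  assumes "ws \<in> lists walls"
  shows "\<exists>vs\<in>lists walls. distinct_adj vs \<and> refl_word vs = refl_word ws \<and> even (length vs + length ws)"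
  using assms
proof (induction ws)
  case (Cons w ws)
  then obtain vs where vs: "vs \<in> lists walls" "distinct_adj vs" "refl_word vs = refl_word ws"
    "even (length vs + length ws)" by auto
  have w: "w \<in> walls" using Cons by simp
  show ?case
  proof (cases "vs \<noteq> [] \<and> hd vs = w")
    case True
    then obtain us where us: "vs = w # us" by (cases vs) auto
    have "reflection w \<circ> (reflection w \<circ> refl_word us) = refl_word us"
      using walls_unit[OF w] by (auto simp: fun_eq_iff reflection_involution)
    hence "refl_word us = refl_word (w # ws)" using vs(3) by (simp add: us[symmetric]) (simp add: us flip: vs(3))
    thus ?thesis using vs us by (intro bexI[of _ us]) (auto dest: distinct_adj_ConsD)
  next
    case False
    thus ?thesis using vs w by (intro bexI[of _ "w # vs"]) (auto simp: distinct_adj_Cons)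
  qed
qed (rule bexI[of _ "[]"], simp_all)

text \<open>Ping-pong: a reduced word moves the chamber behind the wall of its first letter.\<close>

lemma refl_word_behind:
  assumes "ws \<in> lists walls" "distinct_adj ws" "y \<in> chamber"
  shows "refl_word ws y \<in> hyperboloid" "w \<in> walls \<Longrightarrow> (ws = [] \<or> hd ws \<noteq> w) \<Longrightarrow> w \<bullet>\<^sub>M refl_word ws y \<le> 0"
    "ws \<noteq> [] \<Longrightarrow> hd ws \<bullet>\<^sub>M refl_word ws y \<ge> 0"
proof -
  have hyp: "refl_word us y \<in> hyperboloid" if "us \<in> lists walls" for us
    by (rule lorentz_hyperboloid[OF refl_word_lorentz[OF that] chamber_hyperboloid[OF assms(3)]])
  show "refl_word ws y \<in> hyperboloid" by (rule hyp[OF assms(1)])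
  from assms show behind: "ws \<noteq> [] \<Longrightarrow> hd ws \<bullet>\<^sub>M refl_word ws y \<ge> 0"
  proof (induction ws rule: list.induct)
    case (Cons w ws)
    have w: "w \<in> walls" using Cons.prems by simp
    have "w \<bullet>\<^sub>M refl_word ws y \<le> 0"
    proof (cases "ws = []")
      case True
      thus ?thesis using chamber_outward[OF assms(3) walls_outward[OF w]] by simp
    next
      case False
      hence "hd ws \<in> walls" "hd ws \<noteq> w" "hd ws \<bullet>\<^sub>M refl_word ws y \<ge> 0"
        using Cons by (auto simp: distinct_adj_Cons)
      thus ?thesis using walls_sum[OF w, of "hd ws" "refl_word ws y"] hyp[of ws] Cons.prems c
        by (smt (verit) listsE real_sqrt_ge_zero list.inject)
    qed
    thus ?case by (simp add: reflection_normal walls_unit w)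
  qed simp
  assume w: "w \<in> walls" "ws = [] \<or> hd ws \<noteq> w"
  show "w \<bullet>\<^sub>M refl_word ws y \<le> 0"
  proof (cases "ws = []")
    case True
    thus ?thesis using chamber_outward[OF assms(3) walls_outward[OF w(1)]] by simp
  next
    case False
    hence "hd ws \<in> walls" using assms(1) by (cases ws) auto
    thus ?thesis using walls_sum[OF w(1), of "hd ws" "refl_word ws y"] hyp[OF assms(1)] w False behind c
      by (smt (verit) real_sqrt_ge_zero)
  qed
qed

text \<open>Folding space onto the chamber does not increase distances.\<close>

lemma refl_word_fold:
  assumes "ws \<in> lists walls" "distinct_adj ws" and x: "x \<in> chamber" and y: "y \<in> chamber"
  shows "x \<bullet>\<^sub>M refl_word ws y \<le> x \<bullet>\<^sub>M y"
  using assms(1,2)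
proof (induction ws rule: list.induct)
  case (Cons w ws)
  have ws: "ws \<in> lists walls" "distinct_adj ws" "w \<in> walls"
    using Cons.prems distinct_adj_ConsD[OF Cons.prems(2)] by simp_all
  have "w \<bullet>\<^sub>M x \<le> 0" using chamber_outward[OF x walls_outward[OF ws(3)]] .
  moreover have "w \<bullet>\<^sub>M refl_word ws y \<le> 0"
    by (rule refl_word_behind(2)[OF ws(1,2) y ws(3)]) (use Cons.prems in \<open>auto simp: distinct_adj_Cons\<close>)
  ultimately have "(w \<bullet>\<^sub>M x) * (w \<bullet>\<^sub>M refl_word ws y) \<ge> 0" by (simp add: mult_nonpos_nonpos)
  thus ?case using Cons.IH ws by (simp add: minkowski_reflection)
qed simp

text \<open>
  The product of two reflections translates along the common perpendicular of their mirrors by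
  twice the distance of the mirrors, and other points are moved farther.
\<close>

lemma two_reflections:
  assumes w: "a \<in> walls" "b \<in> walls" "a \<noteq> b" and x: "x \<in> chamber"
  shows "x \<bullet>\<^sub>M reflection a (reflection b x) \<le> - (2 * c\<^sup>2 - 1)"
proof -
  define s t k where "s = a \<bullet>\<^sub>M x" and "t = b \<bullet>\<^sub>M x" and "k = - (a \<bullet>\<^sub>M b)"
  have k: "k \<ge> c" using walls_disjoint[OF w] by (simp add: k_def)
  have k2: "k\<^sup>2 \<ge> c\<^sup>2" using k c by (intro power_mono) auto
  have xx: "x \<bullet>\<^sub>M x = -1" using hyperboloid_self[OF chamber_hyperboloid[OF x]] .
  have "(s * t - k)\<^sup>2 \<le> (1 + s\<^sup>2) * (1 + t\<^sup>2)"
    using projected_Cauchy_Schwarz[OF chamber_hyperboloid[OF x], of a b]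
    by (simp add: walls_unit w s_def t_def k_def add.commute)
  hence "k\<^sup>2 - 1 \<le> s\<^sup>2 + t\<^sup>2 + 2 * (s * t) * k" by (simp add: power2_eq_square algebra_simps)
  moreover have "x \<bullet>\<^sub>M reflection a (reflection b x) = - (1 + 2 * (s\<^sup>2 + t\<^sup>2 + 2 * (s * t) * k))"
  proof -
    have ba: "b \<bullet>\<^sub>M a = - k" by (simp add: k_def minkowski_commute[of b a])
    show ?thesis
      unfolding minkowski_reflection xx ba s_def[symmetric] t_def[symmetric]
      by (simp add: power2_eq_square algebra_simps)
  qed
  ultimately show ?thesis using k2 by simp
qed

text \<open>
  A reduced word of length at least three carries the chamber across three disjoint hyperplanes
  in succession, any two neighbours of which are at distance at least \<open>arcosh c\<close>.
\<close>

lemma many_reflections: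
  assumes ws: "a # b # e # ws \<in> lists walls" "distinct_adj (a # b # e # ws)" and x: "x \<in> chamber"
  shows "x \<bullet>\<^sub>M refl_word (a # b # e # ws) x \<le> - (2 * c\<^sup>2 - 1)"
proof -
  define v u z where "v = refl_word (e # ws) x" and "u = refl_word (b # e # ws) x"
    and "z = refl_word (a # b # e # ws) x"
  have w: "a \<in> walls" "b \<in> walls" "e \<in> walls" and ne: "a \<noteq> b" "b \<noteq> e" using ws by auto
  have hyp: "v \<in> hyperboloid" "u \<in> hyperboloid" "z \<in> hyperboloid"
    unfolding v_def u_def z_def by (rule refl_word_behind(1); use ws x in auto)+
  have ev: "e \<bullet>\<^sub>M v \<ge> 0" unfolding v_def
    using refl_word_behind(3)[of "e # ws" x] ws x by auto
  have base: "a \<bullet>\<^sub>M base \<le> 0" "b \<bullet>\<^sub>M base \<le> 0" "e \<bullet>\<^sub>M base \<le> 0"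
    using w walls_base by simp_all
  have c2: "c\<^sup>2 > 1" using c by (simp add: one_less_power)
  have "b \<bullet>\<^sub>M v \<le> - (c * (e \<bullet>\<^sub>M v) + sqrt ((c\<^sup>2 - 1) * (1 + (e \<bullet>\<^sub>M v)\<^sup>2)))"
    by (rule disjoint_halfspaces_depth[OF _ _ walls_disjoint c base_hyperboloid])
      (use w ne base hyp ev walls_unit in auto)
  also have "\<dots> \<le> - sqrt (c\<^sup>2 - 1)"
  proof -
    have "(c\<^sup>2 - 1) * 1 \<le> (c\<^sup>2 - 1) * (1 + (e \<bullet>\<^sub>M v)\<^sup>2)"
      using c2 by (intro mult_left_mono) auto
    hence "sqrt (c\<^sup>2 - 1) \<le> sqrt ((c\<^sup>2 - 1) * (1 + (e \<bullet>\<^sub>M v)\<^sup>2))" by (intro real_sqrt_le_mono) simp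
    moreover have "c * (e \<bullet>\<^sub>M v) \<ge> 0" using c ev by simp
    ultimately show ?thesis by linarith
  qed
  finally have bv: "b \<bullet>\<^sub>M v \<le> - sqrt (c\<^sup>2 - 1)" .
  have bu: "b \<bullet>\<^sub>M u = - (b \<bullet>\<^sub>M v)" by (simp add: u_def v_def reflection_normal walls_unit w)
  have "0 \<le> sqrt (c\<^sup>2 - 1)" using c2 by simp
  hence bu0: "b \<bullet>\<^sub>M u \<ge> 0" using bu bv by linarith
  have sq: "(b \<bullet>\<^sub>M u)\<^sup>2 \<ge> c\<^sup>2 - 1"
    using power_mono[of "sqrt (c\<^sup>2 - 1)" "b \<bullet>\<^sub>M u" 2] bv bu c2 by simp
  have "a \<bullet>\<^sub>M u \<le> - (c * (b \<bullet>\<^sub>M u) + sqrt ((c\<^sup>2 - 1) * (1 + (b \<bullet>\<^sub>M u)\<^sup>2)))"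
    by (rule disjoint_halfspaces_depth[OF _ _ walls_disjoint c base_hyperboloid])
      (use w ne base hyp bu0 walls_unit in auto)
  also have "\<dots> \<le> - (c * sqrt (c\<^sup>2 - 1) + c * sqrt (c\<^sup>2 - 1))"
  proof -
    have "sqrt ((c\<^sup>2 - 1) * c\<^sup>2) \<le> sqrt ((c\<^sup>2 - 1) * (1 + (b \<bullet>\<^sub>M u)\<^sup>2))"
      using c2 sq by (intro real_sqrt_le_mono mult_left_mono) auto
    moreover have "sqrt ((c\<^sup>2 - 1) * c\<^sup>2) = c * sqrt (c\<^sup>2 - 1)" using c by (simp add: real_sqrt_mult)
    moreover have "c * sqrt (c\<^sup>2 - 1) \<le> c * (b \<bullet>\<^sub>M u)" using bv bu c by (intro mult_left_mono) auto
    ultimately show ?thesis by simp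
  qed
  finally have az: "a \<bullet>\<^sub>M z \<ge> 2 * c * sqrt (c\<^sup>2 - 1)"
    by (simp add: z_def u_def reflection_normal walls_unit w)
  have pos: "2 * c * sqrt (c\<^sup>2 - 1) \<ge> 0" using c c2 by simp
  have "1 + (- a \<bullet>\<^sub>M z)\<^sup>2 \<le> (x \<bullet>\<^sub>M z)\<^sup>2"
    by (rule separating_hyperplane_bound)
      (use az pos walls_unit w hyp x chamber_hyperboloid chamber_outward[OF x] walls_outward in auto)
  moreover have "(2 * c * sqrt (c\<^sup>2 - 1))\<^sup>2 \<le> (a \<bullet>\<^sub>M z)\<^sup>2" using az pos by (intro power_mono)
  moreover have "1 + (2 * c * sqrt (c\<^sup>2 - 1))\<^sup>2 = (2 * c\<^sup>2 - 1)\<^sup>2"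
    using c2 by (simp add: power_mult_distrib) (simp add: power2_eq_square algebra_simps)
  ultimately have "(2 * c\<^sup>2 - 1)\<^sup>2 \<le> (- (x \<bullet>\<^sub>M z))\<^sup>2" by simp
  hence "2 * c\<^sup>2 - 1 \<le> - (x \<bullet>\<^sub>M z)"
    by (rule power2_le_imp_le) (use hyperboloid_minkowski_le[OF chamber_hyperboloid[OF x] hyp(3)] in auto)
  thus ?thesis by (simp add: z_def)
qed

text \<open>
  The group of the double. The group generated by the reflections in the walls and by the stabilizer
  of the chamber contains it with index two. The reflections, which have odd length, are left out.
\<close>

definition \<Lambda> where
  "\<Lambda> = {refl_word ws \<circ> A |ws A. ws \<in> lists walls \<and> even (length ws) \<and> A \<in> \<Delta>}"

lemma \<Lambda>I: "ws \<in> lists walls \<Longrightarrow> even (length ws) \<Longrightarrow> A \<in> \<Delta> \<Longrightarrow> refl_word ws \<circ> A \<in> \<Lambda>"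
  by (auto simp: \<Lambda>_def)

lemma \<Delta>_lists: "A \<in> \<Delta> \<Longrightarrow> ws \<in> lists walls \<Longrightarrow> map A ws \<in> lists walls"
  using \<Delta>_walls by auto

lemma \<Lambda>_lorentz: "\<Lambda> \<subseteq> lorentz"
  using lorentz_comp[OF refl_word_lorentz \<Delta>_lorentz] by (auto simp: \<Lambda>_def)

lemma \<Lambda>_id: "id \<in> \<Lambda>"
  using \<Lambda>I[of "[]", OF _ _ \<Delta>_id] by simp

lemma \<Lambda>_comp:
  assumes "S \<in> \<Lambda>" "T \<in> \<Lambda>" shows "S \<circ> T \<in> \<Lambda>"
proof -
  obtain us A where S: "S = refl_word us \<circ> A" "us \<in> lists walls" "even (length us)" "A \<in> \<Delta>"
    using assms(1) by (auto simp: \<Lambda>_def)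
  obtain vs B where T: "T = refl_word vs \<circ> B" "vs \<in> lists walls" "even (length vs)" "B \<in> \<Delta>"
    using assms(2) by (auto simp: \<Lambda>_def)
  have "S \<circ> T = refl_word us \<circ> (A \<circ> refl_word vs) \<circ> B" by (simp add: S T comp_assoc)
  also have "\<dots> = refl_word (us @ map A vs) \<circ> (A \<circ> B)"
    unfolding \<Delta>_refl_word[OF S(4)] by (simp add: refl_word_append comp_assoc)
  also have "\<dots> \<in> \<Lambda>"
    using S T \<Delta>_lists[OF S(4) T(2)] by (intro \<Lambda>I \<Delta>_comp) auto
  finally show ?thesis .
qed

lemma \<Lambda>_inverse:
  assumes "S \<in> \<Lambda>" shows "\<exists>T\<in>\<Lambda>. T \<circ> S = id \<and> S \<circ> T = id"
proof -
  obtain us A where S: "S = refl_word us \<circ> A" "us \<in> lists walls" "even (length us)" "A \<in> \<Delta>"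
    using assms(1) by (auto simp: \<Lambda>_def)
  obtain B where B: "B \<in> \<Delta>" "B \<circ> A = id" "A \<circ> B = id" using \<Delta>_inverse[OF S(4)] by blast
  define T where "T = refl_word (map B (rev us)) \<circ> B"
  have T: "T = B \<circ> refl_word (rev us)" by (simp add: T_def \<Delta>_refl_word[OF B(1)])
  have rev: "rev us \<in> lists walls" using S by auto
  have "T \<in> \<Lambda>" unfolding T_def by (intro \<Lambda>I \<Delta>_lists[OF B(1) rev] B(1)) (use S in auto)
  moreover have "T \<circ> S = B \<circ> (refl_word (rev us) \<circ> refl_word us) \<circ> A" by (simp add: T S comp_assoc)
  hence "T \<circ> S = id" using refl_word_rev[OF S(2)] B by simp
  moreover have "S \<circ> T = refl_word us \<circ> (A \<circ> B) \<circ> refl_word (rev us)" by (simp add: T S comp_assoc)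
  hence "S \<circ> T = id" using refl_word_rev[OF rev] B by simp
  ultimately show ?thesis by blast
qed

text \<open>
  Folding leaves only the displacement of the stabilizer component. If that component is trivial,
  the element is a word of even length in the reflections, and its reduced form is empty, has two
  letters, or has at least three.
\<close>

lemma \<Lambda>_displacement_chamber:
  assumes T: "T \<in> \<Lambda>" "T \<noteq> id" and x: "x \<in> chamber"
  shows "x \<bullet>\<^sub>M T x \<le> - (2 * c\<^sup>2 - 1)"
proof -
  obtain us A where us: "T = refl_word us \<circ> A" "us \<in> lists walls" "even (length us)" and A: "A \<in> \<Delta>"
    using T by (auto simp: \<Lambda>_def)
  obtain vs where vs: "vs \<in> lists walls" "distinct_adj vs" "refl_word vs = refl_word us" "even (length vs)"
    using refl_word_reduced[OF us(2)] us(3) by auto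
  show ?thesis
  proof (cases "A = id")
    case False
    have "x \<bullet>\<^sub>M refl_word vs (A x) \<le> x \<bullet>\<^sub>M A x"
      by (rule refl_word_fold[OF vs(1,2) x \<Delta>_chamber[OF A x]])
    also have "\<dots> \<le> - (2 * c\<^sup>2 - 1)" by (rule disp[OF \<Delta>_\<Gamma>[OF A] False chamber_hyperboloid[OF x]])
    finally show ?thesis using us vs by simp
  next
    case True
    hence T': "T = refl_word vs" using us vs by simp
    show ?thesis
    proof (cases vs)
      case Nil
      thus ?thesis using T T' by simp
    next
      case (Cons a vs')
      then obtain b vs'' where 1: "vs = a # b # vs''" using vs(4) by (cases vs') auto
      show ?thesis
      proof (cases vs'')
        case Nil
        thus ?thesis using two_reflections[of a b x] vs(1,2) x by (simp add: T' 1)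
      next
        case (Cons e ws)
        thus ?thesis using many_reflections[of a b e ws x] vs(1,2) x by (simp add: T' 1)
      qed
    qed
  qed
qed

lemma \<Lambda>_displacement:
  assumes T: "T \<in> \<Lambda>" "T \<noteq> id" and p: "p \<in> hyperboloid"
  shows "p \<bullet>\<^sub>M T p \<le> - (2 * c\<^sup>2 - 1)"
proof -
  obtain ws where ws: "ws \<in> lists walls" "refl_word ws p \<in> chamber" using reflect_into_chamber[OF p] .
  obtain us A where us: "T = refl_word us \<circ> A" "us \<in> lists walls" "even (length us)" and A: "A \<in> \<Delta>"
    using T by (auto simp: \<Lambda>_def)
  have rev: "rev ws \<in> lists walls" using ws by auto
  define S where "S = refl_word ws \<circ> T \<circ> refl_word (rev ws)"
  have "S = refl_word (ws @ us @ map A (rev ws)) \<circ> A"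
    using \<Delta>_refl_word[OF A, of "rev ws"] by (simp add: S_def us refl_word_append comp_assoc)
  also have "\<dots> \<in> \<Lambda>"
    using ws us \<Delta>_lists[OF A rev] by (intro \<Lambda>I A) auto
  finally have S: "S \<in> \<Lambda>" .
  have inv: "refl_word (rev ws) (refl_word ws y) = y" for y
    using refl_word_rev[OF ws(1)] by (simp add: pointfree_idE)
  have "S \<noteq> id"
  proof
    assume "S = id"
    hence "refl_word (rev ws) \<circ> S \<circ> refl_word ws = refl_word (rev ws) \<circ> refl_word ws" by simp
    hence "T = id" by (auto simp: S_def fun_eq_iff inv)
    with T(2) show False ..
  qed
  from \<Lambda>_displacement_chamber[OF S this ws(2)]
  have "refl_word ws p \<bullet>\<^sub>M refl_word ws (T p) \<le> - (2 * c\<^sup>2 - 1)" by (simp add: S_def inv)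
  thus ?thesis using lorentz_minkowski[OF refl_word_lorentz[OF ws(1)]] by simp
qed

lemma \<Lambda>_cobounded: "\<exists>R'. \<forall>p\<in>hyperboloid. \<exists>T\<in>\<Lambda>. snd (T p) \<le> R'"
proof -
  obtain R\<^sub>0 where R0: "\<And>p. p \<in> chamber \<Longrightarrow> \<exists>A\<in>\<Delta>. snd (A p) \<le> R\<^sub>0" using \<Delta>_cobounded by blast
  define v where "v = reflection w\<^sub>1 (0, 1)"
  define R' where "R' = max R\<^sub>0 ((norm (fst v) + \<bar>snd v\<bar>) * R\<^sub>0)"
  have "\<exists>T\<in>\<Lambda>. snd (T p) \<le> R'" if p: "p \<in> hyperboloid" for p
  proof -
    obtain ws where ws: "ws \<in> lists walls" "refl_word ws p \<in> chamber" using reflect_into_chamber[OF p] .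
    obtain A where A: "A \<in> \<Delta>" "snd (A (refl_word ws p)) \<le> R\<^sub>0" using R0[OF ws(2)] by blast
    define q where "q = A (refl_word ws p)"
    have q: "q \<in> hyperboloid"
      unfolding q_def by (rule lorentz_hyperboloid[OF \<Delta>_lorentz[OF A(1)] chamber_hyperboloid[OF ws(2)]])
    have eq: "(refl_word (map A ws) \<circ> A) p = q" by (simp add: q_def flip: \<Delta>_refl_word[OF A(1)])
    show ?thesis
    proof (cases "even (length ws)")
      case True
      thus ?thesis using \<Lambda>I[OF \<Delta>_lists[OF A(1) ws(1)] _ A(1)] A(2) eq
        by (intro bexI[of _ "refl_word (map A ws) \<circ> A"]) (auto simp: R'_def q_def)
    next
      case False
      have "refl_word (w\<^sub>1 # map A ws) \<circ> A \<in> \<Lambda>"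
        using False \<Delta>_lists[OF A(1) ws(1)] w12_walls by (intro \<Lambda>I A(1)) auto
      moreover have "snd ((refl_word (w\<^sub>1 # map A ws) \<circ> A) p) \<le> R'"
      proof -
        have u: "w\<^sub>1 \<bullet>\<^sub>M w\<^sub>1 = 1" by (rule unit[OF w12(1)])
        have "snd ((refl_word (w\<^sub>1 # map A ws) \<circ> A) p) = - (reflection w\<^sub>1 q \<bullet>\<^sub>M (0, 1))"
          using eq by simp
        also have "\<dots> = - (reflection w\<^sub>1 (reflection w\<^sub>1 q) \<bullet>\<^sub>M v)"
          unfolding v_def reflection_minkowski[OF u] ..
        also have "\<dots> = - (v \<bullet>\<^sub>M q)" by (simp only: reflection_involution[OF u] minkowski_commute)
        also have "\<dots> \<le> (norm (fst v) + \<bar>snd v\<bar>) * R\<^sub>0"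
          using minkowski_le_time[OF q, of R\<^sub>0 v] A(2) by (simp add: q_def)
        finally show ?thesis by (simp add: R'_def)
      qed
      ultimately show ?thesis by blast
    qed
  qed
  thus ?thesis by blast
qed

text \<open>
  The unit tangent vector of the common perpendicular at the base point. The product of the
  reflections in \<open>w\<^sub>1\<close> and \<open>w\<^sub>2\<close> is a translation along this line.
\<close>

definition direction where "direction = (1 / sqrt (2 * c + 2)) *\<^sub>R (w\<^sub>1 - w\<^sub>2)"

lemma direction_orthonormal: "direction \<bullet>\<^sub>M direction = 1" "base \<bullet>\<^sub>M direction = 0"
proof -
  have "(w\<^sub>1 - w\<^sub>2) \<bullet>\<^sub>M (w\<^sub>1 - w\<^sub>2) = 2 * c + 2" by (simp add: minkowski_simps unit w12 w21)
  thus "direction \<bullet>\<^sub>M direction = 1"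
    using c by (simp add: direction_def minkowski_scaleR_left minkowski_scaleR_right)
  have "(w\<^sub>1 + w\<^sub>2) \<bullet>\<^sub>M (w\<^sub>1 - w\<^sub>2) = 0" by (simp add: minkowski_simps unit w12 w21)
  thus "base \<bullet>\<^sub>M direction = 0"
    by (simp add: direction_def base_def minkowski_scaleR_left minkowski_scaleR_right)
qed

lemma translation_mem: "reflection w\<^sub>1 \<circ> reflection w\<^sub>2 \<in> \<Lambda>"
  using \<Lambda>I[OF _ _ \<Delta>_id, of "[w\<^sub>1, w\<^sub>2]"] w12_walls by simp

lemma translation_axis:
  assumes l: "cosh l = 2 * c\<^sup>2 - 1" "l > 0"
  shows "(reflection w\<^sub>1 \<circ> reflection w\<^sub>2) (cosh t *\<^sub>R base + sinh t *\<^sub>R direction)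
    = cosh (t + l) *\<^sub>R base + sinh (t + l) *\<^sub>R direction"
proof -
  define T where "T = reflection w\<^sub>1 \<circ> reflection w\<^sub>2"
  have lin: "linear T" unfolding T_def by (intro linear_compose linear_reflection)
  define k m where "k = sqrt (c - 1)" and "m = sqrt (c + 1)"
  have k: "k > 0" "k\<^sup>2 = c - 1" and m: "m > 0" "m\<^sup>2 = c + 1" using c by (auto simp: k_def m_def)
  have eqs: "sqrt (2 * c - 2) = sqrt 2 * k" "sqrt (2 * c + 2) = sqrt 2 * m"
    by (simp_all add: k_def m_def flip: real_sqrt_mult)
  have kb: "k *\<^sub>R base = (1 / sqrt 2) *\<^sub>R (w\<^sub>1 + w\<^sub>2)" and ma: "m *\<^sub>R direction = (1 / sqrt 2) *\<^sub>R (w\<^sub>1 - w\<^sub>2)"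
    using k m by (simp_all add: base_def direction_def eqs)
  have half2: "(sqrt 2 / 2) *\<^sub>R ((1 / sqrt 2) *\<^sub>R (x + x)) = x" for x :: "'n::finite spacetime"
    by (simp flip: scaleR_2)
  have w1: "w\<^sub>1 = (sqrt 2 / 2) *\<^sub>R (k *\<^sub>R base + m *\<^sub>R direction)"
    and w2: "w\<^sub>2 = (sqrt 2 / 2) *\<^sub>R (k *\<^sub>R base - m *\<^sub>R direction)"
    unfolding kb ma scaleR_add_right[symmetric] scaleR_diff_right[symmetric]
    using half2[of w\<^sub>1] half2[of w\<^sub>2] by (simp_all add: algebra_simps)
  have sinh: "sinh l = 2 * c * k * m"
  proof -
    have "(sinh l)\<^sup>2 = (2 * c\<^sup>2 - 1)\<^sup>2 - 1" using hyperbolic_pythagoras[of l] l by simp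
    also have "\<dots> = 4 * c\<^sup>2 * ((c - 1) * (c + 1))" by (simp add: power2_eq_square algebra_simps)
    also have "\<dots> = (2 * c * k * m)\<^sup>2" unfolding k(2)[symmetric] m(2)[symmetric] by (simp add: power_mult_distrib)
    finally show ?thesis using l k m c by (subst (asm) power2_eq_iff_nonneg) auto
  qed
  have bw: "base \<bullet>\<^sub>M w\<^sub>1 = - (k / sqrt 2)" "base \<bullet>\<^sub>M w\<^sub>2 = - (k / sqrt 2)"
    and aw: "direction \<bullet>\<^sub>M w\<^sub>1 = m / sqrt 2" "direction \<bullet>\<^sub>M w\<^sub>2 = - (m / sqrt 2)"
  proof -
    have kk: "c - 1 = k * k" "c + 1 = m * m" using k m by (simp_all add: power2_eq_square)
    have "(w\<^sub>1 + w\<^sub>2) \<bullet>\<^sub>M w\<^sub>1 = - (k * k)" "(w\<^sub>1 + w\<^sub>2) \<bullet>\<^sub>M w\<^sub>2 = - (k * k)"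
      "(w\<^sub>1 - w\<^sub>2) \<bullet>\<^sub>M w\<^sub>1 = m * m" "(w\<^sub>1 - w\<^sub>2) \<bullet>\<^sub>M w\<^sub>2 = - (m * m)"
      by (simp_all add: minkowski_simps unit w12 w21 flip: kk)
    thus "base \<bullet>\<^sub>M w\<^sub>1 = - (k / sqrt 2)" "base \<bullet>\<^sub>M w\<^sub>2 = - (k / sqrt 2)"
      "direction \<bullet>\<^sub>M w\<^sub>1 = m / sqrt 2" "direction \<bullet>\<^sub>M w\<^sub>2 = - (m / sqrt 2)"
      using k m by (simp_all add: base_def direction_def eqs minkowski_scaleR_left)
  qed
  have half: "(2 * (x / sqrt 2)) *\<^sub>R ((sqrt 2 / 2) *\<^sub>R y) = x *\<^sub>R y" for x and y :: "'n spacetime"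
    by simp
  have r: "reflection w\<^sub>1 base = base + k *\<^sub>R (k *\<^sub>R base + m *\<^sub>R direction)"
    "reflection w\<^sub>2 base = base + k *\<^sub>R (k *\<^sub>R base - m *\<^sub>R direction)"
    "reflection w\<^sub>1 direction = direction - m *\<^sub>R (k *\<^sub>R base + m *\<^sub>R direction)"
    "reflection w\<^sub>2 direction = direction + m *\<^sub>R (k *\<^sub>R base - m *\<^sub>R direction)"
    unfolding reflection_def bw aw using half w1 w2 by (metis (no_types, lifting) diff_minus_eq_add mult_minus_right scaleR_minus_left)+
  have kk: "k * k = c - 1" "m * m = c + 1" using k m by (simp_all add: power2_eq_square)
  have r1: "reflection w\<^sub>1 base = c *\<^sub>R base + (k * m) *\<^sub>R direction"
    "reflection w\<^sub>1 direction = - (k * m) *\<^sub>R base - c *\<^sub>R direction"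
    and r2: "reflection w\<^sub>2 base = c *\<^sub>R base - (k * m) *\<^sub>R direction"
    "reflection w\<^sub>2 direction = (k * m) *\<^sub>R base - c *\<^sub>R direction"
    unfolding r scaleR_add_right scaleR_diff_right scaleR_scaleR kk
    by (simp_all add: algebra_simps)
  have km: "(k * m) * (k * m) = c\<^sup>2 - 1"
    using kk by (metis mult.assoc mult.left_commute power2_eq_square square_diff_one_factored mult.commute)
  have lin1: "linear (reflection w\<^sub>1)" by (rule linear_reflection)
  have C: "c * c + (k * m) * (k * m) = cosh l" and S: "c * (k * m) + c * (k * m) = sinh l"
    unfolding km sinh l(1) by (simp_all add: power2_eq_square)
  have Tb: "T base = cosh l *\<^sub>R base + sinh l *\<^sub>R direction"
    unfolding C[symmetric] S[symmetric] scaleR_add_left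
    by (simp add: T_def r2 linear_diff[OF lin1] linear_cmul[OF lin1] r1 algebra_simps)
  have Ta: "T direction = sinh l *\<^sub>R base + cosh l *\<^sub>R direction"
    unfolding C[symmetric] S[symmetric] scaleR_add_left
    by (simp add: T_def r2 linear_diff[OF lin1] linear_cmul[OF lin1] r1 algebra_simps)
  have "T (cosh t *\<^sub>R base + sinh t *\<^sub>R direction)
      = cosh t *\<^sub>R (cosh l *\<^sub>R base + sinh l *\<^sub>R direction) + sinh t *\<^sub>R (sinh l *\<^sub>R base + cosh l *\<^sub>R direction)"
    by (simp only: linear_add[OF lin] linear_cmul[OF lin] Tb Ta)
  also have "\<dots> = cosh (t + l) *\<^sub>R base + sinh (t + l) *\<^sub>R direction"
    by (simp add: cosh_add sinh_add algebra_simps)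
  finally show ?thesis by (simp add: T_def)
qed

end

section \<open>Short vectors in volume-preserving images of a lattice\<close>

lemma orthonormal_expansion:
  fixes B :: "'a::euclidean_space set"
  assumes B: "finite B" "pairwise orthogonal B" "\<And>b. b \<in> B \<Longrightarrow> norm b = 1" and x: "x \<in> span B"
  shows "x = (\<Sum>b\<in>B. (x \<bullet> b) *\<^sub>R b)" "(norm x)\<^sup>2 = (\<Sum>b\<in>B. (x \<bullet> b)\<^sup>2)"
proof -
  have bb: "a \<bullet> b = (if a = b then 1 else 0)" if "a \<in> B" "b \<in> B" for a b
    using that B(2,3) by (auto simp: pairwise_def orthogonal_def norm_eq_1)
  have lin: "linear (\<lambda>x. \<Sum>b\<in>B. (x \<bullet> b) *\<^sub>R b)"
    by (rule linearI) (simp_all add: inner_add_left scaleR_add_left sum.distrib scaleR_sum_right)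
  have fix_B: "a = (\<Sum>b\<in>B. (a \<bullet> b) *\<^sub>R b)" if a: "a \<in> B" for a
  proof -
    have "(\<Sum>b\<in>B. (a \<bullet> b) *\<^sub>R b) = (\<Sum>b\<in>B. if a = b then b else 0)"
      by (rule sum.cong) (use bb a in auto)
    also have "\<dots> = a" using B(1) a by simp
    finally show ?thesis ..
  qed
  have "id x = (\<lambda>x. \<Sum>b\<in>B. (x \<bullet> b) *\<^sub>R b) x"
    by (rule linear_eq_on_span[OF linear_id lin _ x]) (unfold id_apply, rule fix_B)
  thus *: "x = (\<Sum>b\<in>B. (x \<bullet> b) *\<^sub>R b)" by (simp only: id_apply)
  have "(norm x)\<^sup>2 = x \<bullet> (\<Sum>b\<in>B. (x \<bullet> b) *\<^sub>R b)"
    using * by (simp add: power2_norm_eq_inner)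
  thus "(norm x)\<^sup>2 = (\<Sum>b\<in>B. (x \<bullet> b)\<^sup>2)" by (simp add: inner_sum_right power2_eq_square)
qed

lemma pigeonhole_fibre:
  assumes "finite A" "finite C" "f ` A \<subseteq> C" "C \<noteq> {}"
  shows "\<exists>c\<in>C. card A \<le> card C * card {a \<in> A. f a = c}"
proof -
  have "(\<Sum>c\<in>C. card {a \<in> A. f a = c}) = card A"
    using sum.group[OF assms(1,2,3), of "\<lambda>_. 1 :: nat"] by simp
  moreover have "Max ((\<lambda>c. card {a \<in> A. f a = c}) ` C) \<in> (\<lambda>c. card {a \<in> A. f a = c}) ` C"
    using assms(2,4) by (intro Max_in) auto
  then obtain c where c: "c \<in> C" "card {a \<in> A. f a = c} = Max ((\<lambda>c. card {a \<in> A. f a = c}) ` C)" by auto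
  have "card {a \<in> A. f a = c'} \<le> card {a \<in> A. f a = c}" if "c' \<in> C" for c'
    unfolding c(2) using that assms(2) by simp
  ultimately show ?thesis
    using c(1) sum_bounded_above[of C "\<lambda>c. card {a \<in> A. f a = c}"] by (intro bexI[of _ c]) auto
qed

lemma card_int_interval_le:
  fixes x :: real assumes "x \<ge> 0"
  shows "real (card {\<lfloor>- x\<rfloor>..\<lfloor>x\<rfloor>}) \<le> 2 * x + 2"
proof -
  have "\<lfloor>- x\<rfloor> \<le> \<lfloor>x\<rfloor>" using assms by (intro floor_mono) auto
  hence "real (card {\<lfloor>- x\<rfloor>..\<lfloor>x\<rfloor>}) = of_int \<lfloor>x\<rfloor> - of_int \<lfloor>- x\<rfloor> + 1" by simp
  thus ?thesis using floor_correct[of x] floor_correct[of "- x"] by linarith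
qed

lemma same_floor_close: "\<lfloor>x\<rfloor> = \<lfloor>y\<rfloor> \<Longrightarrow> \<bar>x - y :: real\<bar> < 1"
  using floor_correct[of x] floor_correct[of y] by linarith

definition stretch :: "'a set \<Rightarrow> ('a \<Rightarrow> real) \<Rightarrow> 'a::euclidean_space \<Rightarrow> 'a" where
  "stretch J \<mu> x = (\<Sum>j\<in>J. (\<mu> j * (x \<bullet> j)) *\<^sub>R j)"

text \<open>
  A linear map of determinant one that is diagonal and positive in an orthonormal basis. The boosts
  of Minkowski space are of this form.
\<close>

definition unimodular_stretch :: "'a::euclidean_space set \<Rightarrow> ('a \<Rightarrow> real) \<Rightarrow> bool" where
  "unimodular_stretch J \<mu> \<longleftrightarrow> pairwise orthogonal J \<and> (\<forall>j\<in>J. norm j = 1) \<and> span J = UNIV \<and>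
     (\<forall>j\<in>J. \<mu> j > 0) \<and> prod \<mu> J = 1"

lemma linear_stretch: "linear (stretch J \<mu>)"
  by (rule linearI) (auto simp: stretch_def inner_add_left algebra_simps sum.distrib scaleR_sum_right)

lemma stretch_basis:
  fixes J :: "'a::euclidean_space set"
  assumes "unimodular_stretch J \<mu>" shows "finite J" "card J = DIM('a)"
proof -
  have "0 \<notin> J" using assms by (auto simp: unimodular_stretch_def)
  hence "independent J" using assms pairwise_orthogonal_independent by (auto simp: unimodular_stretch_def)
  thus "finite (J :: 'a set)" "card J = DIM('a)"
    using assms dim_eq_card_independent[of J] dim_span[of J]
    by (auto simp: independent_imp_finite unimodular_stretch_def)
qed

lemma norm_stretch:
  assumes "unimodular_stretch J \<mu>" shows "(norm (stretch J \<mu> x))\<^sup>2 = (\<Sum>j\<in>J. (\<mu> j * (x \<bullet> j))\<^sup>2)"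
proof -
  have J: "finite J" by (rule stretch_basis[OF assms])
  have bb: "a \<bullet> b = (if a = b then 1 else 0)" if "a \<in> J" "b \<in> J" for a b
    using that assms by (auto simp: unimodular_stretch_def pairwise_def orthogonal_def norm_eq_1)
  have coord: "stretch J \<mu> x \<bullet> j = \<mu> j * (x \<bullet> j)" if j: "j \<in> J" for j
  proof -
    have "stretch J \<mu> x \<bullet> j = (\<Sum>i\<in>J. if i = j then \<mu> i * (x \<bullet> i) else 0)"
      unfolding stretch_def inner_sum_left by (rule sum.cong) (use bb j in auto)
    thus ?thesis using J j by simp
  qed
  have "(norm (stretch J \<mu> x))\<^sup>2 = (\<Sum>j\<in>J. (stretch J \<mu> x \<bullet> j)\<^sup>2)"
    by (rule orthonormal_expansion(2)) (use J assms in \<open>auto simp: unimodular_stretch_def\<close>)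
  also have "\<dots> = (\<Sum>j\<in>J. (\<mu> j * (x \<bullet> j))\<^sup>2)" by (rule sum.cong) (auto simp: coord)
  finally show ?thesis .
qed

definition int_span :: "'a::real_vector set \<Rightarrow> 'a set" where
  "int_span S = range (\<lambda>k :: 'a \<Rightarrow> int. \<Sum>b\<in>S. of_int (k b) *\<^sub>R b)"

lemma int_span_0: "0 \<in> int_span S"
  unfolding int_span_def by (rule range_eqI[of _ _ "\<lambda>_. 0"]) simp

lemma int_span_add: assumes "x \<in> int_span S" "y \<in> int_span S" shows "x + y \<in> int_span S"
proof -
  obtain k l where "x = (\<Sum>b\<in>S. of_int (k b) *\<^sub>R b)" "y = (\<Sum>b\<in>S. of_int (l b) *\<^sub>R b)"
    using assms by (auto simp: int_span_def)
  thus ?thesis unfolding int_span_def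
    by (intro range_eqI[of _ _ "\<lambda>b. k b + l b"]) (simp add: algebra_simps sum.distrib)
qed

lemma int_span_scale: assumes "x \<in> int_span S" shows "of_int n *\<^sub>R x \<in> int_span S"
proof -
  obtain k where "x = (\<Sum>b\<in>S. of_int (k b) *\<^sub>R b)"
    using assms by (auto simp: int_span_def)
  thus ?thesis unfolding int_span_def
    by (intro range_eqI[of _ _ "\<lambda>b. n * k b"]) (simp add: scaleR_sum_right)
qed

lemma int_span_minus: "x \<in> int_span S \<Longrightarrow> - x \<in> int_span S"
  using int_span_scale[of x S "-1"] by simp

lemma int_span_diff: "x \<in> int_span S \<Longrightarrow> y \<in> int_span S \<Longrightarrow> x - y \<in> int_span S"
  using int_span_add[OF _ int_span_minus, of x S y] by simp

lemma int_span_sum: "(\<And>i. i \<in> I \<Longrightarrow> f i \<in> int_span S) \<Longrightarrow> sum f I \<in> int_span S"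
  by (induction I rule: infinite_finite_induct) (auto simp: int_span_0 int_span_add)

text \<open>
  A lattice has at least \<open>K\<^sup>m\<close> points in a ball of radius proportional to \<open>K\<close>. A stretch maps it
  into a box of volume proportional to \<open>K\<^sup>m\<close>, so some cell of side \<open>r\<close> contains the images of a
  number of points proportional to \<open>r\<^sup>m\<close>. Their differences are short.
\<close>

lemma many_short_vectors:
  fixes B :: "'a::euclidean_space set"
  assumes B: "independent B" "card B = DIM('a)"
  obtains \<kappa> where "\<kappa> > 0"
    "\<And>J \<mu> r. unimodular_stretch J \<mu> \<Longrightarrow> r > 0 \<Longrightarrow>
       \<exists>S\<subseteq>int_span B. finite S \<and> (\<forall>x\<in>S. norm (stretch J \<mu> x) \<le> sqrt DIM('a) * r) \<and> \<kappa> * r ^ DIM('a) \<le> card S"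
proof
  define s where "s = (\<Sum>b\<in>B. norm b)"
  have finB: "finite B" using B independent_imp_finite by blast
  have "B \<noteq> {}" using B(2) DIM_positive[where 'a = 'a] by auto
  have "0 \<notin> B" using B(1) dependent_zero by blast
  hence s: "s > 0" unfolding s_def using finB \<open>B \<noteq> {}\<close> by (intro sum_pos) auto
  define m where "m = DIM('a)"
  show "(1 / (4 * s)) ^ m > 0" using s by simp
  fix J :: "'a set" and \<mu> and r :: real
  assume J: "unimodular_stretch J \<mu>" and r: "r > 0"
  have finJ: "finite J" and cJ: "card J = m" using stretch_basis[OF J] by (auto simp: m_def)
  have J': "norm j = 1" "\<mu> j > 0" if "j \<in> J" for j using J that by (auto simp: unimodular_stretch_def)
  have prod: "prod \<mu> J = 1" using J by (auto simp: unimodular_stretch_def)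
  \<comment> \<open>with \<open>K\<close> this large, the image of the box is at least as wide as a cell in every direction\<close>
  obtain K0 :: nat where K0: "(\<Sum>j\<in>J. r / (\<mu> j * s)) < real K0" using reals_Archimedean2 by blast
  define K where "K = Suc K0"
  define x where "x j = \<mu> j * (real K * s) / r" for j
  have x1: "x j \<ge> 1" if j: "j \<in> J" for j
  proof -
    have "r / (\<mu> j * s) \<le> (\<Sum>j\<in>J. r / (\<mu> j * s))"
      using J' s r finJ j by (intro member_le_sum) (auto intro: less_imp_le)
    hence "r / (\<mu> j * s) \<le> real K" using K0 by (simp add: K_def)
    thus ?thesis using J'[OF j] s r by (simp add: x_def field_simps)
  qed
  define pt where "pt k = (\<Sum>b\<in>B. of_int (k b) *\<^sub>R b)" for k :: "'a \<Rightarrow> int"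
  define P where "P = PiE B (\<lambda>_. {0..int K})"
  have "card {0..int K} = K + 1" by (simp add: nat_add_distrib)
  hence finP: "finite P" and cP: "card P = (K + 1) ^ m"
    using finB B(2) by (auto simp: P_def card_PiE finite_PiE m_def)
  have inj: "inj_on pt P"
  proof (rule inj_onI)
    fix k l assume k: "k \<in> P" "l \<in> P" and eq: "pt k = pt l"
    have "(\<Sum>b\<in>B. (of_int (k b) - of_int (l b)) *\<^sub>R b) = 0"
      using eq by (simp add: pt_def scaleR_diff_left sum_subtractf)
    hence "k b = l b" if "b \<in> B" for b
      using independentD[OF B(1) finB order.refl, of "\<lambda>b. of_int (k b) - of_int (l b)"] that by auto
    thus "k = l" using k by (auto simp: P_def intro: PiE_ext)
  qed
  have norm_pt: "norm (pt k) \<le> real K * s" if "k \<in> P" for k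
  proof -
    have "norm (pt k) \<le> (\<Sum>b\<in>B. norm (of_int (k b) *\<^sub>R b))" unfolding pt_def by (rule norm_sum)
    also have "\<dots> \<le> (\<Sum>b\<in>B. real K * norm b)"
    proof (rule sum_mono)
      fix b assume "b \<in> B"
      hence "0 \<le> k b" "k b \<le> int K" using that by (auto simp: P_def PiE_def Pi_def)
      hence "\<bar>of_int (k b)\<bar> \<le> real K" by simp
      thus "norm (of_int (k b) *\<^sub>R b) \<le> real K * norm b" by (simp add: mult_right_mono)
    qed
    also have "\<dots> = real K * s" by (simp add: s_def sum_distrib_left)
    finally show ?thesis .
  qed
  define cell where "cell y = restrict (\<lambda>j. \<lfloor>\<mu> j * (y \<bullet> j) / r\<rfloor>) J" for y
  define C where "C = PiE J (\<lambda>j. {\<lfloor>- x j\<rfloor>..\<lfloor>x j\<rfloor>})"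
  have finC: "finite C" using finJ by (simp add: C_def finite_PiE)
  have cell: "cell (pt k) \<in> C" if k: "k \<in> P" for k
  proof -
    have "- x j \<le> \<mu> j * (pt k \<bullet> j) / r" "\<mu> j * (pt k \<bullet> j) / r \<le> x j" if j: "j \<in> J" for j
    proof -
      have "\<bar>pt k \<bullet> j\<bar> \<le> norm (pt k) * norm j" by (rule Cauchy_Schwarz_ineq2)
      also have "\<dots> \<le> real K * s" using norm_pt[OF k] J'[OF j] by simp
      finally have "\<mu> j * \<bar>pt k \<bullet> j\<bar> / r \<le> x j"
        unfolding x_def using J'[OF j] r by (intro divide_right_mono mult_left_mono) auto
      moreover have "\<mu> j * \<bar>pt k \<bullet> j\<bar> / r = \<bar>\<mu> j * (pt k \<bullet> j) / r\<bar>"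
        using J'[OF j] r by (simp add: abs_mult)
      ultimately show "- x j \<le> \<mu> j * (pt k \<bullet> j) / r" "\<mu> j * (pt k \<bullet> j) / r \<le> x j" by linarith+
    qed
    thus ?thesis by (auto simp: cell_def C_def intro!: floor_mono)
  qed
  have "P \<noteq> {}" using cP by (metis card.empty power_eq_0_iff add_is_0 one_neq_zero)
  hence "C \<noteq> {}" using cell by blast
  obtain c where c: "c \<in> C" "card P \<le> card C * card {k \<in> P. cell (pt k) = c}"
    using pigeonhole_fibre[OF finP finC, of "\<lambda>k. cell (pt k)"] cell \<open>C \<noteq> {}\<close> by blast
  define F where "F = {k \<in> P. cell (pt k) = c}"
  have cF: "card P \<le> card C * card F" using c(2) by (simp add: F_def)
  have finF: "finite F" using finP by (simp add: F_def)
  have "F \<noteq> {}" using cF cP by (metis card.empty mult_0_right le_zero_eq power_eq_0_iff add_is_0 one_neq_zero)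
  then obtain k0 where k0: "k0 \<in> F" by blast
  have cC: "real (card C) \<le> (4 * real K * s / r) ^ m"
  proof -
    have "real (card C) = (\<Prod>j\<in>J. real (card {\<lfloor>- x j\<rfloor>..\<lfloor>x j\<rfloor>}))"
      using finJ by (simp add: C_def card_PiE)
    also have "\<dots> \<le> (\<Prod>j\<in>J. 4 * x j)"
    proof (rule prod_mono, safe)
      fix j assume j: "j \<in> J"
      show "real (card {\<lfloor>- x j\<rfloor>..\<lfloor>x j\<rfloor>}) \<le> 4 * x j"
        using card_int_interval_le[of "x j"] x1[OF j] by simp
    qed simp
    also have "\<dots> = (\<Prod>j\<in>J. \<mu> j * (4 * real K * s / r))" by (rule prod.cong) (auto simp: x_def)
    also have "\<dots> = (4 * real K * s / r) ^ m" unfolding prod.distrib using prod by (simp add: cJ)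
    finally show ?thesis .
  qed
  have "real K ^ m \<le> real (card P)" by (simp add: cP power_mono)
  also have "\<dots> \<le> real (card C) * real (card F)" using cF by (simp flip: of_nat_mult)
  also have "\<dots> \<le> (4 * real K * s / r) ^ m * real (card F)" using cC by (intro mult_right_mono) auto
  also have "\<dots> = real K ^ m * ((4 * s / r) ^ m * real (card F))"
    by (simp add: power_mult_distrib power_divide)
  finally have "1 \<le> (4 * s / r) ^ m * real (card F)" by (simp add: K_def)
  hence "(r / (4 * s)) ^ m * 1 \<le> (r / (4 * s)) ^ m * ((4 * s / r) ^ m * real (card F))"
    using r s by (intro mult_left_mono) auto
  also have "\<dots> = (r / (4 * s) * (4 * s / r)) ^ m * real (card F)"
    by (simp only: power_mult_distrib mult.assoc)
  also have "\<dots> = real (card F)" using r s by simp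
  finally have bound: "(1 / (4 * s)) ^ m * r ^ m \<le> real (card F)"
    by (simp add: power_divide)
  define S where "S = (\<lambda>k. pt k - pt k0) ` F"
  have "inj_on (\<lambda>k. pt k - pt k0) F" using inj by (auto simp: inj_on_def F_def)
  hence cS: "card S = card F" by (simp add: S_def card_image)
  show "\<exists>S\<subseteq>int_span B. finite S \<and> (\<forall>x\<in>S. norm (stretch J \<mu> x) \<le> sqrt DIM('a) * r) \<and>
      (1 / (4 * s)) ^ m * r ^ DIM('a) \<le> card S"
  proof (intro exI[of _ S] conjI ballI)
    show "S \<subseteq> int_span B" by (auto simp: S_def pt_def int_span_def intro!: int_span_diff[unfolded int_span_def])
    show "finite S" using finF by (simp add: S_def)
    show "(1 / (4 * s)) ^ m * r ^ DIM('a) \<le> card S" using bound by (simp add: cS m_def)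
    fix y assume "y \<in> S"
    then obtain k where k: "k \<in> F" "y = pt k - pt k0" by (auto simp: S_def)
    have "(norm (stretch J \<mu> y))\<^sup>2 = (\<Sum>j\<in>J. (\<mu> j * (y \<bullet> j))\<^sup>2)" by (rule norm_stretch[OF J])
    also have "\<dots> \<le> (\<Sum>j\<in>J. r\<^sup>2)"
    proof (rule sum_mono)
      fix j assume j: "j \<in> J"
      have "cell (pt k) j = cell (pt k0) j" using k(1) k0 by (simp add: F_def)
      hence "\<bar>\<mu> j * (pt k \<bullet> j) / r - \<mu> j * (pt k0 \<bullet> j) / r\<bar> < 1"
        using j by (intro same_floor_close) (simp add: cell_def)
      moreover have "\<mu> j * (pt k \<bullet> j) / r - \<mu> j * (pt k0 \<bullet> j) / r = \<mu> j * (y \<bullet> j) / r"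
        by (simp add: k(2) inner_diff_left right_diff_distrib diff_divide_distrib)
      ultimately have "\<bar>\<mu> j * (y \<bullet> j)\<bar> < r" using r by (simp add: field_simps)
      thus "(\<mu> j * (y \<bullet> j))\<^sup>2 \<le> r\<^sup>2" by (intro power2_le_iff_abs_le[THEN iffD2]) (use r in auto)
    qed
    also have "\<dots> = (sqrt DIM('a) * r)\<^sup>2" by (simp add: cJ m_def power_mult_distrib)
    finally show "norm (stretch J \<mu> y) \<le> sqrt DIM('a) * r"
      by (rule power2_le_imp_le) (use r in simp)
  qed
qed

text \<open>
  Conversely, vectors of mutual distance at least one that lie in a subspace of dimension \<open>d\<close>
  can be distinguished by rounding \<open>d\<close> coordinates, so that there are few of them.
\<close>

lemma few_separated_vectors:
  fixes f :: "'a::euclidean_space \<Rightarrow> 'a" and U :: "'a set"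
  assumes f: "linear f" and U: "subspace U" and S: "S \<subseteq> U" and \<rho>: "\<rho> \<ge> 0" "\<And>x. x \<in> S \<Longrightarrow> norm (f x) \<le> \<rho>"
    and sep: "\<And>x y. x \<in> S \<Longrightarrow> y \<in> S \<Longrightarrow> x \<noteq> y \<Longrightarrow> 1 \<le> norm (f (x - y))"
  shows "finite S" "real (card S) \<le> (2 * \<rho> * real (DIM('a) + 1) + 2) ^ dim U"
proof -
  define M where "M = real (DIM('a) + 1)"
  have sub: "subspace (f ` U)" by (rule linear_subspace_image[OF f U])
  obtain B where B: "B \<subseteq> f ` U" "pairwise orthogonal B" "\<And>b. b \<in> B \<Longrightarrow> norm b = 1"
    "independent B" "card B = dim (f ` U)" "span B = f ` U"
    using orthonormal_basis_subspace[OF sub] by metis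
  have finB: "finite B" using B(4) independent_imp_finite by blast
  define cell where "cell x = restrict (\<lambda>b. \<lfloor>M * (f x \<bullet> b)\<rfloor>) B" for x
  define C where "C = PiE B (\<lambda>_. {\<lfloor>- (M * \<rho>)\<rfloor>..\<lfloor>M * \<rho>\<rfloor>})"
  have finC: "finite C" using finB by (simp add: C_def finite_PiE)
  have M: "M \<ge> 1" by (simp add: M_def)
  have "cell x \<in> C" if x: "x \<in> S" for x
  proof -
    have "- (M * \<rho>) \<le> M * (f x \<bullet> b)" "M * (f x \<bullet> b) \<le> M * \<rho>" if b: "b \<in> B" for b
    proof -
      have "\<bar>f x \<bullet> b\<bar> \<le> norm (f x) * norm b" by (rule Cauchy_Schwarz_ineq2)
      also have "\<dots> \<le> \<rho>" using \<rho>(2)[OF x] B(3)[OF b] by simp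
      finally have "M * \<bar>f x \<bullet> b\<bar> \<le> M * \<rho>" using M by (intro mult_left_mono) auto
      hence "\<bar>M * (f x \<bullet> b)\<bar> \<le> M * \<rho>" using M by (simp add: abs_mult)
      thus "- (M * \<rho>) \<le> M * (f x \<bullet> b)" "M * (f x \<bullet> b) \<le> M * \<rho>" by linarith+
    qed
    thus ?thesis by (auto simp: cell_def C_def intro!: floor_mono)
  qed
  hence img: "cell ` S \<subseteq> C" by blast
  have inj: "inj_on cell S"
  proof (rule inj_onI, rule ccontr)
    fix x y assume xy: "x \<in> S" "y \<in> S" "cell x = cell y" "x \<noteq> y"
    have "x - y \<in> U" using xy S subspace_diff[OF U] by blast
    hence "f (x - y) \<in> span B" unfolding B(6) by (rule imageI)
    hence "(norm (f (x - y)))\<^sup>2 = (\<Sum>b\<in>B. (f (x - y) \<bullet> b)\<^sup>2)"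
      using orthonormal_expansion(2)[OF finB B(2,3)] by blast
    also have "\<dots> \<le> (\<Sum>b\<in>B. (1 / M)\<^sup>2)"
    proof (rule sum_mono)
      fix b assume b: "b \<in> B"
      have "\<bar>M * (f x \<bullet> b) - M * (f y \<bullet> b)\<bar> < 1"
        using fun_cong[OF xy(3), of b] b by (intro same_floor_close) (simp add: cell_def)
      hence "\<bar>M * (f (x - y) \<bullet> b)\<bar> < 1" by (simp add: linear_diff[OF f] inner_diff_left right_diff_distrib)
      hence "\<bar>f (x - y) \<bullet> b\<bar> \<le> 1 / M" using M by (simp add: abs_mult field_simps)
      thus "(f (x - y) \<bullet> b)\<^sup>2 \<le> (1 / M)\<^sup>2" using M by (intro power2_le_iff_abs_le[THEN iffD2]) auto
    qed
    also have "\<dots> = real (dim (f ` U)) / M\<^sup>2" by (simp add: B(5) power_divide)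
    also have "\<dots> < 1"
    proof -
      have "real (dim (f ` U)) < M" using dim_subset_UNIV[of "f ` U"] by (simp add: M_def)
      also have "M * 1 \<le> M * M" using M by (intro mult_left_mono) auto
      hence "M \<le> M\<^sup>2" by (simp add: power2_eq_square)
      finally show ?thesis using M by simp
    qed
    finally have "norm (f (x - y)) < 1" by (simp add: power_less_one_iff abs_square_less_1)
    with sep[OF xy(1,2,4)] show False by simp
  qed
  show "finite S" by (rule inj_on_finite[OF inj img finC])
  have "card S \<le> card C" by (rule card_inj_on_le[OF inj img finC])
  hence "real (card S) \<le> real (card C)" by simp
  also have "\<dots> = real (card {\<lfloor>- (M * \<rho>)\<rfloor>..\<lfloor>M * \<rho>\<rfloor>}) ^ dim (f ` U)"
    using finB B(5) by (simp add: C_def card_PiE)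
  also have "\<dots> \<le> (2 * (M * \<rho>) + 2) ^ dim (f ` U)"
    using M \<rho>(1) by (intro power_mono card_int_interval_le) auto
  also have "\<dots> \<le> (2 * (M * \<rho>) + 2) ^ dim U"
    using M \<rho>(1) dim_image_le[OF f, of U] by (intro power_increasing) auto
  finally show "real (card S) \<le> (2 * \<rho> * real (DIM('a) + 1) + 2) ^ dim U"
    by (simp add: M_def algebra_simps)
qed

text \<open>
  Comparing the two counts shows that, if the image of the lattice has no nonzero vector shorter
  than one, then its short vectors cannot all lie in a proper subspace.
\<close>

lemma short_vectors_span:
  fixes B :: "'a::euclidean_space set"
  assumes B: "independent B" "card B = DIM('a)"
  obtains \<rho> where "\<rho> \<ge> 0"
    "\<And>J \<mu>. unimodular_stretch J \<mu> \<Longrightarrow> (\<And>x. x \<in> int_span B \<Longrightarrow> x \<noteq> 0 \<Longrightarrow> 1 \<le> norm (stretch J \<mu> x)) \<Longrightarrow>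
       span {x \<in> int_span B. norm (stretch J \<mu> x) \<le> \<rho>} = UNIV"
proof -
  obtain \<kappa> where \<kappa>: "\<kappa> > 0" and many:
    "\<And>J \<mu> r. unimodular_stretch J \<mu> \<Longrightarrow> r > 0 \<Longrightarrow>
       \<exists>S\<subseteq>int_span B. finite S \<and> (\<forall>x\<in>S. norm (stretch J \<mu> x) \<le> sqrt DIM('a) * r) \<and> \<kappa> * r ^ DIM('a) \<le> card S"
    using many_short_vectors[OF B] by metis
  define m where "m = DIM('a)"
  define a where "a = 2 * sqrt m * real (m + 1) + 2"
  have m: "m \<ge> 1" using DIM_positive[where 'a = 'a] by (simp add: m_def)
  have a: "a \<ge> 1" by (simp add: a_def)
  \<comment> \<open>where the lower bound \<open>\<kappa> * r ^ m\<close> overtakes the upper bound \<open>(a * r) ^ (m - 1)\<close>\<close>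
  define r where "r = a ^ (m - 1) / \<kappa> + 1"
  have r: "r \<ge> 1" using \<kappa> a by (simp add: r_def)
  show thesis
  proof
    show "sqrt m * r \<ge> 0" using r by simp
    fix J :: "'a set" and \<mu>
    assume J: "unimodular_stretch J \<mu>" and min: "\<And>x. x \<in> int_span B \<Longrightarrow> x \<noteq> 0 \<Longrightarrow> 1 \<le> norm (stretch J \<mu> x)"
    define U where "U = span {x \<in> int_span B. norm (stretch J \<mu> x) \<le> sqrt m * r}"
    show "span {x \<in> int_span B. norm (stretch J \<mu> x) \<le> sqrt m * r} = UNIV"
    proof (rule ccontr)
      assume "\<not> ?thesis"
      hence "dim U \<noteq> m" unfolding U_def m_def by (metis dim_eq_full dim_span)
      moreover have "dim U \<le> m" unfolding m_def by (rule dim_subset_UNIV)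
      ultimately have dU: "dim U \<le> m - 1" by simp
      obtain S where S: "S \<subseteq> int_span B" "finite S" "\<forall>x\<in>S. norm (stretch J \<mu> x) \<le> sqrt m * r" "\<kappa> * r ^ m \<le> card S"
        using many[OF J, of r] r by (auto simp: m_def)
      have "real (card S) \<le> (2 * (sqrt m * r) * real (DIM('a) + 1) + 2) ^ dim U"
      proof (rule few_separated_vectors(2)[OF linear_stretch[of J \<mu>]])
        show "subspace U" by (simp add: U_def)
        show "S \<subseteq> U" unfolding U_def using S by (auto intro: span_base)
        show "1 \<le> norm (stretch J \<mu> (x - y))" if "x \<in> S" "y \<in> S" "x \<noteq> y" for x y
          using S(1) that by (intro min int_span_diff) auto
      qed (use S r in auto)
      also have "\<dots> \<le> (a * r) ^ dim U"
      proof (rule power_mono)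
        have "2 \<le> 2 * r" using r by simp
        thus "2 * (sqrt m * r) * real (DIM('a) + 1) + 2 \<le> a * r" by (simp add: a_def m_def algebra_simps)
      qed (use r in auto)
      also have "\<dots> \<le> (a * r) ^ (m - 1)"
        using a r dU mult_mono[of 1 a 1 r] by (intro power_increasing) auto
      finally have "\<kappa> * r ^ m \<le> a ^ (m - 1) * r ^ (m - 1)" using S(4) by (simp add: power_mult_distrib)
      moreover have "r ^ m = r ^ (m - 1) * r" using m by (metis power_minus_mult less_le_trans zero_less_one)
      ultimately have "r ^ (m - 1) * (\<kappa> * r) \<le> r ^ (m - 1) * a ^ (m - 1)" by (simp add: mult_ac)
      hence "\<kappa> * r \<le> a ^ (m - 1)" using r by simp
      moreover have "\<kappa> * r = a ^ (m - 1) + \<kappa>" using \<kappa> by (simp add: r_def field_simps)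
      ultimately show False using \<kappa> by simp
    qed
  qed
qed

text \<open>
  Rounding the coordinates with respect to a basis of short vectors brings every point close to
  the lattice. Applied to half of a lattice vector, this splits a long lattice vector into two
  shorter ones, so that by descent the lattice is generated by its short vectors.
\<close>

lemma short_vectors_generate:
  fixes f :: "'a::euclidean_space \<Rightarrow> 'a" and B :: "'a set" and \<rho> :: real
  assumes f: "linear f" and min: "\<And>x. x \<in> int_span B \<Longrightarrow> x \<noteq> 0 \<Longrightarrow> 1 \<le> norm (f x)"
    and \<rho>: "\<rho> \<ge> 0" "span {x \<in> int_span B. norm (f x) \<le> \<rho>} = UNIV"
    and short: "\<And>x. x \<in> int_span B \<Longrightarrow> norm (f x) \<le> DIM('a) * \<rho> \<Longrightarrow> P x"
    and add: "\<And>x y. x \<in> int_span B \<Longrightarrow> y \<in> int_span B \<Longrightarrow> P x \<Longrightarrow> P y \<Longrightarrow> P (x + y)"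
    and x: "x \<in> int_span B"
  shows "P x"
proof -
  obtain T where T: "T \<subseteq> {x \<in> int_span B. norm (f x) \<le> \<rho>}" "independent T"
    "span T = span {x \<in> int_span B. norm (f x) \<le> \<rho>}"
    using maximal_independent_subset[of "{x \<in> int_span B. norm (f x) \<le> \<rho>}"]
    by (metis (no_types, lifting) span_eq span_superset subset_trans span_mono span_span)
  have finT: "finite T" using T(2) independent_imp_finite by blast
  have cT: "card T = DIM('a)" using T \<rho>(2) by (metis dim_UNIV dim_span_eq_card_independent)
  have close: "\<exists>y\<in>int_span B. norm (f (z - y)) \<le> DIM('a) * \<rho> / 2" for z
  proof -
    have "z \<in> span T" using T(3) \<rho>(2) by simp
    then obtain u where u: "z = (\<Sum>t\<in>T. u t *\<^sub>R t)" using span_finite[OF finT] by auto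
    define y where "y = (\<Sum>t\<in>T. of_int (round (u t)) *\<^sub>R t)"
    have "y \<in> int_span B" unfolding y_def by (intro int_span_sum int_span_scale) (use T in auto)
    moreover have "norm (f (z - y)) \<le> DIM('a) * \<rho> / 2"
    proof -
      have "f (z - y) = (\<Sum>t\<in>T. (u t - of_int (round (u t))) *\<^sub>R f t)"
        by (simp add: u y_def linear_diff[OF f] linear_sum[OF f] linear_cmul[OF f] scaleR_diff_left sum_subtractf)
      also have "norm \<dots> \<le> (\<Sum>t\<in>T. norm ((u t - of_int (round (u t))) *\<^sub>R f t))" by (rule norm_sum)
      also have "\<dots> \<le> (\<Sum>t\<in>T. 1 / 2 * \<rho>)"
      proof (rule sum_mono)
        fix t assume t: "t \<in> T"
        have "\<bar>u t - of_int (round (u t))\<bar> \<le> 1 / 2"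
          using of_int_round_abs_le[of "u t"] by (simp add: abs_minus_commute)
        thus "norm ((u t - of_int (round (u t))) *\<^sub>R f t) \<le> 1 / 2 * \<rho>"
          unfolding norm_scaleR using T t by (intro mult_mono) auto
      qed
      also have "\<dots> = DIM('a) * \<rho> / 2" by (simp add: cT)
      finally show ?thesis .
    qed
    ultimately show ?thesis by blast
  qed
  have fin: "finite {y \<in> int_span B. norm (f y) \<le> b}" for b
  proof (cases "b \<ge> 0")
    case True
    show ?thesis
      by (rule few_separated_vectors(1)[OF f subspace_UNIV _ True]) (auto intro!: min int_span_diff)
  next
    case False
    hence "{y \<in> int_span B. norm (f y) \<le> b} = {}" using order_trans[OF norm_ge_zero] by blast
    thus ?thesis by (simp only: finite.emptyI)
  qed
  show ?thesis using x
  proof (induction "card {y \<in> int_span B. norm (f y) \<le> norm (f x)}" arbitrary: x rule: less_induct)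
    case less
    show ?case
    proof (cases "norm (f x) \<le> DIM('a) * \<rho>")
      case True
      thus ?thesis using short less.prems by blast
    next
      case False
      obtain y where y: "y \<in> int_span B" "norm (f ((1 / 2) *\<^sub>R x - y)) \<le> DIM('a) * \<rho> / 2"
        using close by blast
      have e: "f y = (1 / 2) *\<^sub>R f x - f ((1 / 2) *\<^sub>R x - y)" "f (x - y) = (1 / 2) *\<^sub>R f x + f ((1 / 2) *\<^sub>R x - y)"
        by (simp_all add: linear_diff[OF f] linear_cmul[OF f] algebra_simps flip: scaleR_left_distrib)
      have ny: "norm (f y) < norm (f x)"
        using norm_triangle_ineq4[of "(1 / 2) *\<^sub>R f x" "f ((1 / 2) *\<^sub>R x - y)"] y(2) False by (simp add: e(1))
      have nxy: "norm (f (x - y)) < norm (f x)"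
        using norm_triangle_ineq[of "(1 / 2) *\<^sub>R f x" "f ((1 / 2) *\<^sub>R x - y)"] y(2) False by (simp add: e(2))
      have dec: "P z" if z: "z \<in> int_span B" "norm (f z) < norm (f x)" for z
      proof (rule less.hyps[OF _ z(1)], rule psubset_card_mono[OF fin])
        show "{y \<in> int_span B. norm (f y) \<le> norm (f z)} \<subset> {y \<in> int_span B. norm (f y) \<le> norm (f x)}"
        proof (rule psubsetI)
          have "x \<in> {y \<in> int_span B. norm (f y) \<le> norm (f x)}" using less.prems by simp
          moreover have "x \<notin> {y \<in> int_span B. norm (f y) \<le> norm (f z)}" using z by simp
          ultimately show "{y \<in> int_span B. norm (f y) \<le> norm (f z)} \<noteq> {y \<in> int_span B. norm (f y) \<le> norm (f x)}"
            by blast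
        qed (use z in auto)
      qed
      have "P (y + (x - y))"
        using dec[OF y(1) ny] dec[OF int_span_diff[OF less.prems y(1)] nxy] y(1) less.prems
        by (intro add int_span_diff)
      thus ?thesis by simp
    qed
  qed
qed

text \<open>
  The form of Mahler's compactness theorem that is needed here: the length and the number of the
  generators do not depend on the stretch.
\<close>

theorem uniformly_short_generators:
  fixes B :: "'a::euclidean_space set"
  assumes B: "independent B" "card B = DIM('a)"
  obtains \<rho> :: real and M :: nat where "\<rho> \<ge> 0"
    "\<And>J \<mu>. unimodular_stretch J \<mu> \<Longrightarrow> (\<And>x. x \<in> int_span B \<Longrightarrow> x \<noteq> 0 \<Longrightarrow> 1 \<le> norm (stretch J \<mu> x)) \<Longrightarrow>
       finite {x \<in> int_span B. norm (stretch J \<mu> x) \<le> \<rho>} \<and>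
       card {x \<in> int_span B. norm (stretch J \<mu> x) \<le> \<rho>} \<le> M"
    "\<And>J \<mu> P x. unimodular_stretch J \<mu> \<Longrightarrow> (\<And>x. x \<in> int_span B \<Longrightarrow> x \<noteq> 0 \<Longrightarrow> 1 \<le> norm (stretch J \<mu> x)) \<Longrightarrow>
       (\<And>x. x \<in> int_span B \<Longrightarrow> norm (stretch J \<mu> x) \<le> \<rho> \<Longrightarrow> P x) \<Longrightarrow>
       (\<And>x y. x \<in> int_span B \<Longrightarrow> y \<in> int_span B \<Longrightarrow> P x \<Longrightarrow> P y \<Longrightarrow> P (x + y)) \<Longrightarrow> x \<in> int_span B \<Longrightarrow> P x"
proof -
  obtain \<rho> where \<rho>: "\<rho> \<ge> 0" and sp: "\<And>J \<mu>. unimodular_stretch J \<mu> \<Longrightarrow>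
      (\<And>x. x \<in> int_span B \<Longrightarrow> x \<noteq> 0 \<Longrightarrow> 1 \<le> norm (stretch J \<mu> x)) \<Longrightarrow>
       span {x \<in> int_span B. norm (stretch J \<mu> x) \<le> \<rho>} = UNIV"
    using short_vectors_span[OF B] by metis
  define \<sigma> where "\<sigma> = DIM('a) * \<rho>"
  have \<sigma>: "\<sigma> \<ge> 0" using \<rho> by (simp add: \<sigma>_def)
  define M where "M = nat \<lceil>(2 * \<sigma> * real (DIM('a) + 1) + 2) ^ DIM('a)\<rceil>"
  show thesis
  proof (rule that[OF \<sigma>, of M])
    fix J :: "'a set" and \<mu>
    assume J: "unimodular_stretch J \<mu>" and min: "\<And>x. x \<in> int_span B \<Longrightarrow> x \<noteq> 0 \<Longrightarrow> 1 \<le> norm (stretch J \<mu> x)"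
    let ?S = "{x \<in> int_span B. norm (stretch J \<mu> x) \<le> \<sigma>}"
    have sep: "1 \<le> norm (stretch J \<mu> (x - y))" if "x \<in> ?S" "y \<in> ?S" "x \<noteq> y" for x y
      using that by (intro min int_span_diff) auto
    have "finite ?S" "real (card ?S) \<le> (2 * \<sigma> * real (DIM('a) + 1) + 2) ^ dim (UNIV :: 'a set)"
      by (rule few_separated_vectors[OF linear_stretch[of J \<mu>] subspace_UNIV _ \<sigma> _ sep]; auto)+
    thus "finite ?S \<and> card ?S \<le> M" unfolding M_def by (simp add: nat_ceiling_le_eq le_nat_iff) linarith
    have spn: "span {x \<in> int_span B. norm (stretch J \<mu> x) \<le> \<rho>} = UNIV" by (rule sp[OF J min])
    fix P x
    assume P: "\<And>x. x \<in> int_span B \<Longrightarrow> norm (stretch J \<mu> x) \<le> \<sigma> \<Longrightarrow> P x"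
      "\<And>x y. x \<in> int_span B \<Longrightarrow> y \<in> int_span B \<Longrightarrow> P x \<Longrightarrow> P y \<Longrightarrow> P (x + y)" "x \<in> int_span B"
    show "P x"
      by (rule short_vectors_generate[OF linear_stretch[of J \<mu>] min \<rho> spn]) (use P in \<open>auto simp: \<sigma>_def\<close>)
  qed
qed

section \<open>The lattice of a quadratic form over the ring of integers of a real quadratic field\<close>

text \<open>
  The elements of \<open>\<int>[sqrt 2]\<close>, paired with their conjugates.
\<close>

definition quad_int :: "(real \<times> real) set" where
  "quad_int = {(of_int p + of_int q * sqrt 2, of_int p - of_int q * sqrt 2) |p q. True}"

lemma quad_intI: "\<alpha> = of_int p + of_int q * sqrt 2 \<Longrightarrow> \<beta> = of_int p - of_int q * sqrt 2 \<Longrightarrow> (\<alpha>, \<beta>) \<in> quad_int"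
  unfolding quad_int_def by blast

lemma quad_int_add: assumes "x \<in> quad_int" "y \<in> quad_int" shows "x + y \<in> quad_int"
proof -
  obtain p q p' q' :: int where "x = (of_int p + of_int q * sqrt 2, of_int p - of_int q * sqrt 2)"
    "y = (of_int p' + of_int q' * sqrt 2, of_int p' - of_int q' * sqrt 2)"
    using assms unfolding quad_int_def by blast
  thus ?thesis by (simp add: quad_intI[of _ "p + p'" "q + q'"] algebra_simps)
qed

lemma quad_int_scale: assumes "x \<in> quad_int" shows "of_int n *\<^sub>R x \<in> quad_int"
proof -
  obtain p q :: int where "x = (of_int p + of_int q * sqrt 2, of_int p - of_int q * sqrt 2)"
    using assms unfolding quad_int_def by blast
  thus ?thesis by (simp add: quad_intI[of _ "n * p" "n * q"] algebra_simps)
qed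

lemma quad_int_0: "(0, 0) \<in> quad_int" by (rule quad_intI[of _ 0 0]) auto

lemma quad_int_sqrt2: assumes "(\<alpha>, \<beta>) \<in> quad_int" shows "(sqrt 2 * \<alpha>, - (sqrt 2 * \<beta>)) \<in> quad_int"
proof -
  obtain p q :: int where pq: "\<alpha> = of_int p + of_int q * sqrt 2" "\<beta> = of_int p - of_int q * sqrt 2"
    using assms unfolding quad_int_def by blast
  show ?thesis by (intro quad_intI[of _ "2 * q" p]) (simp_all add: pq algebra_simps)
qed

lemma square_eq_twice_square:
  fixes p q :: nat assumes "p * p = 2 * (q * q)" shows "q = 0"
  using assms
proof (induction p arbitrary: q rule: less_induct)
  case (less p)
  have "even (p * p)" using less.prems by simp
  then obtain r where r: "p = 2 * r" by auto
  hence q2: "q * q = 2 * (r * r)" using less.prems by simp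
  hence "even (q * q)" by simp
  then obtain s where s: "q = 2 * s" by auto
  hence "r * r = 2 * (s * s)" using q2 by simp
  thus ?case using less.IH[of r s] r s by (cases "p = 0") (use less.prems in auto)
qed

text \<open>The product of a nonzero element with its conjugate is a nonzero integer.\<close>

lemma quad_int_small:
  assumes x: "(\<alpha>, \<beta>) \<in> quad_int" and small: "\<bar>\<alpha> * \<beta>\<bar> < 1" shows "\<alpha> = 0" "\<beta> = 0"
proof -
  obtain p q :: int where pq: "\<alpha> = of_int p + of_int q * sqrt 2" "\<beta> = of_int p - of_int q * sqrt 2"
    using x unfolding quad_int_def by blast
  have "\<alpha> * \<beta> = of_int (p * p - 2 * (q * q))" by (simp add: pq algebra_simps)
  hence "\<bar>real_of_int (p * p - 2 * (q * q))\<bar> < 1" using small by simp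
  hence "p * p - 2 * (q * q) = 0" by linarith
  hence eq: "p * p = 2 * (q * q)" by simp
  hence "nat \<bar>p\<bar> * nat \<bar>p\<bar> = 2 * (nat \<bar>q\<bar> * nat \<bar>q\<bar>)"
    by (simp add: nat_mult_distrib[symmetric] abs_mult[symmetric])
  hence "q = 0" using square_eq_twice_square by force
  with eq pq show "\<alpha> = 0" "\<beta> = 0" by auto
qed

lemma finite_quad_int: "finite {x \<in> quad_int. \<bar>fst x\<bar> \<le> b \<and> \<bar>snd x\<bar> \<le> b}"
proof (rule finite_subset)
  let ?f = "\<lambda>(p, q). (real_of_int p + of_int q * sqrt 2, real_of_int p - of_int q * sqrt 2)"
  show "finite (?f ` ({- \<lceil>b\<rceil>..\<lceil>b\<rceil>} \<times> {- \<lceil>b\<rceil>..\<lceil>b\<rceil>}))" by simp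
  show "{x \<in> quad_int. \<bar>fst x\<bar> \<le> b \<and> \<bar>snd x\<bar> \<le> b} \<subseteq> ?f ` ({- \<lceil>b\<rceil>..\<lceil>b\<rceil>} \<times> {- \<lceil>b\<rceil>..\<lceil>b\<rceil>})"
  proof
    fix x assume x: "x \<in> {x \<in> quad_int. \<bar>fst x\<bar> \<le> b \<and> \<bar>snd x\<bar> \<le> b}"
    then obtain p q :: int where pq: "x = (of_int p + of_int q * sqrt 2, of_int p - of_int q * sqrt 2)"
      unfolding quad_int_def by blast
    have b: "\<bar>of_int p + of_int q * sqrt 2\<bar> \<le> b" "\<bar>of_int p - of_int q * sqrt 2\<bar> \<le> b" using x pq by auto
    hence "\<bar>real_of_int p\<bar> \<le> b" by linarith
    moreover have "\<bar>of_int q * sqrt 2\<bar> \<le> b" using b by linarith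
    moreover have "\<bar>real_of_int q\<bar> * 1 \<le> \<bar>real_of_int q\<bar> * sqrt 2" by (intro mult_left_mono) auto
    ultimately have "\<bar>real_of_int p\<bar> \<le> b" "\<bar>real_of_int q\<bar> \<le> b" by (simp_all add: abs_mult)
    hence "p \<in> {- \<lceil>b\<rceil>..\<lceil>b\<rceil>}" "q \<in> {- \<lceil>b\<rceil>..\<lceil>b\<rceil>}" by (simp_all, linarith+)
    thus "x \<in> ?f ` ({- \<lceil>b\<rceil>..\<lceil>b\<rceil>} \<times> {- \<lceil>b\<rceil>..\<lceil>b\<rceil>})" using pq by (intro image_eqI[of _ _ "(p, q)"]) auto
  qed
qed

text \<open>
  The quadratic form is \<open>x\<^sub>1\<^sup>2 + \<dots> + x\<^sub>n\<^sup>2 - sqrt 2 * x\<^sub>0\<^sup>2\<close> over \<open>\<int>[sqrt 2]\<close>, whose conjugate is positive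
  definite. Scaling the last coordinate by the fourth root of two turns the form into the
  Minkowski form, and its conjugate into the Euclidean inner product. A lattice vector is
  represented by its two scaled conjugates.
\<close>

definition rescale :: "'n::finite spacetime \<Rightarrow> 'n spacetime" where
  "rescale x = (fst x, sqrt (sqrt 2) * snd x)"

definition gens :: "('n::finite spacetime \<times> 'n spacetime) set" where
  "gens = (\<lambda>e. (rescale e, rescale e)) ` Basis \<union>
     (\<lambda>e. (sqrt 2 *\<^sub>R rescale e, - (sqrt 2 *\<^sub>R rescale e))) ` Basis"

definition lat :: "('n::finite spacetime \<times> 'n spacetime) set" where
  "lat = int_span gens"

definition pairing where
  "pairing l l' = (fst l \<bullet>\<^sub>M fst l', snd l \<bullet> snd l')"

lemma fourth_root: "(sqrt (sqrt 2) * a) * (sqrt (sqrt 2) * b) = sqrt 2 * (a * b)"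
proof -
  have "(sqrt (sqrt 2) * a) * (sqrt (sqrt 2) * b) = (sqrt (sqrt 2) * sqrt (sqrt 2)) * (a * b)"
    by (simp only: mult_ac)
  thus ?thesis by simp
qed

lemma linear_rescale: "linear rescale"
  by (rule linearI) (auto simp: rescale_def algebra_simps)

lemma rescale_inj: "rescale x = rescale y \<longleftrightarrow> x = y"
  by (auto simp: rescale_def prod_eq_iff)

lemma rescale_surj: "\<exists>y. x = rescale y"
  by (rule exI[of _ "(fst x, snd x / sqrt (sqrt 2))"]) (simp add: rescale_def prod_eq_iff)

lemma rescale_minkowski: "rescale x \<bullet>\<^sub>M rescale y = fst x \<bullet> fst y - sqrt 2 * (snd x * snd y)"
  by (simp only: rescale_def minkowski_def fst_conv snd_conv fourth_root)

lemma rescale_inner: "rescale x \<bullet> rescale y = fst x \<bullet> fst y + sqrt 2 * (snd x * snd y)"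
  by (simp only: rescale_def inner_prod_def fst_conv snd_conv inner_real_def fourth_root)

lemma rescale_Basis:
  assumes "e \<in> Basis" "e' \<in> Basis"
  shows "(rescale e \<bullet>\<^sub>M rescale e', rescale e \<bullet> rescale e') \<in> quad_int"
    "e \<noteq> e' \<Longrightarrow> rescale e \<bullet> rescale e' = 0"
proof -
  have 1: "(1, 1) \<in> quad_int" "(- sqrt 2, sqrt 2) \<in> quad_int"
    by (rule quad_intI[of _ 1 0], auto) (rule quad_intI[of _ 0 "-1"], auto)
  show "(rescale e \<bullet>\<^sub>M rescale e', rescale e \<bullet> rescale e') \<in> quad_int"
    "e \<noteq> e' \<Longrightarrow> rescale e \<bullet> rescale e' = 0"
    using assms 1 quad_int_0
    by (auto simp: Basis_prod_def rescale_minkowski rescale_inner inner_Basis split: if_splits)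
qed

lemma gens_independent: "independent (gens :: ('n::finite spacetime \<times> _) set)"
  and gens_card: "card (gens :: ('n spacetime \<times> _) set) = DIM('n spacetime \<times> 'n spacetime)"
proof -
  let ?A = "(\<lambda>e :: 'n spacetime. (rescale e, rescale e)) ` Basis"
  let ?B = "(\<lambda>e :: 'n spacetime. (sqrt 2 *\<^sub>R rescale e, - (sqrt 2 *\<^sub>R rescale e))) ` Basis"
  have nz: "rescale e \<noteq> 0" if "e \<in> Basis" for e :: "'n spacetime"
  proof -
    have "rescale 0 = (0 :: 'n spacetime)" by (rule linear_0[OF linear_rescale])
    thus ?thesis using rescale_inj[of e 0] nonzero_Basis[OF that] by metis
  qed
  have "pairwise orthogonal (gens :: ('n spacetime \<times> _) set)"
    unfolding pairwise_def orthogonal_def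
  proof (intro ballI impI)
    fix i j :: "'n spacetime \<times> 'n spacetime"
    assume ij: "i \<in> gens" "j \<in> gens" "i \<noteq> j"
    obtain e where e: "e \<in> Basis" "i = (rescale e, rescale e) \<or> i = (sqrt 2 *\<^sub>R rescale e, - (sqrt 2 *\<^sub>R rescale e))"
      using ij(1) unfolding gens_def by blast
    obtain e' where e': "e' \<in> Basis" "j = (rescale e', rescale e') \<or> j = (sqrt 2 *\<^sub>R rescale e', - (sqrt 2 *\<^sub>R rescale e'))"
      using ij(2) unfolding gens_def by blast
    show "i \<bullet> j = 0"
    proof (cases "e = e'")
      case True
      thus ?thesis using e(2) e'(2) ij(3) by (elim disjE) (simp_all add: inner_Pair)
    next
      case False
      thus ?thesis using e(2) e'(2) rescale_Basis(2)[OF e(1) e'(1)] by (elim disjE) (simp_all add: inner_Pair)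
    qed
  qed
  moreover have "0 \<notin> (gens :: ('n spacetime \<times> _) set)"
  proof
    assume "0 \<in> (gens :: ('n spacetime \<times> _) set)"
    then obtain e :: "'n spacetime" where e: "e \<in> Basis"
      "0 = (rescale e, rescale e) \<or> 0 = (sqrt 2 *\<^sub>R rescale e, - (sqrt 2 *\<^sub>R rescale e))"
      unfolding gens_def by blast
    from e(2) have "0 = rescale e \<or> 0 = sqrt 2 *\<^sub>R rescale e" by (metis fst_conv fst_zero)
    thus False using nz[OF e(1)] by simp
  qed
  ultimately show "independent (gens :: ('n spacetime \<times> _) set)"
    by (rule pairwise_orthogonal_independent)
  have "card ?A = DIM('n spacetime)"
    by (rule card_image) (auto simp: inj_on_def rescale_inj)
  moreover have "card ?B = DIM('n spacetime)"
    by (rule card_image) (auto simp: inj_on_def rescale_inj)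
  moreover have "?A \<inter> ?B = {}"
  proof -
    have False if e: "e \<in> Basis" "e' \<in> Basis" "(rescale e, rescale e) = (sqrt 2 *\<^sub>R rescale e', - (sqrt 2 *\<^sub>R rescale e'))"
      for e e' :: "'n spacetime"
    proof -
      have "sqrt 2 *\<^sub>R rescale e' = - (sqrt 2 *\<^sub>R rescale e')" using e(3) by (metis prod.inject)
      hence "2 *\<^sub>R (sqrt 2 *\<^sub>R rescale e') = 0" unfolding scaleR_2 by (simp only: eq_neg_iff_add_eq_0)
      hence "rescale e' = 0" by simp
      thus False using nz e by blast
    qed
    thus ?thesis by blast
  qed
  ultimately show "card (gens :: ('n spacetime \<times> _) set) = DIM('n spacetime \<times> 'n spacetime)"
    unfolding gens_def by (subst card_Un_disjoint) auto
qed

lemma gens_finite: "finite gens"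
  by (simp add: gens_def)

lemma gens_subset_lat: "b \<in> gens \<Longrightarrow> b \<in> lat"
  unfolding lat_def int_span_def
  by (rule range_eqI[of _ _ "\<lambda>x. if x = b then 1 else 0"])
    (simp add: gens_finite if_distrib[of "\<lambda>k. of_int k *\<^sub>R _"] cong: if_cong)

lemma lat_diff: "l \<in> lat \<Longrightarrow> l' \<in> lat \<Longrightarrow> l - l' \<in> lat"
  and lat_add: "l \<in> lat \<Longrightarrow> l' \<in> lat \<Longrightarrow> l + l' \<in> lat"
  and lat_0: "0 \<in> lat"
  and lat_scale: "l \<in> lat \<Longrightarrow> of_int k *\<^sub>R l \<in> lat"
  by (simp_all add: lat_def int_span_diff int_span_add int_span_0 int_span_scale)

lemma int_span_hom:
  assumes x: "x \<in> int_span S" and \<phi>: "linear \<phi>" and S: "\<And>b. b \<in> S \<Longrightarrow> \<phi> b \<in> G"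
    and G: "0 \<in> G" "\<And>g h. g \<in> G \<Longrightarrow> h \<in> G \<Longrightarrow> g + h \<in> G" "\<And>n g. g \<in> G \<Longrightarrow> of_int n *\<^sub>R g \<in> G"
  shows "\<phi> x \<in> G"
proof -
  obtain k where "x = (\<Sum>b\<in>S. of_int (k b) *\<^sub>R b)" using x by (auto simp: int_span_def)
  hence "\<phi> x = (\<Sum>b\<in>S. of_int (k b) *\<^sub>R \<phi> b)" by (simp add: linear_sum[OF \<phi>] linear_cmul[OF \<phi>])
  also have "\<dots> \<in> G" using S by (induction S rule: infinite_finite_induct) (auto intro: G)
  finally show ?thesis .
qed

lemma linear_pairing: "linear (\<lambda>l. pairing l l')" "linear (pairing l)"
  by (rule linearI; simp add: pairing_def minkowski_simps inner_add_left inner_add_right)+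

lemma pairing_lat:
  assumes "l \<in> lat" "l' \<in> lat" shows "pairing l l' \<in> quad_int"
proof -
  note closed = quad_int_0[folded zero_prod_def] quad_int_add quad_int_scale
  have base: "pairing b b' \<in> quad_int" if "b \<in> gens" "b' \<in> gens" for b b' :: "'n::finite spacetime \<times> _"
  proof -
    show ?thesis using that rescale_Basis(1) quad_int_sqrt2[OF rescale_Basis(1)] quad_int_sqrt2[OF quad_int_sqrt2[OF rescale_Basis(1)]]
      by (auto simp: gens_def pairing_def minkowski_simps)
  qed
  have "pairing b l' \<in> quad_int" if "b \<in> gens" for b
    by (rule int_span_hom[OF assms(2)[unfolded lat_def] linear_pairing(2) base[OF that] closed])
  thus ?thesis
    by (rule int_span_hom[OF assms(1)[unfolded lat_def] linear_pairing(1) _ closed])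
qed

lemma rescale_Basis_spans:
  assumes "subspace W" "\<And>e. e \<in> Basis \<Longrightarrow> rescale e \<in> W"
  shows "W = (UNIV :: 'n::finite spacetime set)"
proof -
  have "rescale x \<in> W" for x
    using linear_sum[OF linear_rescale, of "\<lambda>e. (x \<bullet> e) *\<^sub>R e" Basis] assms
    by (simp add: euclidean_representation linear_cmul[OF linear_rescale] subspace_sum subspace_scale)
  thus ?thesis using rescale_surj by (metis UNIV_eq_I)
qed

lemma lat_spans:
  assumes "subspace W"
  shows "(\<And>l. l \<in> lat \<Longrightarrow> fst l \<in> W) \<Longrightarrow> W = (UNIV :: 'n::finite spacetime set)"
    "(\<And>l. l \<in> lat \<Longrightarrow> snd l \<in> W) \<Longrightarrow> W = (UNIV :: 'n::finite spacetime set)"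
proof -
  have mem: "(rescale e, rescale e) \<in> lat" if "e \<in> Basis" for e :: "'n spacetime"
    by (rule gens_subset_lat) (use that in \<open>simp add: gens_def\<close>)
  show "W = UNIV" if W: "\<And>l. l \<in> lat \<Longrightarrow> fst l \<in> W"
    using W[OF mem] by (intro rescale_Basis_spans[OF assms]) simp
  show "W = UNIV" if W: "\<And>l. l \<in> lat \<Longrightarrow> snd l \<in> W"
    using W[OF mem] by (intro rescale_Basis_spans[OF assms]) simp
qed

text \<open>
  Conjugation is injective: if the conjugate of a lattice vector vanishes, so do the conjugates of
  its pairings with the lattice, and then these pairings themselves.
\<close>

lemma lat_snd_zero:
  assumes "l \<in> lat" "snd l = 0" shows "l = 0"
proof -
  have "fst l \<bullet>\<^sub>M fst l' = 0" if "l' \<in> lat" for l'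
    by (rule quad_int_small(1)[of _ "snd l \<bullet> snd l'"])
      (use pairing_lat[OF assms(1) that] assms(2) in \<open>auto simp: pairing_def\<close>)
  moreover have "subspace {y. fst l \<bullet>\<^sub>M y = 0}" by (auto simp: subspace_def minkowski_simps)
  ultimately have "{y. fst l \<bullet>\<^sub>M y = 0} = UNIV" by (intro lat_spans(1)) auto
  hence "fst l = 0" using minkowski_nondegenerate[of "fst l"] by blast
  thus ?thesis using assms(2) by (simp add: prod_eq_iff)
qed

section \<open>The positive forms belonging to points of hyperbolic space\<close>

text \<open>
  The form with the sign of the timelike direction \<open>p\<close> reversed, which is positive definite.
\<close>

definition majorant where
  "majorant p X = X \<bullet>\<^sub>M X + 2 * (X \<bullet>\<^sub>M p)\<^sup>2"

lemma majorant_bounds: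
  assumes "p \<in> hyperboloid"
  shows "\<bar>X \<bullet>\<^sub>M X\<bar> \<le> majorant p X" "(X \<bullet>\<^sub>M p)\<^sup>2 \<le> majorant p X" "0 \<le> majorant p X"
proof -
  have "0 \<le> X \<bullet>\<^sub>M X + (X \<bullet>\<^sub>M p)\<^sup>2" using reverse_Cauchy_Schwarz[OF assms, of X] by simp
  thus "\<bar>X \<bullet>\<^sub>M X\<bar> \<le> majorant p X" "(X \<bullet>\<^sub>M p)\<^sup>2 \<le> majorant p X" "0 \<le> majorant p X"
    using zero_le_power2[of "X \<bullet>\<^sub>M p"] unfolding majorant_def by linarith+
qed

text \<open>
  The majorants of two points are comparable, with a constant that depends only on the distance of
  the points.
\<close>

lemma majorant_compare:
  assumes p: "p \<in> hyperboloid" and q: "q \<in> hyperboloid" and K: "- (q \<bullet>\<^sub>M p) \<le> K"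
  shows "(X \<bullet>\<^sub>M q)\<^sup>2 \<le> 2 * K\<^sup>2 * majorant p X"
proof -
  define s a where "s = X \<bullet>\<^sub>M p" and "a = q \<bullet>\<^sub>M p"
  have a1: "a \<le> -1" using hyperboloid_minkowski_le[OF q p] by (simp add: a_def)
  have a2: "a\<^sup>2 \<le> K\<^sup>2" using K a1 by (metis a_def abs_le_square_iff abs_of_nonpos abs_of_nonneg order_trans le_minus_iff minus_le_iff neg_0_le_iff_le linorder_le_cases zero_le_one)
  have uu0: "0 \<le> X \<bullet>\<^sub>M X + s\<^sup>2" using reverse_Cauchy_Schwarz[OF p, of X] by (simp add: s_def)
  have 1: "(X \<bullet>\<^sub>M q + s * a)\<^sup>2 \<le> (X \<bullet>\<^sub>M X + s\<^sup>2) * (a\<^sup>2 - 1)"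
    using projected_Cauchy_Schwarz[OF p, of X q] by (simp add: hyperboloid_self[OF q] s_def a_def)
  have "(X \<bullet>\<^sub>M X + s\<^sup>2) * (a\<^sup>2 - 1) \<le> (X \<bullet>\<^sub>M X + s\<^sup>2) * K\<^sup>2" using uu0 a2 by (intro mult_left_mono) auto
  hence "(X \<bullet>\<^sub>M q + s * a)\<^sup>2 \<le> (X \<bullet>\<^sub>M X + s\<^sup>2) * K\<^sup>2" using 1 by linarith
  moreover have "(s * a)\<^sup>2 \<le> s\<^sup>2 * K\<^sup>2" using a2 by (simp add: power_mult_distrib mult_left_mono)
  moreover have "(X \<bullet>\<^sub>M q)\<^sup>2 \<le> 2 * (X \<bullet>\<^sub>M q + s * a)\<^sup>2 + 2 * (s * a)\<^sup>2"
    using zero_le_power2[of "X \<bullet>\<^sub>M q + 2 * (s * a)"] by (simp add: power2_eq_square algebra_simps)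
  ultimately have "(X \<bullet>\<^sub>M q)\<^sup>2 \<le> 2 * ((X \<bullet>\<^sub>M X + s\<^sup>2) * K\<^sup>2) + 2 * (s\<^sup>2 * K\<^sup>2)" by linarith
  thus ?thesis by (simp add: majorant_def s_def algebra_simps)
qed

lemma hyperboloid_polar:
  fixes p :: "'n::finite spacetime"
  assumes p: "p \<in> hyperboloid"
  obtains u t where "norm u = 1" "p = (sinh t *\<^sub>R u, cosh t)"
proof -
  obtain u0 :: "real ^ 'n" where u0: "norm u0 = 1" using vector_choose_size[of 1] by auto
  define u where "u = (if fst p = 0 then u0 else (1 / norm (fst p)) *\<^sub>R fst p)"
  have "norm u = 1" using u0 by (auto simp: u_def)
  moreover have "fst p = norm (fst p) *\<^sub>R u" by (auto simp: u_def)
  moreover have "snd p = cosh (arsinh (norm (fst p)))"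
  proof -
    have "(snd p)\<^sup>2 = 1 + (norm (fst p))\<^sup>2" "snd p > 0"
      using p by (auto simp: hyperboloid_def minkowski_def power2_norm_eq_inner power2_eq_square[of "snd p"])
    hence "snd p = sqrt (1 + (norm (fst p))\<^sup>2)" by (metis real_sqrt_unique less_imp_le)
    thus ?thesis by (simp add: cosh_arsinh_real add.commute)
  qed
  ultimately show thesis using that[of u "arsinh (norm (fst p))"] by (simp add: prod_eq_iff)
qed

text \<open>
  A boost has determinant one: it scales the two lightlike directions of its plane by inverse
  factors and fixes the orthogonal complement of the plane.
\<close>

lemma majorant_stretch:
  fixes p :: "'n::finite spacetime"
  assumes p: "p \<in> hyperboloid"
  shows "\<exists>J \<mu>. unimodular_stretch J \<mu> \<and>
    (\<forall>X Y :: 'n spacetime. (norm (stretch J \<mu> (X, Y)))\<^sup>2 = majorant p X + (norm Y)\<^sup>2)"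
proof -
  obtain u t where u: "norm u = 1" and put: "p = (sinh t *\<^sub>R u, cosh t)" using hyperboloid_polar[OF p] .
  have "u \<noteq> 0" using u by auto
  obtain S :: "(real ^ 'n) set" where S: "u \<in> S" "pairwise orthogonal S" "\<And>x. x \<in> S \<Longrightarrow> norm x = 1"
    "independent S" "card S = CARD('n)" "span S = UNIV"
    using vector_in_orthonormal_basis[OF u] by (metis DIM_cart DIM_real mult.right_neutral)
  have finS: "finite S" using S(4) independent_imp_finite by blast
  \<comment> \<open>the two lightlike eigenvectors of the boost towards \<open>p\<close>\<close>
  define a b :: "'n spacetime \<times> 'n spacetime"
    where "a = ((1 / sqrt 2) *\<^sub>R (u, 1), 0)" and "b = ((1 / sqrt 2) *\<^sub>R (u, -1), 0)"
  define JS where "JS = (\<lambda>w. ((w, 0 :: real), 0 :: 'n spacetime)) ` (S - {u})"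
  define JY where "JY = (\<lambda>e. (0 :: 'n spacetime, e :: 'n spacetime)) ` Basis"
  define J where "J = insert a (insert b (JS \<union> JY))"
  define \<mu> where "\<mu> j = (if j = a then exp (- t) else if j = b then exp t else 1)" for j
  have finJ: "finite JS" "finite JY" using finS by (simp_all add: JS_def JY_def)
  have uu: "u \<bullet> u = 1" using u by (simp add: norm_eq_1)
  have Su: "w \<bullet> u = 0" "u \<bullet> w = 0" if "w \<in> S - {u}" for w
    using S(1,2) that by (auto simp: pairwise_def orthogonal_def)
  have ab: "a \<noteq> b" by (auto simp: a_def b_def)
  have naJ: "a \<notin> JS \<union> JY" "b \<notin> JS \<union> JY" by (auto simp: a_def b_def JS_def JY_def zero_prod_def)
  have disj: "JS \<inter> JY = {}" by (auto simp: JS_def JY_def dest: nonzero_Basis)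
  have norms: "norm j = 1" if "j \<in> J" for j
  proof -
    have "norm a = 1" "norm b = 1" by (simp_all add: norm_eq_1 a_def b_def inner_Pair uu)
    moreover have "norm j = 1" if "j \<in> JS" for j using that S(3) unfolding JS_def by (elim imageE) (simp add: norm_Pair)
    moreover have "norm j = 1" if "j \<in> JY" for j using that unfolding JY_def by (elim imageE) (simp add: norm_Pair)
    ultimately show ?thesis using that unfolding J_def by blast
  qed
  have orth: "pairwise orthogonal J"
  proof -
    have "a \<bullet> b = 0" "b \<bullet> a = 0" by (simp_all add: a_def b_def inner_Pair uu)
    moreover have "a \<bullet> j = 0" "j \<bullet> a = 0" "b \<bullet> j = 0" "j \<bullet> b = 0" if "j \<in> JS" for j
      using that Su unfolding JS_def a_def b_def by (elim imageE; simp add: inner_Pair)+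
    moreover have "a \<bullet> j = 0" "j \<bullet> a = 0" "b \<bullet> j = 0" "j \<bullet> b = 0" if "j \<in> JY" for j
      using that unfolding JY_def a_def b_def by (elim imageE; simp add: inner_Pair)+
    moreover have "i \<bullet> j = 0" "j \<bullet> i = 0" if "i \<in> JS" "j \<in> JY" for i j
      using that unfolding JS_def JY_def by (elim imageE; simp add: inner_Pair)+
    moreover have "i \<bullet> j = 0" if ij: "i \<in> JS" "j \<in> JS" "i \<noteq> j" for i j
    proof -
      obtain w w' where w: "w \<in> S" "w' \<in> S" "i = ((w, 0), 0)" "j = ((w', 0), 0)"
        using ij(1,2) unfolding JS_def by blast
      hence "w \<noteq> w'" using ij(3) by blast
      thus ?thesis using w S(2) by (simp add: inner_Pair pairwise_def orthogonal_def)
    qed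
    moreover have "i \<bullet> j = 0" if ij: "i \<in> JY" "j \<in> JY" "i \<noteq> j" for i j
    proof -
      obtain e e' where e: "e \<in> Basis" "e' \<in> Basis" "i = (0, e)" "j = (0, e')"
        using ij(1,2) unfolding JY_def by blast
      hence "e \<noteq> e'" using ij(3) by blast
      thus ?thesis using e by (simp add: inner_Pair inner_Basis)
    qed
    ultimately have "i \<bullet> j = 0" if "i \<in> J" "j \<in> J" "i \<noteq> j" for i j
      using that unfolding J_def insert_iff Un_iff by (elim disjE) simp_all
    thus ?thesis by (auto simp: pairwise_def orthogonal_def)
  qed
  have "0 \<notin> J" using norms[of 0] by auto
  hence "independent J" using orth by (intro pairwise_orthogonal_independent)
  moreover have "card J = DIM('n spacetime \<times> 'n spacetime)"
  proof -
    have "card JS = CARD('n) - 1" unfolding JS_def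
      by (subst card_image) (use finS S(1,5) in \<open>auto simp: inj_on_def\<close>)
    moreover have "card JY = CARD('n) + 1" unfolding JY_def
      by (subst card_image) (auto simp: inj_on_def)
    moreover have "CARD('n) > 0" by simp
    ultimately show ?thesis
      using ab naJ disj finJ by (simp add: J_def card_Un_disjoint)
  qed
  ultimately have span: "span J = UNIV"
    by (metis card_ge_dim_independent dim_UNIV order_refl subset_UNIV top.extremum_uniqueI)
  have "prod \<mu> (JS \<union> JY) = 1" using naJ by (intro prod.neutral) (auto simp: \<mu>_def)
  hence "prod \<mu> J = 1"
    using ab naJ finJ by (simp add: J_def \<mu>_def exp_minus)
  hence us: "unimodular_stretch J \<mu>"
    unfolding unimodular_stretch_def using orth norms span by (auto simp: \<mu>_def)
  have "(norm (stretch J \<mu> (X, Y)))\<^sup>2 = majorant p X + (norm Y)\<^sup>2" for X Y :: "'n spacetime"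
  proof -
    obtain x s where X: "X = (x, s)" by (cases X)
    define y where "y = x \<bullet> u"
    let ?g = "\<lambda>j. (\<mu> j * ((X, Y) \<bullet> j))\<^sup>2"
    have "(norm x)\<^sup>2 = (\<Sum>w\<in>S. (x \<bullet> w)\<^sup>2)"
      by (rule orthonormal_expansion(2)[OF finS S(2,3)]) (simp_all add: S(6))
    hence xx: "x \<bullet> x = y\<^sup>2 + (\<Sum>w\<in>S - {u}. (x \<bullet> w)\<^sup>2)"
      using finS S(1) by (simp add: power2_norm_eq_inner y_def sum.remove)
    have "sum ?g JS = (\<Sum>w\<in>S - {u}. (x \<bullet> w)\<^sup>2)"
      unfolding JS_def
    proof (subst sum.reindex)
      show "(\<Sum>w\<in>S - {u}. (?g \<circ> (\<lambda>w. ((w, 0), 0))) w) = (\<Sum>w\<in>S - {u}. (x \<bullet> w)\<^sup>2)"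
      proof (rule sum.cong[OF refl])
        fix w assume "w \<in> S - {u}"
        hence "((w, 0), 0) \<in> JS" by (auto simp: JS_def)
        hence "\<mu> ((w, 0), 0) = 1" using naJ by (auto simp: \<mu>_def)
        thus "(?g \<circ> (\<lambda>w. ((w, 0), 0))) w = (x \<bullet> w)\<^sup>2" by (simp add: X inner_Pair)
      qed
    qed (auto simp: inj_on_def)
    moreover have "sum ?g JY = (norm Y)\<^sup>2"
      unfolding JY_def
    proof (subst sum.reindex)
      have "(\<Sum>e\<in>Basis. (?g \<circ> Pair 0) e) = (\<Sum>e\<in>Basis. (Y \<bullet> e)\<^sup>2)"
      proof (rule sum.cong[OF refl])
        fix e :: "'n spacetime" assume "e \<in> Basis"
        hence "(0, e) \<in> JY" by (auto simp: JY_def)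
        hence "\<mu> (0, e) = 1" using naJ by (auto simp: \<mu>_def)
        thus "(?g \<circ> Pair 0) e = (Y \<bullet> e)\<^sup>2" by (simp add: X inner_Pair)
      qed
      also have "\<dots> = (norm Y)\<^sup>2"
        by (subst orthonormal_expansion(2)[of Basis Y]) (auto simp: pairwise_def orthogonal_def inner_Basis)
      finally show "(\<Sum>e\<in>Basis. (?g \<circ> Pair 0) e) = (norm Y)\<^sup>2" .
    qed (auto simp: inj_on_def)
    moreover have "(norm (stretch J \<mu> (X, Y)))\<^sup>2 = ?g a + (?g b + (sum ?g JS + sum ?g JY))"
      unfolding norm_stretch[OF us] using ab naJ finJ disj by (simp add: J_def sum.union_disjoint)
    moreover have "?g a = (exp (- t))\<^sup>2 * (y + s)\<^sup>2 / 2"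
      by (simp add: \<mu>_def a_def X inner_Pair y_def power_mult_distrib power_divide flip: add_divide_distrib)
    moreover have "?g b = (exp t)\<^sup>2 * (y - s)\<^sup>2 / 2"
      using ab by (simp add: \<mu>_def b_def X inner_Pair y_def power_mult_distrib power_divide flip: diff_divide_distrib)
    moreover have "majorant p X = x \<bullet> x - s * s + (exp (- t) * (y + s) - exp t * (y - s))\<^sup>2 / 2"
    proof -
      have Xp: "X \<bullet>\<^sub>M p = (exp t * (y - s) - exp (- t) * (y + s)) / 2"
        by (simp add: put X minkowski_def y_def sinh_field_def cosh_field_def field_simps)
      have "(X \<bullet>\<^sub>M p)\<^sup>2 = (exp (- t) * (y + s) - exp t * (y - s))\<^sup>2 / 4"
        unfolding Xp power_divide by (subst power2_commute) simp
      moreover have "X \<bullet>\<^sub>M X = x \<bullet> x - s * s" by (simp add: X minkowski_def)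
      ultimately show ?thesis by (simp add: majorant_def)
    qed
    moreover have "(exp (- t) * (y + s) - exp t * (y - s))\<^sup>2
      = (exp (- t))\<^sup>2 * (y + s)\<^sup>2 + (exp t)\<^sup>2 * (y - s)\<^sup>2 - 2 * (y\<^sup>2 - s * s)"
    proof -
      have "(exp (- t) * (y + s)) * (exp t * (y - s)) = (exp (- t) * exp t) * (y\<^sup>2 - s * s)"
        by (simp only: power2_eq_square algebra_simps)
      hence "(exp (- t) * (y + s)) * (exp t * (y - s)) = y\<^sup>2 - s * s" by (simp add: exp_minus)
      thus ?thesis by (simp add: power2_diff power_mult_distrib mult.assoc)
    qed
    ultimately show ?thesis using xx by (simp add: add_divide_distrib diff_divide_distrib)
  qed
  thus ?thesis using us by blast
qed

definition lnorm where
  "lnorm p l = sqrt (majorant p (fst l) + (norm (snd l))\<^sup>2)"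

lemma lnorm_stretch:
  fixes p :: "'n::finite spacetime"
  assumes p: "p \<in> hyperboloid"
  obtains J \<mu> where "unimodular_stretch J \<mu>"
    "\<And>l :: 'n spacetime \<times> 'n spacetime. norm (stretch J \<mu> l) = lnorm p l"
proof -
  obtain J \<mu> where J: "unimodular_stretch J \<mu>"
    "\<And>X Y :: 'n spacetime. (norm (stretch J \<mu> (X, Y)))\<^sup>2 = majorant p X + (norm Y)\<^sup>2"
    using majorant_stretch[OF p] by blast
  have "norm (stretch J \<mu> l) = lnorm p l" for l :: "'n spacetime \<times> 'n spacetime"
    using J(2)[of "fst l" "snd l"] unfolding lnorm_def by (metis norm_ge_zero prod.collapse real_sqrt_unique)
  thus thesis using that J(1) by blast
qed

lemma lnorm_square:
  assumes "p \<in> hyperboloid" shows "(lnorm p l)\<^sup>2 = majorant p (fst l) + (norm (snd l))\<^sup>2" "lnorm p l \<ge> 0"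
  using majorant_bounds(3)[OF assms] by (simp_all add: lnorm_def)

lemma lnorm_diff:
  fixes p :: "'n::finite spacetime" and l l' :: "'n spacetime \<times> 'n spacetime"
  assumes "p \<in> hyperboloid" shows "lnorm p (l - l') \<le> lnorm p l + lnorm p l'" "lnorm p (k *\<^sub>R l) = \<bar>k\<bar> * lnorm p l"
proof -
  obtain J \<mu> where J: "\<And>l :: 'n spacetime \<times> 'n spacetime. norm (stretch J \<mu> l) = lnorm p l"
    using lnorm_stretch[OF assms] by blast
  show "lnorm p (l - l') \<le> lnorm p l + lnorm p l'" "lnorm p (k *\<^sub>R l) = \<bar>k\<bar> * lnorm p l"
    using norm_triangle_ineq4[of "stretch J \<mu> l" "stretch J \<mu> l'"]
    by (simp_all flip: J add: linear_diff[OF linear_stretch] linear_cmul[OF linear_stretch])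
qed

text \<open>
  For a nonzero lattice vector, the product of the values of the form and of its conjugate is a
  nonzero integer, so both cannot be small. This holds uniformly in the point \<open>p\<close>.
\<close>

lemma lnorm_ge_1:
  assumes p: "p \<in> hyperboloid" and l: "l \<in> lat" "l \<noteq> 0" shows "1 \<le> lnorm p l"
proof (rule ccontr)
  assume "\<not> ?thesis"
  hence "(lnorm p l)\<^sup>2 < 1" using lnorm_square(2)[OF p, of l] by (simp add: abs_square_less_1)
  hence sum: "majorant p (fst l) + (norm (snd l))\<^sup>2 < 1" using lnorm_square(1)[OF p, of l] by simp
  have "\<bar>fst l \<bullet>\<^sub>M fst l\<bar> < 1" "snd l \<bullet> snd l < 1"
    using sum majorant_bounds[OF p, of "fst l"] zero_le_power2[of "norm (snd l)"]
    unfolding power2_norm_eq_inner by linarith+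
  hence "\<bar>fst l \<bullet>\<^sub>M fst l\<bar> * (snd l \<bullet> snd l) < 1 * 1" by (intro mult_strict_mono) auto
  hence "snd l \<bullet> snd l = 0"
    using quad_int_small(2)[of "fst l \<bullet>\<^sub>M fst l" "snd l \<bullet> snd l"] pairing_lat[OF l(1) l(1)]
    by (simp add: pairing_def abs_mult)
  thus False using lat_snd_zero[OF l(1)] l(2) by simp
qed

lemma finite_lnorm_le:
  fixes p :: "'n::finite spacetime"
  assumes p: "p \<in> hyperboloid" shows "finite {l \<in> lat. lnorm p l \<le> b}"
proof (cases "b \<ge> 0")
  case True
  obtain J \<mu> where J: "\<And>l :: 'n spacetime \<times> 'n spacetime. norm (stretch J \<mu> l) = lnorm p l"
    using lnorm_stretch[OF p] by blast
  have "1 \<le> norm (stretch J \<mu> (x - y))" if "x \<in> {l \<in> lat. lnorm p l \<le> b}" "y \<in> {l \<in> lat. lnorm p l \<le> b}" "x \<noteq> y" for x y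
    unfolding J using that by (intro lnorm_ge_1[OF p] lat_diff) simp_all
  thus ?thesis
    by (intro few_separated_vectors(1)[OF linear_stretch[of J \<mu>] subspace_UNIV _ True]) (simp_all add: J)
next
  case False
  hence "{l \<in> lat. lnorm p l \<le> b} = {}" using order_trans[OF lnorm_square(2)[OF p]] by blast
  thus ?thesis by (simp only: finite.emptyI)
qed

definition short_vectors where "short_vectors b p = {l \<in> lat. lnorm p l \<le> b}"

lemma uniformly_short_generators_lat:
  obtains b :: real and M :: nat where "b \<ge> 0"
    "\<And>p :: 'n::finite spacetime. p \<in> hyperboloid \<Longrightarrow> finite (short_vectors b p) \<and> card (short_vectors b p) \<le> M"
    "\<And>(p :: 'n spacetime) P l. p \<in> hyperboloid \<Longrightarrow> (\<And>l. l \<in> short_vectors b p \<Longrightarrow> P l) \<Longrightarrow>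
       (\<And>l l'. l \<in> lat \<Longrightarrow> l' \<in> lat \<Longrightarrow> P l \<Longrightarrow> P l' \<Longrightarrow> P (l + l')) \<Longrightarrow> l \<in> lat \<Longrightarrow> P l"
proof (rule uniformly_short_generators[OF gens_independent gens_card])
  fix b :: real and M :: nat
  assume b: "b \<ge> 0" and
    fin: "\<And>J \<mu>. unimodular_stretch J \<mu> \<Longrightarrow> (\<And>x. x \<in> int_span gens \<Longrightarrow> x \<noteq> 0 \<Longrightarrow> 1 \<le> norm (stretch J \<mu> x)) \<Longrightarrow>
       finite {x \<in> int_span (gens :: ('n spacetime \<times> 'n spacetime) set). norm (stretch J \<mu> x) \<le> b} \<and>
       card {x \<in> int_span (gens :: ('n spacetime \<times> 'n spacetime) set). norm (stretch J \<mu> x) \<le> b} \<le> M" and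
    gen: "\<And>J \<mu> P x. unimodular_stretch J \<mu> \<Longrightarrow> (\<And>x. x \<in> int_span gens \<Longrightarrow> x \<noteq> 0 \<Longrightarrow> 1 \<le> norm (stretch J \<mu> x)) \<Longrightarrow>
       (\<And>x. x \<in> int_span (gens :: ('n spacetime \<times> 'n spacetime) set) \<Longrightarrow> norm (stretch J \<mu> x) \<le> b \<Longrightarrow> P x) \<Longrightarrow>
       (\<And>x y. x \<in> int_span gens \<Longrightarrow> y \<in> int_span gens \<Longrightarrow> P x \<Longrightarrow> P y \<Longrightarrow> P (x + y)) \<Longrightarrow> x \<in> int_span gens \<Longrightarrow> P x"
  show thesis
  proof (rule that[OF b, of M])
    fix p :: "'n spacetime" assume p: "p \<in> hyperboloid"
    obtain J \<mu> where J: "unimodular_stretch J \<mu>"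
      "\<And>l :: 'n spacetime \<times> 'n spacetime. norm (stretch J \<mu> l) = lnorm p l"
      using lnorm_stretch[OF p] by blast
    have min: "1 \<le> norm (stretch J \<mu> x)" if "x \<in> int_span gens" "x \<noteq> 0" for x
      using lnorm_ge_1[OF p, of x] that by (simp add: J(2) lat_def)
    show "finite (short_vectors b p) \<and> card (short_vectors b p) \<le> M"
      using fin[OF J(1) min] by (simp add: short_vectors_def lat_def J(2))
    fix P and l :: "'n spacetime \<times> 'n spacetime"
    assume P: "\<And>l. l \<in> short_vectors b p \<Longrightarrow> P l" "\<And>l l'. l \<in> lat \<Longrightarrow> l' \<in> lat \<Longrightarrow> P l \<Longrightarrow> P l' \<Longrightarrow> P (l + l')" "l \<in> lat"
    show "P l"
      by (rule gen[OF J(1) min, of P l]) (use P in \<open>auto simp: short_vectors_def lat_def J(2)\<close>)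
  qed
qed

section \<open>Principal congruence subgroups\<close>

text \<open>
  An automorphism of the form over \<open>\<int>[sqrt 2]\<close> that is congruent to the identity modulo \<open>N\<close>, given
  by its action \<open>A\<close> on Minkowski space together with the conjugate action \<open>B\<close>, which is
  orthogonal.
\<close>

definition congruence_pair where
  "congruence_pair N A B \<longleftrightarrow> linear A \<and> (\<forall>x y. A x \<bullet>\<^sub>M A y = x \<bullet>\<^sub>M y) \<and>
     linear B \<and> (\<forall>x y. B x \<bullet> B y = x \<bullet> y) \<and> map_prod A B ` lat = lat \<and>
     (\<forall>l\<in>lat. \<exists>l'\<in>lat. map_prod A B l = l + real N *\<^sub>R l')"

definition congruence_isometries :: "nat \<Rightarrow> ('n::finite spacetime \<Rightarrow> 'n spacetime) set" where
  "congruence_isometries N = {A. \<exists>B. congruence_pair N A B}"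

definition congruence_group :: "nat \<Rightarrow> ('n::finite spacetime \<Rightarrow> 'n spacetime) set" where
  "congruence_group N = congruence_isometries N \<inter> lorentz"

lemma linear_map_prod: "linear A \<Longrightarrow> linear B \<Longrightarrow> linear (map_prod A B)"
  by (rule linearI) (auto simp: map_prod_def linear_add linear_cmul split: prod.splits)

lemma congruence_pairD:
  assumes "congruence_pair N A B"
  shows "linear A" "\<And>x y. A x \<bullet>\<^sub>M A y = x \<bullet>\<^sub>M y" "linear B" "\<And>x y. B x \<bullet> B y = x \<bullet> y"
    "map_prod A B ` lat = lat" "\<And>l. l \<in> lat \<Longrightarrow> \<exists>l'\<in>lat. map_prod A B l = l + real N *\<^sub>R l'"
    "\<And>l. l \<in> lat \<Longrightarrow> map_prod A B l \<in> lat" "linear (map_prod A B)"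
  using assms linear_map_prod[of A B] unfolding congruence_pair_def by blast+

lemma congruence_pair_id: "congruence_pair N id id"
  unfolding congruence_pair_def using lat_0 by (auto simp: linear_id prod.map_id intro!: bexI[of _ 0])

lemma congruence_pair_comp:
  assumes 1: "congruence_pair N A B" and 2: "congruence_pair N A' B'"
  shows "congruence_pair N (A \<circ> A') (B \<circ> B')"
proof -
  note 1 = congruence_pairD[OF 1] and 2 = congruence_pairD[OF 2]
  have comp: "map_prod (A \<circ> A') (B \<circ> B') l = map_prod A B (map_prod A' B' l)" for l
    by (cases l) simp
  have "map_prod (A \<circ> A') (B \<circ> B') ` lat = map_prod A B ` (map_prod A' B' ` lat)"
    by (simp only: map_prod_compose image_comp)
  hence "map_prod (A \<circ> A') (B \<circ> B') ` lat = lat" by (simp only: 1(5) 2(5))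
  moreover have "\<exists>l'\<in>lat. map_prod (A \<circ> A') (B \<circ> B') l = l + real N *\<^sub>R l'" if l: "l \<in> lat" for l
  proof -
    obtain l1 where l1: "l1 \<in> lat" "map_prod A' B' l = l + real N *\<^sub>R l1" using 2(6)[OF l] by blast
    obtain l2 where l2: "l2 \<in> lat" "map_prod A B l = l + real N *\<^sub>R l2" using 1(6)[OF l] by blast
    have "map_prod (A \<circ> A') (B \<circ> B') l = l + real N *\<^sub>R (l2 + map_prod A B l1)"
      by (simp add: comp l1(2) linear_add[OF 1(8)] linear_cmul[OF 1(8)] l2(2) algebra_simps)
    thus ?thesis using lat_add[OF l2(1) 1(7)[OF l1(1)]] by blast
  qed
  moreover have "linear (A \<circ> A')" "linear (B \<circ> B')" using linear_compose 1 2 by blast+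
  ultimately show ?thesis unfolding congruence_pair_def using 1(2,4) 2(2,4) by simp
qed

lemma congruence_pair_inverse:
  fixes A B :: "'n::finite spacetime \<Rightarrow> 'n spacetime"
  assumes "congruence_pair N A B"
  obtains A' B' where "congruence_pair N A' B'" "A' \<circ> A = id" "A \<circ> A' = id"
proof -
  note D = congruence_pairD[OF assms]
  have "A x = 0 \<Longrightarrow> x = 0" for x using minkowski_nondegenerate[of x] D(2)[of x] by simp
  hence "inj A" using linear_injective_0[OF D(1)] by blast
  then obtain A' where A': "linear A'" "\<And>x. A' (A x) = x" "\<And>x. A (A' x) = x"
    using linear_injective_isomorphism[OF D(1)] by blast
  have "B x = 0 \<Longrightarrow> x = 0" for x using D(4)[of x x] by simp
  hence "inj B" using linear_injective_0[OF D(3)] by blast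
  then obtain B' where B': "linear B'" "\<And>x. B' (B x) = x" "\<And>x. B (B' x) = x"
    using linear_injective_isomorphism[OF D(3)] by blast
  have inv: "map_prod A' B' (map_prod A B l) = l" for l by (cases l) (simp add: A' B')
  have "map_prod A' B' ` lat = map_prod A' B' ` (map_prod A B ` lat)" by (simp only: D(5))
  also have "\<dots> = lat" by (simp add: image_image inv)
  finally have img: "map_prod A' B' ` lat = lat" .
  have "\<exists>l'\<in>lat. map_prod A' B' l = l + real N *\<^sub>R l'" if l: "l \<in> lat" for l
  proof -
    have "l \<in> map_prod A B ` lat" using l by (simp only: D(5))
    then obtain m where m: "m \<in> lat" "l = map_prod A B m" by (elim imageE)
    obtain l1 where l1: "l1 \<in> lat" "map_prod A B m = m + real N *\<^sub>R l1" using D(6)[OF m(1)] by blast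
    have "map_prod A' B' l = m" by (simp only: m(2) inv)
    also have "m = l + real N *\<^sub>R (- l1)" using l1(2) by (simp add: m(2))
    finally have "map_prod A' B' l = l + real N *\<^sub>R (- l1)" .
    moreover have "- l1 \<in> lat" using lat_diff[OF lat_0 l1(1)] by simp
    ultimately show ?thesis by blast
  qed
  hence "congruence_pair N A' B'"
    unfolding congruence_pair_def using A' B' D(2)[of "A' x" "A' y" for x y] D(4)[of "B' x" "B' y" for x y] img by auto
  thus thesis using that A' by (auto simp: fun_eq_iff)
qed

lemma congruence_group_lorentz: "congruence_group N \<subseteq> lorentz"
  by (auto simp: congruence_group_def)

lemma congruence_group_id: "id \<in> congruence_group N"
  using congruence_pair_id lorentz_id by (auto simp: congruence_group_def congruence_isometries_def)

lemma congruence_group_comp: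
  "A \<in> congruence_group N \<Longrightarrow> B \<in> congruence_group N \<Longrightarrow> A \<circ> B \<in> congruence_group N"
  unfolding congruence_group_def congruence_isometries_def
  using congruence_pair_comp lorentz_comp by blast

lemma congruence_group_inverse:
  assumes "A \<in> congruence_group N" shows "\<exists>B\<in>congruence_group N. B \<circ> A = id \<and> A \<circ> B = id"
proof -
  obtain B where B: "congruence_pair N A B" and A: "A \<in> lorentz"
    using assms by (auto simp: congruence_group_def congruence_isometries_def)
  obtain A' B' where A': "congruence_pair N A' B'" "A' \<circ> A = id" "A \<circ> A' = id"
    using congruence_pair_inverse[OF B] .
  have "A' (A (0, 1)) = (0, 1)" using A'(2) by (rule pointfree_idE)
  hence "A' \<in> lorentz"
    using congruence_pairD(1,2)[OF A'(1)] lorentz_hyperboloid[OF A origin_in_hyperboloid] origin_in_hyperboloid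
    by (intro isometry_in_lorentz[of A' "A (0, 1)" "(0, 1)"]) auto
  thus ?thesis using A' by (auto simp: congruence_group_def congruence_isometries_def)
qed

text \<open>
  If an element moves \<open>p\<close> a bounded distance, it keeps vectors that are short with respect to
  \<open>p\<close> short. When the level is large, a congruence between short vectors is an equality, so
  the element fixes the generating set of short vectors.
\<close>

lemma congruence_displacement:
  "\<exists>N0. \<forall>N\<ge>N0. \<forall>A\<in>congruence_group N. \<forall>p :: 'n::finite spacetime. p \<in> hyperboloid \<longrightarrow> A \<noteq> id \<longrightarrow> p \<bullet>\<^sub>M A p < - K"
proof (rule uniformly_short_generators_lat[where 'n = 'n])
  fix b :: real and M :: nat
  assume b: "b \<ge> 0" and gen: "\<And>(p :: 'n spacetime) P l. p \<in> hyperboloid \<Longrightarrow> (\<And>l. l \<in> short_vectors b p \<Longrightarrow> P l) \<Longrightarrow>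
       (\<And>l l'. l \<in> lat \<Longrightarrow> l' \<in> lat \<Longrightarrow> P l \<Longrightarrow> P l' \<Longrightarrow> P (l + l')) \<Longrightarrow> l \<in> lat \<Longrightarrow> P l"
  define c where "c = sqrt (1 + 4 * K\<^sup>2)"
  obtain N0 :: nat where N0: "(c + 1) * b < real N0" using reals_Archimedean2 by blast
  show ?thesis
  proof (intro exI[of _ N0] allI impI ballI)
    fix N and A :: "'n spacetime \<Rightarrow> 'n spacetime" and p :: "'n spacetime"
    assume N: "N0 \<le> N" and A: "A \<in> congruence_group N" and p: "p \<in> hyperboloid" and "A \<noteq> id"
    obtain B where B: "congruence_pair N A B" and lor: "A \<in> lorentz"
      using A by (auto simp: congruence_group_def congruence_isometries_def)
    note D = congruence_pairD[OF B]
    have Ap: "A p \<in> hyperboloid" by (rule lorentz_hyperboloid[OF lor p])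
    show "p \<bullet>\<^sub>M A p < - K"
    proof (rule ccontr)
      assume "\<not> ?thesis"
      hence K: "- (p \<bullet>\<^sub>M A p) \<le> K" by simp
      have bound: "lnorm p (map_prod A B l) \<le> c * lnorm p l" for l
      proof -
        have "(A (fst l) \<bullet>\<^sub>M p)\<^sup>2 \<le> 2 * K\<^sup>2 * majorant (A p) (A (fst l))"
          by (rule majorant_compare[OF Ap p K])
        also have "majorant (A p) (A (fst l)) = majorant p (fst l)" by (simp add: majorant_def D(2))
        finally have 1: "majorant p (A (fst l)) \<le> (1 + 4 * K\<^sup>2) * majorant p (fst l)"
          using majorant_bounds(1)[OF p, of "fst l"] unfolding majorant_def[of p "A (fst l)"]
          by (simp add: D(2) algebra_simps)
        have "(norm (snd l))\<^sup>2 \<le> (1 + 4 * K\<^sup>2) * (norm (snd l))\<^sup>2"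
          by (simp add: algebra_simps)
        moreover have "(norm (B (snd l)))\<^sup>2 = (norm (snd l))\<^sup>2" by (simp add: power2_norm_eq_inner D(4))
        ultimately have "(lnorm p (map_prod A B l))\<^sup>2 \<le> (1 + 4 * K\<^sup>2) * (lnorm p l)\<^sup>2"
          using 1 by (simp add: lnorm_square(1)[OF p] distrib_left)
        also have "\<dots> = (c * lnorm p l)\<^sup>2" by (simp add: c_def power_mult_distrib)
        finally show ?thesis
          by (rule power2_le_imp_le) (simp add: c_def lnorm_square(2)[OF p])
      qed
      have c0: "c \<ge> 0" by (simp add: c_def)
      have fix_short: "map_prod A B l = l" if l: "l \<in> short_vectors b p" for l
      proof -
        have l': "l \<in> lat" "lnorm p l \<le> b" using l by (auto simp: short_vectors_def)
        obtain m where m: "m \<in> lat" "map_prod A B l = l + real N *\<^sub>R m" using D(6)[OF l'(1)] by blast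
        have "real N * lnorm p m = lnorm p (map_prod A B l - l)" by (simp add: m(2) lnorm_diff(2)[OF p])
        also have "\<dots> \<le> lnorm p (map_prod A B l) + lnorm p l" by (rule lnorm_diff(1)[OF p])
        also have "\<dots> \<le> c * b + b"
          using bound[of l] mult_left_mono[OF l'(2) c0] l'(2) by linarith
        also have "\<dots> < real N" using N0 N by (simp add: algebra_simps)
        finally have "lnorm p m < 1" using lnorm_square(2)[OF p, of m] c0 b
          by (cases "N = 0") (auto simp: mult_less_cancel_left1)
        hence "m = 0" using lnorm_ge_1[OF p m(1)] by force
        thus ?thesis using m by simp
      qed
      have "map_prod A B l = l" if "l \<in> lat" for l
        by (rule gen[OF p, of "\<lambda>l. map_prod A B l = l"]) (use fix_short that linear_add[OF D(8)] in auto)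
      hence "A (fst l) = fst l" if "l \<in> lat" for l using that by (metis fst_map_prod)
      moreover have "subspace {x. A x = x}" 
        by (auto simp: subspace_def linear_add[OF D(1)] linear_cmul[OF D(1)] linear_0[OF D(1)])
      ultimately have "{x. A x = x} = UNIV" by (intro lat_spans(1)) auto
      hence "A = id" by (auto simp: fun_eq_iff)
      with \<open>A \<noteq> id\<close> show False ..
    qed
  qed
qed

text \<open>
  For large level, congruent small values of the form are equal: their difference is divisible by
  \<open>N\<close>, and the quotient is an integer of the field that is small together with its conjugate. The
  conjugate values are always small, because the conjugate form is positive definite.
\<close>

lemma congruence_pairing_eq:
  assumes AB: "congruence_pair N A B" and l: "l \<in> lat" "l' \<in> lat"
    and b: "\<bar>A (fst l) \<bullet>\<^sub>M fst l'\<bar> + \<bar>fst l \<bullet>\<^sub>M fst l'\<bar> \<le> b" "2 * norm (snd l) * norm (snd l') \<le> b" and N: "real N > b"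
  shows "A (fst l) \<bullet>\<^sub>M fst l' = fst l \<bullet>\<^sub>M fst l'" "B (snd l) \<bullet> snd l' = snd l \<bullet> snd l'"
proof -
  note D = congruence_pairD[OF AB]
  obtain m where m: "m \<in> lat" "map_prod A B l = l + real N *\<^sub>R m" using D(6)[OF l(1)] by blast
  have fs: "A (fst l) = fst l + real N *\<^sub>R fst m" "B (snd l) = snd l + real N *\<^sub>R snd m"
    using arg_cong[OF m(2), of fst] arg_cong[OF m(2), of snd] by simp_all
  define \<alpha> \<beta> where "\<alpha> = fst m \<bullet>\<^sub>M fst l'" and "\<beta> = snd m \<bullet> snd l'"
  have q: "(\<alpha>, \<beta>) \<in> quad_int" using pairing_lat[OF m(1) l(2)] by (simp add: pairing_def \<alpha>_def \<beta>_def)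
  have eqs: "A (fst l) \<bullet>\<^sub>M fst l' = fst l \<bullet>\<^sub>M fst l' + real N * \<alpha>" "B (snd l) \<bullet> snd l' = snd l \<bullet> snd l' + real N * \<beta>"
    by (simp_all add: fs minkowski_simps inner_add_left \<alpha>_def \<beta>_def)
  have b0: "b \<ge> 0" using b(1) by linarith
  hence N0: "real N > 0" using N by simp
  have "real N * \<bar>\<alpha>\<bar> \<le> b" using eqs(1) b(1) N0 by (simp add: abs_mult[symmetric, of "real N", simplified])
  moreover have "real N * \<bar>\<beta>\<bar> \<le> b"
  proof -
    have "norm (B (snd l)) = norm (snd l)" by (simp add: norm_eq_sqrt_inner D(4))
    hence "\<bar>B (snd l) \<bullet> snd l'\<bar> \<le> norm (snd l) * norm (snd l')" by (metis Cauchy_Schwarz_ineq2)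
    moreover have "\<bar>snd l \<bullet> snd l'\<bar> \<le> norm (snd l) * norm (snd l')" by (rule Cauchy_Schwarz_ineq2)
    ultimately have "\<bar>real N * \<beta>\<bar> \<le> b" using eqs(2) b(2) by linarith
    thus ?thesis by (simp add: abs_mult)
  qed
  ultimately have "\<bar>\<alpha>\<bar> \<le> b / real N" "\<bar>\<beta>\<bar> \<le> b / real N" using N0 by (simp_all add: field_simps)
  hence "\<bar>\<alpha>\<bar> * \<bar>\<beta>\<bar> \<le> (b / real N) * (b / real N)" by (intro mult_mono) auto
  also have "\<dots> < 1 * 1" using N N0 b0 by (intro mult_strict_mono) auto
  finally have "\<alpha> = 0" "\<beta> = 0" using quad_int_small[OF q] by (simp_all add: abs_mult)
  thus "A (fst l) \<bullet>\<^sub>M fst l' = fst l \<bullet>\<^sub>M fst l'" "B (snd l) \<bullet> snd l' = snd l \<bullet> snd l'"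
    using eqs by simp_all
qed

text \<open>
  Equality in the Cauchy--Schwarz inequality of the conjugate form forces the conjugate vector to be
  fixed, and hence the vector itself.
\<close>

lemma congruence_fixes:
  assumes AB: "congruence_pair N A B" and l: "l \<in> lat" and eq: "B (snd l) \<bullet> snd l = snd l \<bullet> snd l"
  shows "A (fst l) = fst l"
proof -
  note D = congruence_pairD[OF AB]
  have "(B (snd l) - snd l) \<bullet> (B (snd l) - snd l) = 0"
    using eq D(4) by (simp add: inner_diff_left inner_diff_right inner_commute)
  hence "B (snd l) = snd l" by simp
  hence "snd (map_prod A B l - l) = 0" by simp
  hence "map_prod A B l - l = 0" using lat_snd_zero[OF lat_diff[OF D(7)[OF l] l]] by blast
  thus ?thesis by (metis eq_iff_diff_eq_0 fst_map_prod)
qed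

section \<open>Cocompactness\<close>

text \<open>
  A linear relation between the first vectors pairs to zero with all of them. Since the Gram
  matrices agree and the form is nondegenerate, the same relation holds between the second vectors.
\<close>

lemma linear_extension_isometry:
  fixes xs ys :: "'a::euclidean_space list"
  assumes b: "bilinear b" and nondeg: "\<And>x. (\<And>y. b x y = (0 :: real)) \<Longrightarrow> x = 0"
    and len: "length xs = length ys" and span: "span (set xs) = UNIV" "span (set ys) = UNIV"
    and gram: "\<And>i j. i < length xs \<Longrightarrow> j < length xs \<Longrightarrow> b (xs ! i) (xs ! j) = b (ys ! i) (ys ! j)"
  obtains A where "linear A" "\<And>i. i < length xs \<Longrightarrow> A (xs ! i) = ys ! i" "\<And>x y. b (A x) (A y) = b x y"
proof -
  have lin: "linear (\<lambda>x. b x y)" "linear (b x)" for x y using b by (auto simp: bilinear_def)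
  obtain T where T: "T \<subseteq> set xs" "independent T" "span T = UNIV"
    using maximal_independent_subset[of "set xs"] span(1) by (metis span_eq span_superset span_mono span_span top.extremum_uniqueI)
  have finT: "finite T" using T(2) independent_imp_finite by blast
  define idx where "idx x = (SOME i. i < length xs \<and> xs ! i = x)" for x
  have idx: "idx x < length xs" "xs ! idx x = x" if "x \<in> set xs" for x
  proof -
    have "\<exists>i. i < length xs \<and> xs ! i = x" using that by (auto simp: in_set_conv_nth)
    from someI_ex[OF this] show "idx x < length xs" "xs ! idx x = x" by (auto simp: idx_def)
  qed
  obtain A where A: "linear A" "\<And>x. x \<in> T \<Longrightarrow> A x = ys ! idx x"
    using linear_independent_extend[OF T(2), of "\<lambda>x. ys ! idx x"] by blast
  have Ai: "A (xs ! i) = ys ! i" if i: "i < length xs" for i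
  proof -
    have "xs ! i \<in> span T" using T(3) by simp
    then obtain u where u: "xs ! i = (\<Sum>t\<in>T. u t *\<^sub>R t)" using span_finite[OF finT] by auto
    have "b (A (xs ! i)) (ys ! j) = b (ys ! i) (ys ! j)" if j: "j < length xs" for j
    proof -
      have "b (A (xs ! i)) (ys ! j) = (\<Sum>t\<in>T. u t * b (A t) (ys ! j))"
        by (simp add: u linear_sum[OF A(1)] linear_cmul[OF A(1)] linear_sum[OF lin(1)] linear_cmul[OF lin(1)])
      also have "\<dots> = (\<Sum>t\<in>T. u t * b t (xs ! j))"
      proof (rule sum.cong[OF refl])
        fix t assume t: "t \<in> T"
        hence "t \<in> set xs" using T(1) by blast
        thus "u t * b (A t) (ys ! j) = u t * b t (xs ! j)"
          using A(2)[OF t] gram[OF idx(1) j, of t] idx(2)[of t] by simp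
      qed
      also have "\<dots> = b (xs ! i) (xs ! j)"
        by (simp add: u linear_sum[OF lin(1)] linear_cmul[OF lin(1)])
      finally show ?thesis using gram[OF i j] by simp
    qed
    hence "b (A (xs ! i) - ys ! i) (ys ! j) = 0" if "j < length ys" for j
      using that len by (simp add: linear_diff[OF lin(1)])
    hence "set ys \<subseteq> {y. b (A (xs ! i) - ys ! i) y = 0}" by (auto simp: in_set_conv_nth)
    moreover have "subspace {y. b (A (xs ! i) - ys ! i) y = 0}"
      by (auto simp: subspace_def linear_add[OF lin(2)] linear_cmul[OF lin(2)] linear_0[OF lin(2)])
    ultimately have "span (set ys) \<subseteq> {y. b (A (xs ! i) - ys ! i) y = 0}" by (rule span_minimal)
    hence "b (A (xs ! i) - ys ! i) y = 0" for y using span(2) by blast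
    hence "A (xs ! i) - ys ! i = 0" by (rule nondeg)
    thus ?thesis by simp
  qed
  have "b (A x) (A y) = b x y" for x y
  proof -
    have 1: "b (A x) (A y) = b x y" if y: "y \<in> set xs" for x y
    proof -
      have l1: "linear (\<lambda>x. b (A x) (A y))" by (rule linear_compose[OF A(1) lin(1), unfolded o_def])
      have on: "b (A z) (A y) = b z y" if "z \<in> set xs" for z
      proof -
        obtain i where "i < length xs" "xs ! i = z" using \<open>z \<in> set xs\<close> unfolding in_set_conv_nth by blast
        moreover obtain j where "j < length xs" "xs ! j = y" using y unfolding in_set_conv_nth by blast
        ultimately show ?thesis using gram[of i j] Ai[of i] Ai[of j] by simp
      qed
      show ?thesis
        using linear_eq_on_span[of "\<lambda>x. b (A x) (A y)" "\<lambda>x. b x y" "set xs" x, OF l1 lin(1) on] span(1) by simp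
    qed
    have l2: "linear (\<lambda>y. b (A x) (A y))" by (rule linear_compose[OF A(1) lin(2), unfolded o_def])
    show ?thesis
      using linear_eq_on_span[of "\<lambda>y. b (A x) (A y)" "b x" "set xs" y, OF l2 lin(2) 1] span(1) by simp
  qed
  thus thesis using that A(1) Ai by blast
qed

lemma finite_residues:
  assumes "N > 0"
  obtains res :: "'n::finite spacetime \<times> 'n spacetime \<Rightarrow> _" where
    "finite (res ` lat)" "\<And>l. l \<in> lat \<Longrightarrow> \<exists>m\<in>lat. l = res l + real N *\<^sub>R m"
proof -
  define R where "R = (\<lambda>k. \<Sum>b\<in>gens. of_int (k b) *\<^sub>R b) ` PiE (gens :: ('n spacetime \<times> _) set) (\<lambda>_. {0..<int N})"
  have finR: "finite R" unfolding R_def by (intro finite_imageI finite_PiE gens_finite) auto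
  have "\<exists>r. r \<in> R \<and> (\<exists>m\<in>lat. l = r + real N *\<^sub>R m)" if l: "l \<in> lat" for l
  proof -
    obtain k where k: "l = (\<Sum>b\<in>gens. of_int (k b) *\<^sub>R b)" using l by (auto simp: lat_def int_span_def)
    let ?k = "restrict (\<lambda>b. k b mod int N) gens"
    have "(\<Sum>b\<in>gens. of_int (?k b) *\<^sub>R b) \<in> R"
      unfolding R_def using assms by (intro imageI) auto
    moreover have "(\<Sum>b\<in>gens. of_int (k b div int N) *\<^sub>R b) \<in> lat"
      unfolding lat_def int_span_def by (rule range_eqI[of _ _ "\<lambda>b. k b div int N"]) simp
    moreover have "l = (\<Sum>b\<in>gens. of_int (?k b) *\<^sub>R b) + real N *\<^sub>R (\<Sum>b\<in>gens. of_int (k b div int N) *\<^sub>R b)"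
    proof -
      have "real_of_int (k b) = of_int (k b mod int N) + real N * of_int (k b div int N)" for b
        by (metis add.commute mult_div_mod_eq of_int_add of_int_mult of_int_of_nat_eq)
      hence "l = (\<Sum>b\<in>gens. (of_int (k b mod int N) + real N * of_int (k b div int N)) *\<^sub>R b)"
        unfolding k by simp
      also have "\<dots> = (\<Sum>b\<in>gens. of_int (?k b) *\<^sub>R b) + real N *\<^sub>R (\<Sum>b\<in>gens. of_int (k b div int N) *\<^sub>R b)"
        by (simp add: scaleR_left_distrib sum.distrib scaleR_sum_right)
      finally show ?thesis .
    qed
    ultimately show ?thesis by blast
  qed
  then obtain res where res: "\<And>l. l \<in> lat \<Longrightarrow> res l \<in> R \<and> (\<exists>m\<in>lat. l = res l + real N *\<^sub>R m)" by metis
  hence "finite (res ` lat)" using finR by (meson finite_subset image_subsetI)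
  thus thesis using that res by blast
qed

lemma bounded_pairings_bound_vector:
  fixes S :: "'n::finite spacetime set"
  assumes "finite S" "span S = UNIV"
  obtains R where "\<And>y. (\<And>x. x \<in> S \<Longrightarrow> \<bar>x \<bullet>\<^sub>M y\<bar> \<le> b) \<Longrightarrow> \<bar>snd y\<bar> \<le> R"
proof -
  have "(0, 1) \<in> span S" using assms(2) by simp
  then obtain u where u: "(0, 1) = (\<Sum>x\<in>S. u x *\<^sub>R x)" using span_finite[OF assms(1)] by auto
  have "\<bar>snd y\<bar> \<le> (\<Sum>x\<in>S. \<bar>u x\<bar> * b)" if y: "\<And>x. x \<in> S \<Longrightarrow> \<bar>x \<bullet>\<^sub>M y\<bar> \<le> b" for y
  proof -
    have lin: "linear (\<lambda>x. x \<bullet>\<^sub>M y)" using bilinear_minkowski by (auto simp: bilinear_def)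
    have "snd y = - ((0, 1) \<bullet>\<^sub>M y)" by (simp add: minkowski_def)
    also have "\<dots> = - (\<Sum>x\<in>S. u x * (x \<bullet>\<^sub>M y))"
      unfolding u by (simp add: linear_sum[OF lin] linear_cmul[OF lin])
    finally have "\<bar>snd y\<bar> \<le> (\<Sum>x\<in>S. \<bar>u x * (x \<bullet>\<^sub>M y)\<bar>)" using sum_abs[of "\<lambda>x. u x * (x \<bullet>\<^sub>M y)" S] by simp
    also have "\<dots> \<le> (\<Sum>x\<in>S. \<bar>u x\<bar> * b)" using y by (intro sum_mono) (auto simp: abs_mult mult_left_mono)
    finally show ?thesis .
  qed
  thus thesis using that by blast
qed

text \<open>
  The list of short vectors of a point has only finitely many possible Gram matrices and residues
  modulo \<open>N\<close>. Two points with the same data differ by an element of the congruence group, up to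
  a bounded distance.
\<close>

lemma congruence_isometries_cobounded:
  assumes N: "N > 0"
  shows "\<exists>R. \<forall>p :: 'n::finite spacetime. p \<in> hyperboloid \<longrightarrow> (\<exists>A\<in>congruence_isometries N. \<bar>snd (A p)\<bar> \<le> R)"
proof (rule uniformly_short_generators_lat[where 'n = 'n])
  fix b :: real and M :: nat
  assume b: "b \<ge> 0" and fin: "\<And>p :: 'n spacetime. p \<in> hyperboloid \<Longrightarrow> finite (short_vectors b p) \<and> card (short_vectors b p) \<le> M"
    and gen: "\<And>(p :: 'n spacetime) P l. p \<in> hyperboloid \<Longrightarrow> (\<And>l. l \<in> short_vectors b p \<Longrightarrow> P l) \<Longrightarrow>
       (\<And>l l'. l \<in> lat \<Longrightarrow> l' \<in> lat \<Longrightarrow> P l \<Longrightarrow> P l' \<Longrightarrow> P (l + l')) \<Longrightarrow> l \<in> lat \<Longrightarrow> P l"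
  obtain res :: "'n spacetime \<times> 'n spacetime \<Rightarrow> 'n spacetime \<times> 'n spacetime"
    where res: "finite (res ` lat)" "\<And>l. l \<in> lat \<Longrightarrow> \<exists>m\<in>lat. l = res l + real N *\<^sub>R m"
    using finite_residues[OF N] by blast
  have "\<exists>ls. \<forall>p :: 'n spacetime. p \<in> hyperboloid \<longrightarrow> set (ls p) = short_vectors b p \<and> length (ls p) \<le> M"
  proof (rule choice, rule allI)
    fix p :: "'n spacetime"
    show "\<exists>xs. p \<in> hyperboloid \<longrightarrow> set xs = short_vectors b p \<and> length xs \<le> M"
      using fin[of p] finite_distinct_list[of "short_vectors b p"] distinct_card by metis
  qed
  then obtain ls where ls: "\<And>p :: 'n spacetime. p \<in> hyperboloid \<Longrightarrow> set (ls p) = short_vectors b p"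
    "\<And>p :: 'n spacetime. p \<in> hyperboloid \<Longrightarrow> length (ls p) \<le> M" by blast
  have short: "l \<in> lat" "\<bar>fst l \<bullet>\<^sub>M p\<bar> \<le> b" "lnorm p l \<le> b" if "l \<in> set (ls p)" "p \<in> hyperboloid" for l p
  proof -
    show l: "l \<in> lat" "lnorm p l \<le> b" using that ls(1) by (auto simp: short_vectors_def)
    have "(fst l \<bullet>\<^sub>M p)\<^sup>2 \<le> (lnorm p l)\<^sup>2"
      using majorant_bounds(2)[OF that(2), of "fst l"] zero_le_power2[of "norm (snd l)"]
      unfolding lnorm_square(1)[OF that(2)] by linarith
    also have "\<dots> \<le> b\<^sup>2" using l(2) lnorm_square(2)[OF that(2)] by (intro power_mono)
    finally show "\<bar>fst l \<bullet>\<^sub>M p\<bar> \<le> b" using b by (simp add: power2_le_iff_abs_le)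
  qed
  define gram where "gram p = map (\<lambda>l. map (pairing l) (ls p)) (ls p)" for p
  define dat where "dat p = (gram p, map res (ls p))" for p
  have "finite (dat ` hyperboloid)"
  proof (rule finite_subset)
    let ?Q = "{x \<in> quad_int. \<bar>fst x\<bar> \<le> 2 * b\<^sup>2 \<and> \<bar>snd x\<bar> \<le> 2 * b\<^sup>2}"
    let ?L = "{xs. set xs \<subseteq> ?Q \<and> length xs \<le> M}"
    let ?G = "{xs. set xs \<subseteq> ?L \<and> length xs \<le> M}"
    let ?R = "{xs. set xs \<subseteq> res ` lat \<and> length xs \<le> M}"
    show "finite (?G \<times> ?R)"
      by (intro finite_cartesian_product finite_lists_length_le finite_quad_int res(1))
    show "dat ` hyperboloid \<subseteq> ?G \<times> ?R"
    proof (rule image_subsetI)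
      fix p :: "'n spacetime" assume p: "p \<in> hyperboloid"
      have pq: "pairing l l' \<in> ?Q" if l: "l \<in> set (ls p)" "l' \<in> set (ls p)" for l l'
      proof -
        note s = short[OF l(1) p] short[OF l(2) p]
        have half: "majorant p (fst l) \<le> b\<^sup>2 \<and> (norm (snd l))\<^sup>2 \<le> b\<^sup>2" if "lnorm p l \<le> b" for l
          using power_mono[OF that lnorm_square(2)[OF p], of 2] majorant_bounds(3)[OF p, of "fst l"] zero_le_power2[of "norm (snd l)"]
          unfolding lnorm_square(1)[OF p] by linarith
        have "\<bar>snd l \<bullet> snd l'\<bar> \<le> norm (snd l) * norm (snd l')" by (rule Cauchy_Schwarz_ineq2)
        also have "\<dots> \<le> b * b"
          by (rule mult_mono[OF power2_le_imp_le[OF conjunct2[OF half[OF s(3)]] b]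
                power2_le_imp_le[OF conjunct2[OF half[OF s(6)]] b] b norm_ge_zero])
        finally have 1: "\<bar>snd l \<bullet> snd l'\<bar> \<le> 2 * b\<^sup>2" using b by (simp add: power2_eq_square)
        let ?x = "fst l" and ?y = "fst l'"
        have le: "?x \<bullet>\<^sub>M ?x + (?x \<bullet>\<^sub>M p)\<^sup>2 \<le> b\<^sup>2" "?y \<bullet>\<^sub>M ?y + (?y \<bullet>\<^sub>M p)\<^sup>2 \<le> b\<^sup>2" "0 \<le> ?y \<bullet>\<^sub>M ?y + (?y \<bullet>\<^sub>M p)\<^sup>2"
          using half[OF s(3)] half[OF s(6)] zero_le_power2[of "?x \<bullet>\<^sub>M p"] zero_le_power2[of "?y \<bullet>\<^sub>M p"]
            reverse_Cauchy_Schwarz[OF p, of ?y]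
          unfolding majorant_def by linarith+
        have "(?x \<bullet>\<^sub>M ?y + (?x \<bullet>\<^sub>M p) * (?y \<bullet>\<^sub>M p))\<^sup>2 \<le> b\<^sup>2 * b\<^sup>2"
          using projected_Cauchy_Schwarz[OF p, of ?x ?y] mult_mono[OF le(1,2) zero_le_power2 le(3)] by linarith
        also have "\<dots> = (b\<^sup>2)\<^sup>2" by (simp only: power2_eq_square)
        finally have "\<bar>?x \<bullet>\<^sub>M ?y + (?x \<bullet>\<^sub>M p) * (?y \<bullet>\<^sub>M p)\<bar> \<le> b\<^sup>2"
          by (rule power2_le_iff_abs_le[THEN iffD1, rotated]) simp
        moreover have "\<bar>(fst l \<bullet>\<^sub>M p) * (fst l' \<bullet>\<^sub>M p)\<bar> \<le> b\<^sup>2"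
          using s(2,5) b unfolding abs_mult power2_eq_square by (intro mult_mono) auto
        ultimately have 2: "\<bar>fst l \<bullet>\<^sub>M fst l'\<bar> \<le> 2 * b\<^sup>2" by linarith
        show ?thesis using 1 2 pairing_lat[OF s(1,4)] by (simp add: pairing_def)
      qed
      have "map (pairing l) (ls p) \<in> ?L" if "l \<in> set (ls p)" for l
      proof (intro CollectI conjI)
        show "set (map (pairing l) (ls p)) \<subseteq> ?Q" unfolding set_map by (intro image_subsetI pq that)
      qed (simp add: ls(2)[OF p])
      hence "set (gram p) \<subseteq> ?L" unfolding gram_def set_map by (intro image_subsetI)
      moreover have "length (gram p) \<le> M" by (simp add: gram_def ls(2)[OF p])
      moreover have "set (map res (ls p)) \<subseteq> res ` lat" using short(1)[OF _ p] unfolding set_map by blast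
      moreover have "length (map res (ls p)) \<le> M" by (simp add: ls(2)[OF p])
      ultimately show "dat p \<in> ?G \<times> ?R" unfolding dat_def by blast
    qed
  qed
  have span_fst: "span (set (map fst (ls p))) = UNIV" and span_snd: "span (set (map snd (ls p))) = UNIV"
    if p: "p \<in> hyperboloid" for p :: "'n spacetime"
  proof -
    have "fst l \<in> span (set (map fst (ls p)))" if "l \<in> lat" for l
      by (rule gen[OF p _ _ that]) (auto simp flip: ls(1)[OF p] intro: span_base span_add)
    thus "span (set (map fst (ls p))) = UNIV" by (intro lat_spans(1)) auto
    have "snd l \<in> span (set (map snd (ls p)))" if "l \<in> lat" for l
      by (rule gen[OF p _ _ that]) (auto simp flip: ls(1)[OF p] intro: span_base span_add)
    thus "span (set (map snd (ls p))) = UNIV" by (intro lat_spans(2)) auto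
  qed
  have link: "\<exists>A\<in>congruence_isometries N. \<forall>x\<in>fst ` set (ls q). \<bar>x \<bullet>\<^sub>M A p\<bar> \<le> b"
    if p: "p \<in> hyperboloid" and q: "q \<in> hyperboloid" and eq: "dat p = dat q" for p q
  proof -
    have len: "length (ls p) = length (ls q)" using eq unfolding dat_def by (metis length_map prod.inject)
    have gr: "pairing (ls p ! i) (ls p ! j) = pairing (ls q ! i) (ls q ! j)" if "i < length (ls p)" "j < length (ls p)" for i j
    proof -
      have "gram p ! i ! j = gram q ! i ! j" using eq by (simp add: dat_def)
      thus ?thesis using that len by (simp add: gram_def)
    qed
    have rs: "res (ls p ! i) = res (ls q ! i)" if "i < length (ls p)" for i
    proof -
      have "map res (ls p) ! i = map res (ls q) ! i" using eq by (simp add: dat_def)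
      thus ?thesis using that len by simp
    qed
    obtain A where A: "linear A" "\<And>i. i < length (map fst (ls p)) \<Longrightarrow> A (map fst (ls p) ! i) = map fst (ls q) ! i"
      "\<And>x y. A x \<bullet>\<^sub>M A y = x \<bullet>\<^sub>M y"
      by (rule linear_extension_isometry[OF bilinear_minkowski minkowski_nondegenerate _ span_fst[OF p] span_fst[OF q]])
        (use len gr in \<open>auto simp: pairing_def\<close>)
    have bil: "bilinear ((\<bullet>) :: 'n spacetime \<Rightarrow> _)"
      by (rule bilinear_conv_bounded_bilinear[THEN iffD2, OF bounded_bilinear_inner])
    have nondeg: "x = 0" if "\<And>y. x \<bullet> y = 0" for x :: "'n spacetime" using that[of x] by simp
    obtain B where B: "linear B" "\<And>i. i < length (map snd (ls p)) \<Longrightarrow> B (map snd (ls p) ! i) = map snd (ls q) ! i"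
      "\<And>x y. B x \<bullet> B y = x \<bullet> y"
      by (rule linear_extension_isometry[OF bil nondeg _ span_snd[OF p] span_snd[OF q]])
        (use len gr in \<open>auto simp: pairing_def\<close>)
    define T where "T = map_prod A B"
    have linT: "linear T" unfolding T_def by (rule linear_map_prod[OF A(1) B(1)])
    have Ti: "T (ls p ! i) = ls q ! i" if "i < length (ls p)" for i
      using A(2)[of i] B(2)[of i] that len by (simp add: T_def prod_eq_iff)
    have cong: "\<exists>m\<in>lat. T l = l + real N *\<^sub>R m" if "l \<in> lat" for l
    proof (rule gen[OF p _ _ that, of "\<lambda>l. \<exists>m\<in>lat. T l = l + real N *\<^sub>R m"])
      fix l assume "l \<in> short_vectors b p"
      then obtain i where i: "i < length (ls p)" "l = ls p ! i" using ls(1)[OF p] by (metis in_set_conv_nth)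
      have "ls p ! i \<in> lat" "ls q ! i \<in> lat" using short(1) i len p q by (metis nth_mem)+
      then obtain m m' where m: "m \<in> lat" "ls p ! i = res (ls p ! i) + real N *\<^sub>R m"
        "m' \<in> lat" "ls q ! i = res (ls q ! i) + real N *\<^sub>R m'" using res(2) by meson
      have "T l = l + (ls q ! i - ls p ! i)" using Ti[OF i(1)] i(2) by simp
      also have "ls q ! i - ls p ! i = real N *\<^sub>R (m' - m)"
        by (subst m(4), subst m(2)) (simp add: rs[OF i(1)] scaleR_diff_right)
      finally show "\<exists>m\<in>lat. T l = l + real N *\<^sub>R m" using lat_diff[OF m(3,1)] by blast
    next
      fix l l' assume "\<exists>m\<in>lat. T l = l + real N *\<^sub>R m" "\<exists>m\<in>lat. T l' = l' + real N *\<^sub>R m"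
      then obtain m m' where "m \<in> lat" "T l = l + real N *\<^sub>R m" "m' \<in> lat" "T l' = l' + real N *\<^sub>R m'" by blast
      thus "\<exists>m\<in>lat. T (l + l') = l + l' + real N *\<^sub>R m"
        by (intro bexI[of _ "m + m'"] lat_add) (simp_all add: linear_add[OF linT] algebra_simps)
    qed
    have "T ` lat = lat"
    proof (intro equalityI subsetI)
      fix l assume "l \<in> T ` lat"
      then obtain l0 m where "l0 \<in> lat" "m \<in> lat" "l = l0 + of_int (int N) *\<^sub>R m" using cong by fastforce
      thus "l \<in> lat" using lat_add lat_scale by blast
    next
      fix l :: "'n spacetime \<times> 'n spacetime" assume l: "l \<in> lat"
      show "l \<in> T ` lat"
      proof (rule gen[OF q _ _ l, of "\<lambda>l. l \<in> T ` lat"])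
        fix l assume "l \<in> short_vectors b q"
        then obtain i where i: "i < length (ls p)" "l = ls q ! i" using ls(1)[OF q] len by (metis in_set_conv_nth)
        have "ls p ! i \<in> lat" using short(1) i p by (metis nth_mem)
        thus "l \<in> T ` lat" using Ti[OF i(1)] i(2) by (metis imageI)
      next
        fix l l' assume "l \<in> T ` lat" "l' \<in> T ` lat"
        then obtain m m' where "m \<in> lat" "m' \<in> lat" "l = T m" "l' = T m'" by blast
        thus "l + l' \<in> T ` lat" by (intro image_eqI[of _ _ "m + m'"] lat_add) (simp_all add: linear_add[OF linT])
      qed
    qed
    hence "congruence_pair N A B"
      unfolding congruence_pair_def using A(1,3) B(1,3) cong by (simp add: T_def)
    hence "A \<in> congruence_isometries N" by (auto simp: congruence_isometries_def)
    moreover have "\<bar>x \<bullet>\<^sub>M A p\<bar> \<le> b" if x: "x \<in> fst ` set (ls q)" for x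
    proof -
      obtain i where i: "i < length (ls p)" "x = fst (ls q ! i)" using x len by (auto simp: in_set_conv_nth)
      hence "x = A (fst (ls p ! i))" using A(2)[of i] len by simp
      hence "x \<bullet>\<^sub>M A p = fst (ls p ! i) \<bullet>\<^sub>M p" by (simp add: A(3))
      thus ?thesis using short(2)[OF nth_mem[OF i(1)] p] by simp
    qed
    ultimately show ?thesis by blast
  qed
  have "\<exists>r. \<forall>q. q \<in> hyperboloid \<longrightarrow> (\<forall>y. (\<forall>x\<in>fst ` set (ls q). \<bar>x \<bullet>\<^sub>M y\<bar> \<le> b) \<longrightarrow> \<bar>snd y\<bar> \<le> r q)"
  proof (rule choice, rule allI)
    fix q :: "'n spacetime"
    show "\<exists>r. q \<in> hyperboloid \<longrightarrow> (\<forall>y. (\<forall>x\<in>fst ` set (ls q). \<bar>x \<bullet>\<^sub>M y\<bar> \<le> b) \<longrightarrow> \<bar>snd y\<bar> \<le> r)"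
    proof (cases "q \<in> hyperboloid")
      case True
      have "finite (fst ` set (ls q))" "span (fst ` set (ls q)) = UNIV" using span_fst[OF True] by auto
      from bounded_pairings_bound_vector[OF this, of b] show ?thesis by metis
    qed simp
  qed
  then obtain r where r: "\<And>q y. q \<in> hyperboloid \<Longrightarrow> (\<forall>x\<in>fst ` set (ls q). \<bar>x \<bullet>\<^sub>M y\<bar> \<le> b) \<Longrightarrow> \<bar>snd y\<bar> \<le> r q" by blast
  have "\<exists>rep. \<forall>d\<in>dat ` hyperboloid. rep d \<in> hyperboloid \<and> dat (rep d) = d" by (rule bchoice) blast
  then obtain rep where rep: "\<And>p. p \<in> hyperboloid \<Longrightarrow> rep (dat p) \<in> hyperboloid \<and> dat (rep (dat p)) = dat p" by blast
  show ?thesis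
  proof (intro exI[of _ "Max ((\<lambda>d. r (rep d)) ` dat ` hyperboloid)"] allI impI)
    fix p :: "'n spacetime" assume p: "p \<in> hyperboloid"
    obtain A where A: "A \<in> congruence_isometries N" "\<forall>x\<in>fst ` set (ls (rep (dat p))). \<bar>x \<bullet>\<^sub>M A p\<bar> \<le> b"
      using link[OF p, of "rep (dat p)"] rep[OF p] by auto
    have "\<bar>snd (A p)\<bar> \<le> r (rep (dat p))" using r A(2) rep[OF p] by blast
    also have "\<dots> \<le> Max ((\<lambda>d. r (rep d)) ` dat ` hyperboloid)"
      using \<open>finite (dat ` hyperboloid)\<close> p by (intro Max_ge) auto
    finally show "\<exists>A\<in>congruence_isometries N. \<bar>snd (A p)\<bar> \<le> Max ((\<lambda>d. r (rep d)) ` dat ` hyperboloid)"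
      using A(1) by blast
  qed
qed

text \<open>
  The isometries found above may exchange the two sheets of the hyperboloid. In that case a fixed
  isometry \<open>F\<close> of this kind can be composed with them, which changes the bound only.
\<close>

lemma congruence_group_cobounded:
  assumes N: "N > 0"
  shows "\<exists>R. \<forall>p :: 'n::finite spacetime. p \<in> hyperboloid \<longrightarrow> (\<exists>A\<in>congruence_group N. snd (A p) \<le> R)"
proof -
  obtain R where R: "\<And>p :: 'n::finite spacetime. p \<in> hyperboloid \<Longrightarrow> \<exists>A\<in>congruence_isometries N. \<bar>snd (A p)\<bar> \<le> R"
    using congruence_isometries_cobounded[OF N] by blast
  show ?thesis
  proof (cases "congruence_isometries N \<subseteq> (lorentz :: ('n spacetime \<Rightarrow> _) set)")
    case True
    hence "congruence_group N = (congruence_isometries N :: ('n spacetime \<Rightarrow> _) set)"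
      by (auto simp: congruence_group_def)
    thus ?thesis using R by (intro exI[of _ R]) (metis abs_le_D1)
  next
    case False
    then obtain F :: "'n spacetime \<Rightarrow> _" where F: "F \<in> congruence_isometries N" "F \<notin> lorentz" by blast
    then obtain F2 where F2: "congruence_pair N F F2" by (auto simp: congruence_isometries_def)
    obtain F' F2' where F': "F \<circ> F' = id" using congruence_pair_inverse[OF F2] by metis
    define w where "w = F' (0, 1)"
    have Fw: "F w = (0, 1)" using F' by (simp add: w_def pointfree_idE)
    have reversing: "A p \<bullet>\<^sub>M (0, 1) > 0" if A: "A \<in> congruence_isometries N" "A \<notin> lorentz" and p: "p \<in> hyperboloid" for A and p :: "'n spacetime"
    proof (rule ccontr)
      obtain A2 where "congruence_pair N A A2" using A(1) unfolding congruence_isometries_def by blast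
      note D = congruence_pairD(1,2)[OF this]
      assume "\<not> ?thesis"
      hence "A p \<bullet>\<^sub>M (0, 1) \<le> 0" by (simp only: not_less)
      with A(2) show False using isometry_in_lorentz[OF D p origin_in_hyperboloid] by blast
    qed
    show ?thesis
    proof (intro exI[of _ "max R ((norm (fst w) + \<bar>snd w\<bar>) * R)"] allI impI)
      fix p :: "'n spacetime" assume p: "p \<in> hyperboloid"
      obtain A where A: "A \<in> congruence_isometries N" "\<bar>snd (A p)\<bar> \<le> R" using R[OF p] by blast
      show "\<exists>A\<in>congruence_group N. snd (A p) \<le> max R ((norm (fst w) + \<bar>snd w\<bar>) * R)"
      proof (cases "A \<in> lorentz")
        case True
        thus ?thesis using A by (intro bexI[of _ A]) (auto simp: congruence_group_def)
      next
        case False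
        obtain A2 where A2: "congruence_pair N A A2" using A by (auto simp: congruence_isometries_def)
        note DF = congruence_pairD(1,2)[OF F2] and DA = congruence_pairD(1,2)[OF A2]
        have y: "- A p \<in> hyperboloid"
          using reversing[OF A(1) False p] DA(2) hyperboloid_self[OF p] by (simp add: hyperboloid_def)
        have Fy: "F (A p) = - F (- A p)" using linear_neg[OF DF(1), of "A p"] by simp
        have comp: "congruence_pair N (F \<circ> A) (F2 \<circ> A2)" by (rule congruence_pair_comp[OF F2 A2])
        have "(F \<circ> A) p \<bullet>\<^sub>M (0, 1) \<le> 0"
          using reversing[OF F(1,2) y] unfolding comp_apply Fy by (simp only: minkowski_minus)
        hence "F \<circ> A \<in> lorentz"
          using congruence_pairD(1,2)[OF comp] by (intro isometry_in_lorentz[OF _ _ p origin_in_hyperboloid])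
        hence mem: "F \<circ> A \<in> congruence_group N" using comp by (auto simp: congruence_group_def congruence_isometries_def)
        have "snd ((F \<circ> A) p) = - (F (A p) \<bullet>\<^sub>M F w)" by (simp add: Fw)
        also have "\<dots> = w \<bullet>\<^sub>M (- A p)" by (simp add: DF(2) minkowski_commute)
        also have "\<dots> \<le> (norm (fst w) + \<bar>snd w\<bar>) * R"
        proof -
          have "snd (- A p) \<le> R" using A(2) by simp
          from minkowski_le_time[OF y this, of w] show ?thesis by simp
        qed
        finally show ?thesis using mem by (intro bexI[of _ "F \<circ> A"]) auto
      qed
    qed
  qed
qed

section \<open>Short systoles\<close>

lemma (in wall_system) doubled_manifold:
  "\<exists>M :: 'n hyperbolic set set. compact_hyperbolic_manifold M \<and> systole M setdist = arcosh (2 * c\<^sup>2 - 1)"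
proof -
  define l where "l = arcosh (2 * c\<^sup>2 - 1)"
  have c2: "c\<^sup>2 > 1" using c by (simp add: one_less_power)
  have cosh: "cosh l = 2 * c\<^sup>2 - 1" and "l \<ge> 0" using c2 by (simp_all add: l_def)
  moreover have "l \<noteq> 0" using cosh c2 by auto
  ultimately have l: "l > 0" by simp
  obtain R' where R': "\<forall>p\<in>hyperboloid. \<exists>T\<in>\<Lambda>. snd (T p) \<le> R'" using \<Lambda>_cobounded by blast
  have "\<exists>M :: 'n hyperbolic set set. compact_hyperbolic_manifold M \<and> systole M setdist = l"
  proof (rule compact_manifold_of_lorentz_group[OF \<Lambda>_lorentz \<Lambda>_id \<Lambda>_comp \<Lambda>_inverse l _ _
        base_hyperboloid direction_orthonormal translation_mem translation_axis[OF cosh l]])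
    show "p \<bullet>\<^sub>M A p \<le> - cosh l" if "A \<in> \<Lambda>" "A \<noteq> id" "p \<in> hyperboloid" for A p
      unfolding cosh by (rule \<Lambda>_displacement[OF that])
    show "\<exists>A\<in>\<Lambda>. snd (A p) \<le> R'" if "p \<in> hyperboloid" for p using R' that by blast
  qed
  thus ?thesis by (simp add: l_def)
qed

text \<open>
  The two hyperplanes are orthogonal to the vectors \<open>e\<close> and \<open>a * e + e\<^sub>0\<close>, which have norms \<open>1\<close> and
  \<open>a\<^sup>2 - sqrt 2\<close> and pairing \<open>a\<close>, so that the hyperbolic cosine of their distance tends to one as
  \<open>a\<close> grows. If two hyperplanes in the orbits of these under a congruence subgroup of large level
  were closer than that, the pairing of their normals would equal the pairing of the original ones,
  and they would coincide or have exactly the original distance.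
\<close>

lemma arithmetic_wall_system:
  fixes a :: nat
  assumes a: "a \<ge> 2" and c: "c = real a / sqrt ((real a)\<^sup>2 - sqrt 2)"
  shows "\<exists>\<Gamma> \<N> R w\<^sub>1 w\<^sub>2. wall_system \<Gamma> (\<N> :: 'n::finite spacetime set) c R w\<^sub>1 w\<^sub>2"
proof -
  define k where "k = sqrt ((real a)\<^sup>2 - sqrt 2)"
  have s2: "sqrt 2 \<le> 3 / 2" by (rule real_le_lsqrt) (auto simp: power2_eq_square)
  have "2 * 2 \<le> real a * real a" using a by (intro mult_mono) auto
  hence a4: "(real a)\<^sup>2 \<ge> 4" by (simp add: power2_eq_square)
  have k2: "k\<^sup>2 = (real a)\<^sup>2 - sqrt 2" using a4 s2 by (simp add: k_def)
  have k1: "k \<ge> 1" unfolding k_def using a4 s2 by simp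
  have ck: "c * k = real a" using k1 by (simp add: c k_def[symmetric])
  have "k\<^sup>2 < (real a)\<^sup>2" by (simp add: k2)
  hence ka: "k < real a" by (rule power2_less_imp_less) simp
  have c1: "c > 1" using ka k1 by (simp add: c k_def[symmetric])
  have "(real a)\<^sup>2 \<le> (2 * k)\<^sup>2" using a4 s2 by (simp add: power_mult_distrib k2)
  hence "real a \<le> 2 * k" by (rule power2_le_imp_le) (use k1 in simp)
  hence c2: "c \<le> 2" using k1 by (simp add: c k_def[symmetric] field_simps)
  obtain e :: "real ^ 'n" where e: "e \<in> Basis" using nonempty_Basis by blast
  have ee: "e \<bullet> e = 1" using e by (simp add: inner_Basis)
  define v\<^sub>1 v\<^sub>2 :: "'n spacetime" where "v\<^sub>1 = (e, 0)" and "v\<^sub>2 = (real a *\<^sub>R e, sqrt (sqrt 2))"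
  define l\<^sub>1 l\<^sub>2 where "l\<^sub>1 = (v\<^sub>1, v\<^sub>1)" and "l\<^sub>2 = (v\<^sub>2, v\<^sub>2)"
  have l1: "l\<^sub>1 \<in> lat"
  proof (rule gens_subset_lat)
    have "v\<^sub>1 = rescale (e, 0)" by (simp add: v\<^sub>1_def rescale_def)
    thus "l\<^sub>1 \<in> gens" unfolding l\<^sub>1_def gens_def using e by (auto simp: Basis_prod_def)
  qed
  have l2: "l\<^sub>2 \<in> lat"
  proof -
    have "(rescale (0, 1), rescale (0, 1)) \<in> (lat :: ('n spacetime \<times> _) set)"
      by (rule gens_subset_lat) (auto simp: gens_def Basis_prod_def)
    hence "of_int (int a) *\<^sub>R l\<^sub>1 + (rescale (0, 1), rescale (0, 1)) \<in> lat"
      by (intro lat_add lat_scale l1)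
    also have "of_int (int a) *\<^sub>R l\<^sub>1 + (rescale (0, 1), rescale (0, 1)) = l\<^sub>2"
      by (simp add: l\<^sub>1_def l\<^sub>2_def v\<^sub>1_def v\<^sub>2_def rescale_def)
    finally show ?thesis .
  qed
  have v: "v\<^sub>1 \<bullet>\<^sub>M v\<^sub>1 = 1" "v\<^sub>1 \<bullet>\<^sub>M v\<^sub>2 = real a" "v\<^sub>2 \<bullet>\<^sub>M v\<^sub>1 = real a" "v\<^sub>2 \<bullet>\<^sub>M v\<^sub>2 = k\<^sup>2"
    "v\<^sub>1 \<bullet> v\<^sub>1 = 1" "v\<^sub>2 \<bullet> v\<^sub>2 = (real a)\<^sup>2 + sqrt 2"
    unfolding k2 by (simp_all add: v\<^sub>1_def v\<^sub>2_def minkowski_def ee power2_eq_square)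
  \<comment> \<open>the two lattice vectors, with the norms of their first components\<close>
  define U where "U = {(l\<^sub>1, 1 :: real), (l\<^sub>2, k)}"
  \<comment> \<open>a bound for all pairings of these vectors and for the squared norms of their conjugates\<close>
  define B where "B = (real a)\<^sup>2 + 2"
  have U: "l \<in> lat" "fst l \<bullet>\<^sub>M fst l = \<kappa>\<^sup>2" "\<kappa> \<ge> 1" "\<kappa> \<le> real a" "(norm (snd l))\<^sup>2 \<le> B" if "(l, \<kappa>) \<in> U" for l \<kappa>
    using that l1 l2 k1 ka a v s2 a4 by (auto simp: U_def l\<^sub>1_def l\<^sub>2_def B_def power2_norm_eq_inner)
  have UU: "(l, \<kappa>) = (l', \<kappa>') \<or> fst l \<bullet>\<^sub>M fst l' = c * \<kappa> * \<kappa>'" "\<bar>fst l \<bullet>\<^sub>M fst l'\<bar> \<le> B"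
    if "(l, \<kappa>) \<in> U" "(l', \<kappa>') \<in> U" for l \<kappa> l' \<kappa>'
  proof -
    show "(l, \<kappa>) = (l', \<kappa>') \<or> fst l \<bullet>\<^sub>M fst l' = c * \<kappa> * \<kappa>'"
      using that v ck unfolding U_def l\<^sub>1_def l\<^sub>2_def by (elim insertE emptyE) simp_all
    have "real a * 1 \<le> real a * real a" using a by (intro mult_left_mono) auto
    hence "real a \<le> (real a)\<^sup>2" by (simp add: power2_eq_square)
    moreover have "k\<^sup>2 \<le> (real a)\<^sup>2" by (simp add: k2)
    moreover have "0 \<le> k\<^sup>2" "0 \<le> real a" by simp_all
    ultimately have "\<bar>1\<bar> \<le> B" "\<bar>real a\<bar> \<le> B" "\<bar>k\<^sup>2\<bar> \<le> B"
      using a4 unfolding B_def by linarith+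
    thus "\<bar>fst l \<bullet>\<^sub>M fst l'\<bar> \<le> B"
      using that v unfolding U_def l\<^sub>1_def l\<^sub>2_def by (elim insertE emptyE) simp_all
  qed
  obtain N0 where N0: "\<And>N A p. N0 \<le> N \<Longrightarrow> A \<in> congruence_group N \<Longrightarrow> (p :: 'n spacetime) \<in> hyperboloid \<Longrightarrow>
      A \<noteq> id \<Longrightarrow> p \<bullet>\<^sub>M A p < - (2 * c\<^sup>2 - 1)"
    using congruence_displacement[of "2 * c\<^sup>2 - 1"] by blast
  obtain N1 :: nat where N1: "3 * B < real N1" using reals_Archimedean2 by blast
  define N where "N = max N0 (Suc N1)"
  have N: "N0 \<le> N" "3 * B < real N" "N > 0" using N1 by (auto simp: N_def)
  define \<Gamma> where "\<Gamma> = (congruence_group N :: ('n spacetime \<Rightarrow> 'n spacetime) set)"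
  obtain R where R: "\<And>p. p \<in> hyperboloid \<Longrightarrow> \<exists>A\<in>\<Gamma>. snd (A p) \<le> R"
    using congruence_group_cobounded[OF N(3), where 'n = 'n] unfolding \<Gamma>_def by blast
  have lor: "A \<in> lorentz" if "A \<in> \<Gamma>" for A using that congruence_group_lorentz by (auto simp: \<Gamma>_def)
  define \<N> where "\<N> = {(s / \<kappa>) *\<^sub>R A (fst l) |s \<kappa> A l. (s = 1 \<or> s = -1) \<and> A \<in> \<Gamma> \<and> (l, \<kappa>) \<in> U}"
  have \<N>I: "(s / \<kappa>) *\<^sub>R A (fst l) \<in> \<N>" if "s = 1 \<or> s = -1" "A \<in> \<Gamma>" "(l, \<kappa>) \<in> U" for s \<kappa> A l
    using that unfolding \<N>_def by blast
  have \<N>E: thesis if "w \<in> \<N>" "\<And>s \<kappa> A l. s = 1 \<or> s = -1 \<Longrightarrow> A \<in> \<Gamma> \<Longrightarrow> (l, \<kappa>) \<in> U \<Longrightarrow> w = (s / \<kappa>) *\<^sub>R A (fst l) \<Longrightarrow> thesis"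
    for w thesis using that unfolding \<N>_def by blast
  have id: "id \<in> \<Gamma>" by (simp add: \<Gamma>_def congruence_group_id)
  have "wall_system \<Gamma> \<N> c R (- v\<^sub>1) ((1 / k) *\<^sub>R v\<^sub>2)"
  proof
    show "\<Gamma> \<subseteq> lorentz" "id \<in> \<Gamma>" "c > 1" using lor id c1 by auto
    show "A \<circ> A' \<in> \<Gamma>" if "A \<in> \<Gamma>" "A' \<in> \<Gamma>" for A A' using that by (simp add: \<Gamma>_def congruence_group_comp)
    show "\<exists>A'\<in>\<Gamma>. A' \<circ> A = id \<and> A \<circ> A' = id" if "A \<in> \<Gamma>" for A
      using that congruence_group_inverse by (simp add: \<Gamma>_def)
    show "p \<bullet>\<^sub>M A p \<le> - (2 * c\<^sup>2 - 1)" if "A \<in> \<Gamma>" "A \<noteq> id" "p \<in> hyperboloid" for A p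
      using N0[OF N(1), of A p] that by (simp add: \<Gamma>_def)
    show "\<exists>A\<in>\<Gamma>. snd (A p) \<le> R" if "p \<in> hyperboloid" for p by (rule R[OF that])
    show "w \<bullet>\<^sub>M w = 1" if "w \<in> \<N>" for w
    proof (rule \<N>E[OF that])
      fix s \<kappa> :: real and A l assume *: "s = 1 \<or> s = -1" "A \<in> \<Gamma>" "(l, \<kappa>) \<in> U" "w = (s / \<kappa>) *\<^sub>R A (fst l)"
      have "w \<bullet>\<^sub>M w = (s * s) * \<kappa>\<^sup>2 / (\<kappa> * \<kappa>)"
        using lorentz_minkowski[OF lor[OF *(2)], of "fst l" "fst l"] U(2)[OF *(3)] by (simp add: *(4) minkowski_simps)
      thus "w \<bullet>\<^sub>M w = 1" using *(1) U(3)[OF *(3)] by (auto simp: power2_eq_square)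
    qed
    show "- w \<in> \<N>" if "w \<in> \<N>" for w
    proof (rule \<N>E[OF that])
      fix s \<kappa> :: real and A l assume *: "s = 1 \<or> s = -1" "A \<in> \<Gamma>" "(l, \<kappa>) \<in> U" "w = (s / \<kappa>) *\<^sub>R A (fst l)"
      show "- w \<in> \<N>" using \<N>I[of "- s" A l \<kappa>] * by auto
    qed
    show "A w \<in> \<N>" if "A \<in> \<Gamma>" "w \<in> \<N>" for A w
    proof (rule \<N>E[OF that(2)])
      fix s \<kappa> :: real and A' l assume *: "s = 1 \<or> s = -1" "A' \<in> \<Gamma>" "(l, \<kappa>) \<in> U" "w = (s / \<kappa>) *\<^sub>R A' (fst l)"
      have "A \<circ> A' \<in> \<Gamma>" using that(1) *(2) by (simp add: \<Gamma>_def congruence_group_comp)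
      moreover have "A w = (s / \<kappa>) *\<^sub>R (A \<circ> A') (fst l)"
        using linear_cmul[OF lorentz_linear[OF lor[OF that(1)]]] by (simp add: *(4))
      ultimately show "A w \<in> \<N>" using \<N>I *(1,3) by metis
    qed
    show "c \<le> \<bar>w \<bullet>\<^sub>M w'\<bar>" if ww: "w \<in> \<N>" "w' \<in> \<N>" "w' \<noteq> w" "w' \<noteq> - w" for w w'
    proof (rule ccontr)
      assume "\<not> ?thesis"
      hence lt: "\<bar>w \<bullet>\<^sub>M w'\<bar> < c" by simp
      obtain s \<kappa> A l where w: "s = 1 \<or> s = -1" "A \<in> \<Gamma>" "(l, \<kappa>) \<in> U" "w = (s / \<kappa>) *\<^sub>R A (fst l)" using \<N>E[OF ww(1)] .
      obtain s' \<kappa>' A' l' where w': "s' = 1 \<or> s' = -1" "A' \<in> \<Gamma>" "(l', \<kappa>') \<in> U" "w' = (s' / \<kappa>') *\<^sub>R A' (fst l')" using \<N>E[OF ww(2)] .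
      obtain A'' where A'': "A'' \<in> \<Gamma>" "A'' \<circ> A' = id" "A' \<circ> A'' = id"
        using congruence_group_inverse w'(2) unfolding \<Gamma>_def by blast
      define P where "P = A'' \<circ> A"
      have "P \<in> congruence_group N" unfolding P_def using congruence_group_comp A''(1) w(2) unfolding \<Gamma>_def by blast
      then obtain Q where Q: "congruence_pair N P Q" by (auto simp: congruence_group_def congruence_isometries_def)
      have \<kappa>: "\<kappa> \<ge> 1" "\<kappa>' \<ge> 1" "\<kappa> \<le> real a" "\<kappa>' \<le> real a" using U(3,4) w(3) w'(3) by blast+
      have "A (fst l) \<bullet>\<^sub>M A' (fst l') = A'' (A (fst l)) \<bullet>\<^sub>M A'' (A' (fst l'))"
        using lorentz_minkowski[OF lor[OF A''(1)]] by simp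
      also have "\<dots> = P (fst l) \<bullet>\<^sub>M fst l'" using A''(2) by (simp add: P_def pointfree_idE)
      finally have "w \<bullet>\<^sub>M w' = s * s' * (P (fst l) \<bullet>\<^sub>M fst l') / (\<kappa> * \<kappa>')"
        by (simp add: w(4) w'(4) minkowski_simps mult_ac)
      hence "\<bar>w \<bullet>\<^sub>M w'\<bar> = \<bar>P (fst l) \<bullet>\<^sub>M fst l'\<bar> / (\<kappa> * \<kappa>')"
        using w(1) w'(1) \<kappa> by (auto simp: abs_mult)
      moreover have "\<kappa> * \<kappa>' > 0" using \<kappa> by simp
      ultimately have small: "\<bar>P (fst l) \<bullet>\<^sub>M fst l'\<bar> < c * \<kappa> * \<kappa>'"
        using lt by (simp add: pos_divide_less_eq mult.assoc)
      also have "c * \<kappa> * \<kappa>' \<le> 2 * real a * real a"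
        using c2 c1 \<kappa> by (intro mult_mono) auto
      finally have "\<bar>P (fst l) \<bullet>\<^sub>M fst l'\<bar> \<le> 2 * B" by (simp add: B_def power2_eq_square)
      hence b1: "\<bar>P (fst l) \<bullet>\<^sub>M fst l'\<bar> + \<bar>fst l \<bullet>\<^sub>M fst l'\<bar> \<le> 3 * B"
        using UU(2)[OF w(3) w'(3)] by simp
      have B0: "B \<ge> 0" by (simp add: B_def)
      have "2 * norm (snd l) * norm (snd l') \<le> (norm (snd l))\<^sup>2 + (norm (snd l'))\<^sup>2"
        using sum_squares_bound[of "norm (snd l)" "norm (snd l')"] .
      hence b2: "2 * norm (snd l) * norm (snd l') \<le> 3 * B"
        using U(5)[OF w(3)] U(5)[OF w'(3)] B0 by linarith
      note eq = congruence_pairing_eq[OF Q U(1)[OF w(3)] U(1)[OF w'(3)] b1 b2 N(2)]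
      show False
      proof (cases "(l, \<kappa>) = (l', \<kappa>')")
        case True
        hence "P (fst l) = fst l" using congruence_fixes[OF Q U(1)[OF w(3)]] eq(2) by simp
        hence "A' (P (fst l)) = A' (fst l)" by simp
        hence "A (fst l) = A' (fst l)" using A''(3) by (simp add: P_def pointfree_idE)
        hence "w' = (s' / \<kappa>) *\<^sub>R A (fst l)" using True w'(4) by simp
        thus False using w(1,4) w'(1) ww(3,4) by auto
      next
        case False
        hence "fst l \<bullet>\<^sub>M fst l' = c * \<kappa> * \<kappa>'" using UU(1)[OF w(3) w'(3)] by blast
        thus False using small eq(1) by simp
      qed
    qed
    show "finite {w \<in> \<N>. \<bar>snd w\<bar> \<le> b}" for b
    proof (rule finite_subset)
      define r where "r = (\<lambda>(l :: 'n spacetime \<times> 'n spacetime, \<kappa>). sqrt (\<kappa>\<^sup>2 + 2 * (\<kappa> * b)\<^sup>2 + (norm (snd l))\<^sup>2))"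
      define S where "S u = {m \<in> lat. lnorm ((0, 1) :: 'n spacetime) m \<le> r u}" for u
      let ?F = "(\<Union>s\<in>{1, -1}. \<Union>u\<in>U. (\<lambda>m. (s / snd u) *\<^sub>R fst m) ` S u)"
      show "finite ?F"
        unfolding S_def U_def by (intro finite_UN_I finite_imageI finite_lnorm_le origin_in_hyperboloid) auto
      show "{w \<in> \<N>. \<bar>snd w\<bar> \<le> b} \<subseteq> ?F"
      proof
        fix w assume "w \<in> {w \<in> \<N>. \<bar>snd w\<bar> \<le> b}"
        hence wN: "w \<in> \<N>" and w: "\<bar>snd w\<bar> \<le> b" by simp_all
        obtain s \<kappa> A l where *: "s = 1 \<or> s = -1" "A \<in> \<Gamma>" "(l, \<kappa>) \<in> U" "w = (s / \<kappa>) *\<^sub>R A (fst l)" using \<N>E[OF wN] .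
        obtain Q where Q: "congruence_pair N A Q"
          using *(2) by (auto simp: \<Gamma>_def congruence_group_def congruence_isometries_def)
        define m where "m = map_prod A Q l"
        have m: "m \<in> lat" unfolding m_def by (rule congruence_pairD(7)[OF Q U(1)[OF *(3)]])
        have \<kappa>: "\<kappa> > 0" using U(3)[OF *(3)] by simp
        have "\<bar>snd (A (fst l))\<bar> = \<kappa> * \<bar>snd w\<bar>" using *(1) \<kappa> by (auto simp: *(4) abs_mult)
        also have "\<dots> \<le> \<kappa> * b" using w \<kappa> by simp
        finally have "\<bar>snd (A (fst l))\<bar>\<^sup>2 \<le> (\<kappa> * b)\<^sup>2" by (intro power_mono) auto
        moreover have "(norm (snd m))\<^sup>2 = (norm (snd l))\<^sup>2"
          using congruence_pairD(4)[OF Q] by (simp add: m_def power2_norm_eq_inner)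
        moreover have "majorant (0, 1) (fst m) = \<kappa>\<^sup>2 + 2 * (snd (A (fst l)))\<^sup>2"
          using congruence_pairD(2)[OF Q] U(2)[OF *(3)] by (simp add: m_def majorant_def)
        ultimately have "lnorm (0, 1) m \<le> r (l, \<kappa>)"
          unfolding lnorm_def r_def by simp
        hence "m \<in> S (l, \<kappa>)" using m by (simp add: S_def)
        moreover have "w = (s / snd (l, \<kappa>)) *\<^sub>R fst m" by (simp add: *(4) m_def)
        ultimately show "w \<in> ?F" using *(1,3) by blast
      qed
    qed
    have "(-1 / 1) *\<^sub>R id (fst l\<^sub>1) \<in> \<N>" by (intro \<N>I id) (auto simp: U_def)
    thus "- v\<^sub>1 \<in> \<N>" by (simp add: l\<^sub>1_def)
    have "(1 / k) *\<^sub>R id (fst l\<^sub>2) \<in> \<N>" by (intro \<N>I id) (auto simp: U_def)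
    thus "(1 / k) *\<^sub>R v\<^sub>2 \<in> \<N>" by (simp add: l\<^sub>2_def)
    show "(- v\<^sub>1) \<bullet>\<^sub>M ((1 / k) *\<^sub>R v\<^sub>2) = - c"
      by (simp add: minkowski_simps v c k_def)
    show "0 < snd (- v\<^sub>1 + (1 / k) *\<^sub>R v\<^sub>2)"
      using k1 by (simp add: v\<^sub>1_def v\<^sub>2_def)
  qed
  thus ?thesis by blast
qed

theorem theorem1p1:
  fixes \<epsilon> :: real
  assumes "CARD('n::finite) \<ge> 2" and "\<epsilon> > 0"
  shows "\<exists>M :: 'n hyperbolic set set. compact_hyperbolic_manifold M \<and> systole M setdist < \<epsilon>"
proof -
  define \<delta> where "\<delta> = cosh \<epsilon> - 1"
  have \<delta>: "\<delta> > 0" using cosh_real_strict_mono[of 0 \<epsilon>] assms(2) by (simp add: \<delta>_def)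
  \<comment> \<open>so large that \<open>2 * c\<^sup>2 - 2 = 2 * sqrt 2 / (a\<^sup>2 - sqrt 2)\<close> is smaller than \<open>\<delta>\<close>\<close>
  obtain a0 :: nat where a0: "3 / \<delta> < real a0" using reals_Archimedean2 by blast
  define a where "a = a0 + 2"
  have a: "a \<ge> 2" "3 < \<delta> * real a" using a0 \<delta> by (simp_all add: a_def field_simps)
  define c where "c = real a / sqrt ((real a)\<^sup>2 - sqrt 2)"
  obtain \<Gamma> \<N> R w\<^sub>1 w\<^sub>2 where "wall_system \<Gamma> (\<N> :: 'n::finite spacetime set) c R w\<^sub>1 w\<^sub>2"
    using arithmetic_wall_system[OF a(1) c_def] by blast
  then interpret wall_system \<Gamma> \<N> c R w\<^sub>1 w\<^sub>2 .
  obtain M :: "'n hyperbolic set set" where M: "compact_hyperbolic_manifold M" "systole M setdist = arcosh (2 * c\<^sup>2 - 1)"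
    using doubled_manifold by blast
  have s2: "sqrt 2 \<le> 3 / 2" by (rule real_le_lsqrt) (auto simp: power2_eq_square)
  have "2 * real a \<le> real a * real a" using a(1) by (intro mult_right_mono) auto
  hence big: "real a \<le> (real a)\<^sup>2 - sqrt 2" using s2 a(1) unfolding power2_eq_square by linarith
  hence pos: "(real a)\<^sup>2 - sqrt 2 > 0" using a(1) by linarith
  have "c\<^sup>2 = (real a)\<^sup>2 / ((real a)\<^sup>2 - sqrt 2)" using pos by (simp add: c_def power_divide)
  hence "2 * c\<^sup>2 - 2 = 2 * sqrt 2 / ((real a)\<^sup>2 - sqrt 2)" using pos by (simp add: field_simps)
  also have "\<dots> < \<delta>"
  proof -
    have "2 * sqrt 2 < \<delta> * real a" using s2 a(2) by linarith
    also have "\<dots> \<le> \<delta> * ((real a)\<^sup>2 - sqrt 2)" using big \<delta> by (intro mult_left_mono) auto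
    finally show ?thesis using pos by (simp add: field_simps)
  qed
  finally have "2 * c\<^sup>2 - 1 < cosh \<epsilon>" by (simp add: \<delta>_def)
  moreover have c2: "2 * c\<^sup>2 - 1 \<ge> 1" using one_less_power[OF c, of 2] by simp
  ultimately have "cosh (arcosh (2 * c\<^sup>2 - 1)) < cosh \<epsilon>" by simp
  hence "arcosh (2 * c\<^sup>2 - 1) < \<epsilon>"
    using c2 assms(2) by (subst (asm) cosh_real_nonneg_less_iff) auto
  thus ?thesis using M by auto
qed

end
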